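(* Let $p,q\geq 2$ be integers that are multiplicatively independent, i.e. there are no positive integers $r,s$ with $p^r=q^s$. Let $\mathbb{Z}^2$ act on the additive group $\mathbb{Z}[\frac{1}{pq}]$ by $\alpha_{(n,m)}(x):=p^nq^mx$ for $n,m\in\mathbb{Z}$ and $x\in\mathbb{Z}[\frac{1}{pq}]$, and let $\mathbb{Z}[\frac{1}{pq}]\rtimes\mathbb{Z}^2$ be the corresponding semidirect product. Then the group $\mathbb{Z}[\frac{1}{pq}]\rtimes\mathbb{Z}^2$ is algebraically $\mathrm{C}^*$-unique, i.e. its complex group ring $\mathbb{C}\big[\mathbb{Z}[\frac{1}{pq}]\rtimes\mathbb{Z}^2\big]$ admits a unique $\mathrm{C}^*$-norm.
   Context: $\mathbb{Z}[\frac{1}{pq}]$ denotes the additive group $\{\frac{a}{(pq)^n}\in\mathbb{Q}: a\in\mathbb{Z},\ n\in\mathbb{N}\}$, where $\mathbb{N}=\{1,2,3,\dots\}$. For a (discrete) group $G$, the complex group ring $\mathbb{C}[G]$ is a $*$-algebra with involution determined by $(\lambda g)^*=\overline{\lambda}g^{-1}$ for $\lambda\in\mathbb{C}$, $g\in G$. A $\mathrm{C}^*$-norm on $\mathbb{C}[G]$ is a submultiplicative norm $\|\cdot\|$ (a genuine norm, not merely a seminorm) satisfying $\|x^*x\|=\|x\|^2$ for all $x\in\mathbb{C}[G]$. A group $G$ is called algebraically $\mathrm{C}^*$-unique if $\mathbb{C}[G]$ admits a unique $\mathrm{C}^*$-norm. *)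

theory Defs
  imports Complex_Main "HOL-Algebra.Ring" "HOL-Algebra.Elementary_Groups"
begin

text \<open>Elements of the group ring of \<open>G\<close> are the finitely supported complex functions on
  \<open>carrier G\<close>, extended by \<open>0\<close> outside the carrier.\<close>

definition group_algebra :: "('a, 'b) monoid_scheme \<Rightarrow> ('a \<Rightarrow> complex) ring" where
  "group_algebra G =
    \<lparr>carrier = {f. finite {x. f x \<noteq> 0} \<and> {x. f x \<noteq> 0} \<subseteq> carrier G},
     mult = (\<lambda>f g x. \<Sum>(a, b)\<in>{(a, b). f a \<noteq> 0 \<and> g b \<noteq> 0 \<and> a \<otimes>\<^bsub>G\<^esub> b = x}. f a * g b),
     one = (\<lambda>x. if x = \<one>\<^bsub>G\<^esub> then 1 else 0),
     zero = (\<lambda>_. 0),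
     add = (\<lambda>f g x. f x + g x)\<rparr>"

definition group_algebra_star :: "('a, 'b) monoid_scheme \<Rightarrow> ('a \<Rightarrow> complex) \<Rightarrow> 'a \<Rightarrow> complex" where
  "group_algebra_star G f = (\<lambda>x. if x \<in> carrier G then cnj (f (inv\<^bsub>G\<^esub> x)) else 0)"

definition is_Cstar_norm ::
    "('a, 'b) monoid_scheme \<Rightarrow> (('a \<Rightarrow> complex) \<Rightarrow> real) \<Rightarrow> bool" where
  "is_Cstar_norm G N \<longleftrightarrow>
    (let A = group_algebra G in
      (\<forall>f\<in>carrier A. 0 \<le> N f \<and> (N f = 0 \<longleftrightarrow> f = \<zero>\<^bsub>A\<^esub>)) \<and>
      (\<forall>f\<in>carrier A. \<forall>c. N (\<lambda>x. c * f x) = cmod c * N f) \<and>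
      (\<forall>f\<in>carrier A. \<forall>g\<in>carrier A. N (f \<oplus>\<^bsub>A\<^esub> g) \<le> N f + N g) \<and>
      (\<forall>f\<in>carrier A. \<forall>g\<in>carrier A. N (f \<otimes>\<^bsub>A\<^esub> g) \<le> N f * N g) \<and>
      (\<forall>f\<in>carrier A. N (group_algebra_star G f \<otimes>\<^bsub>A\<^esub> f) = (N f)\<^sup>2))"

text \<open>Norms are total functions in HOL; extensionality fixes their irrelevant values outside
  the group ring, so that uniqueness only concerns the values on the group ring.\<close>

definition algebraically_Cstar_unique :: "('a, 'b) monoid_scheme \<Rightarrow> bool" where
  "algebraically_Cstar_unique G \<longleftrightarrow>
    (\<exists>!N. N \<in> extensional (carrier (group_algebra G)) \<and> is_Cstar_norm G N)"

definition semidirect_product ::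
    "('n, 'c) monoid_scheme \<Rightarrow> ('h, 'd) monoid_scheme \<Rightarrow> ('h \<Rightarrow> 'n \<Rightarrow> 'n) \<Rightarrow> ('n \<times> 'h) monoid" where
  "semidirect_product N H \<alpha> =
    \<lparr>carrier = carrier N \<times> carrier H,
     mult = (\<lambda>(x, h) (y, k). (x \<otimes>\<^bsub>N\<^esub> \<alpha> h y, h \<otimes>\<^bsub>H\<^esub> k)),
     one = (\<one>\<^bsub>N\<^esub>, \<one>\<^bsub>H\<^esub>)\<rparr>"

definition Z_inverting :: "int \<Rightarrow> rat monoid" where
  "Z_inverting k =
    \<lparr>carrier = {of_int a / of_int k ^ n | a n. n \<ge> 1}, mult = (+), one = 0\<rparr>"

definition pq_action :: "int \<Rightarrow> int \<Rightarrow> int \<times> int \<Rightarrow> rat \<Rightarrow> rat" where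
  "pq_action p q = (\<lambda>(n, m) x. of_int p powi n * of_int q powi m * x)"

lemma carrier_Z_inverting:
  "x \<in> carrier (Z_inverting k) \<longleftrightarrow> (\<exists>a n. n \<ge> 1 \<and> x = of_int a / of_int k ^ n)"
  by (auto simp: Z_inverting_def)

lemma Z_inverting_add:
  assumes "k \<noteq> 0" "x \<in> carrier (Z_inverting k)" "y \<in> carrier (Z_inverting k)"
  shows "x + y \<in> carrier (Z_inverting k)"
proof -
  from assms obtain a n b m where *: "n \<ge> 1" "x = of_int a / of_int k ^ n"
    "y = of_int b / of_int k ^ m"
    by (auto simp: carrier_Z_inverting)
  then have "x + y = of_int (a * k ^ m + b * k ^ n) / of_int k ^ (n + m)"
    using \<open>k \<noteq> 0\<close> by (simp add: add_divide_distrib power_add)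
  then show ?thesis
    unfolding carrier_Z_inverting
    using \<open>n \<ge> 1\<close> by (intro exI[of _ "a * k ^ m + b * k ^ n"] exI[of _ "n + m"]) simp
qed

lemma comm_group_Z_inverting:
  assumes "k \<noteq> 0"
  shows "comm_group (Z_inverting k)"
proof (rule comm_groupI)
  fix x y z assume "x \<in> carrier (Z_inverting k)" "y \<in> carrier (Z_inverting k)"
  then show "x \<otimes>\<^bsub>Z_inverting k\<^esub> y \<in> carrier (Z_inverting k)"
    using Z_inverting_add[OF assms] by (simp add: Z_inverting_def)
next
  show "\<one>\<^bsub>Z_inverting k\<^esub> \<in> carrier (Z_inverting k)"
    unfolding carrier_Z_inverting
    by (rule exI[of _ 0], rule exI[of _ 1]) (simp add: Z_inverting_def)
next
  fix x assume "x \<in> carrier (Z_inverting k)"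
  then obtain a n where "n \<ge> 1" "x = of_int a / of_int k ^ n"
    by (auto simp: carrier_Z_inverting)
  then have "- x \<in> carrier (Z_inverting k)"
    unfolding carrier_Z_inverting by (intro exI[of _ "- a"] exI[of _ n]) simp
  then show "\<exists>y\<in>carrier (Z_inverting k). y \<otimes>\<^bsub>Z_inverting k\<^esub> x = \<one>\<^bsub>Z_inverting k\<^esub>"
    by (rule bexI[rotated]) (simp add: Z_inverting_def)
qed (auto simp: Z_inverting_def)

lemma pq_action_closed:
  assumes "p \<noteq> 0" "q \<noteq> 0" "x \<in> carrier (Z_inverting (p * q))"
  shows "pq_action p q h x \<in> carrier (Z_inverting (p * q))"
proof -
  have mult: "of_int c * y \<in> carrier (Z_inverting (p * q))"
    if "y \<in> carrier (Z_inverting (p * q))" for c y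
  proof -
    from that obtain a n where "n \<ge> 1" "y = of_int a / of_int (p * q) ^ n"
      by (auto simp: carrier_Z_inverting)
    then show ?thesis
      unfolding carrier_Z_inverting by (intro exI[of _ "c * a"] exI[of _ n]) simp
  qed
  have inv_pq: "inverse (of_int (p * q)) * y \<in> carrier (Z_inverting (p * q))"
    if "y \<in> carrier (Z_inverting (p * q))" for y
  proof -
    from that obtain a n where "n \<ge> 1" "y = of_int a / of_int (p * q) ^ n"
      by (auto simp: carrier_Z_inverting)
    then show ?thesis
      unfolding carrier_Z_inverting
      by (intro exI[of _ a] exI[of _ "Suc n"]) (simp add: divide_inverse)
  qed
  have inv_p: "inverse (of_int p) * y \<in> carrier (Z_inverting (p * q))"
    if "y \<in> carrier (Z_inverting (p * q))" for y
    using inv_pq[OF mult[of y q]] that assms(1,2) by (simp add: field_simps)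
  have inv_q: "inverse (of_int q) * y \<in> carrier (Z_inverting (p * q))"
    if "y \<in> carrier (Z_inverting (p * q))" for y
    using inv_pq[OF mult[of y p]] that assms(1,2) by (simp add: field_simps)
  have pow: "c ^ n * y \<in> carrier (Z_inverting (p * q))"
    if "\<And>y. y \<in> carrier (Z_inverting (p * q)) \<Longrightarrow> c * y \<in> carrier (Z_inverting (p * q))"
      "y \<in> carrier (Z_inverting (p * q))" for c y n
    using that by (induction n) (auto simp: mult.assoc)
  have powi: "of_int c powi n * y \<in> carrier (Z_inverting (p * q))"
    if "\<And>y. y \<in> carrier (Z_inverting (p * q)) \<Longrightarrow>
          inverse (of_int c) * y \<in> carrier (Z_inverting (p * q))"
      "y \<in> carrier (Z_inverting (p * q))" for c n y
    unfolding power_int_def using pow[OF mult] pow[OF that(1)] that(2) by auto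
  show ?thesis
    using powi[OF inv_p powi[OF inv_q assms(3)]]
    by (simp add: pq_action_def split_def mult.assoc)
qed

lemma group_semidirect_product_pq_action:
  assumes "p \<noteq> 0" "q \<noteq> 0"
  shows "group (semidirect_product (Z_inverting (p * q)) (integer_group \<times>\<times> integer_group)
           (pq_action p q))"
proof -
  let ?Z = "Z_inverting (p * q)"
  interpret Z: comm_group ?Z
    using assms by (intro comm_group_Z_inverting) simp
  have add: "x + y \<in> carrier ?Z" if "x \<in> carrier ?Z" "y \<in> carrier ?Z" for x y
    using Z.m_closed[OF that] by (simp add: Z_inverting_def)
  have minus: "- x \<in> carrier ?Z" if x: "x \<in> carrier ?Z" for x
  proof -
    obtain y where "y \<in> carrier ?Z" "y \<otimes>\<^bsub>?Z\<^esub> x = \<one>\<^bsub>?Z\<^esub>"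
      using Z.l_inv_ex[OF x] by blast
    then show ?thesis
      by (simp add: Z_inverting_def eq_neg_iff_add_eq_0[symmetric])
  qed
  have simps: "mult ?Z = (+)" "one ?Z = 0"
    by (simp_all add: Z_inverting_def)
  have zero: "0 \<in> carrier ?Z"
    using Z.one_closed by (simp add: simps)
  have act0: "pq_action p q (0, 0) x = x" "pq_action p q h 0 = 0" for h x
    by (simp_all add: pq_action_def split_def)
  have act_add: "pq_action p q h (x + y) = pq_action p q h x + pq_action p q h y" for h x y
    by (simp add: pq_action_def split_def distrib_left)
  have act_act: "pq_action p q (a, b) (pq_action p q (c, d) x) = pq_action p q (a + c, b + d) x"
    for a b c d x
    using assms by (simp add: pq_action_def power_int_add)
  show ?thesis
  proof (rule groupI, goal_cases)
    case (5 x)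
    obtain z n m where x: "x = (z, n, m)" by (cases x) auto
    have "(pq_action p q (- n, - m) (- z), - n, - m) \<in> carrier ?Z \<times> UNIV"
      using 5 assms by (auto simp: x semidirect_product_def intro!: pq_action_closed minus)
    then show ?case
      by (intro bexI[of _ "(pq_action p q (- n, - m) (- z), - n, - m)"])
        (auto simp: x semidirect_product_def simps act_add[symmetric] act0)
  qed (use assms in \<open>auto simp: semidirect_product_def simps act0 act_add act_act zero add.assoc
         intro!: add pq_action_closed\<close>)
qed

lemma group_algebra_single_mult:
  fixes c d :: complex
  shows "(\<lambda>x. if x = g then c else 0) \<otimes>\<^bsub>group_algebra G\<^esub> (\<lambda>x. if x = h then d else 0) =
    (\<lambda>x. if x = g \<otimes>\<^bsub>G\<^esub> h then c * d else 0)"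
proof
  fix x
  have "{(a, b). (if a = g then c else 0) \<noteq> 0 \<and> (if b = h then d else 0) \<noteq> 0 \<and> a \<otimes>\<^bsub>G\<^esub> b = x} =
    (if c \<noteq> 0 \<and> d \<noteq> 0 \<and> g \<otimes>\<^bsub>G\<^esub> h = x then {(g, h)} else {})"
    by (auto split: if_splits)
  then show "((\<lambda>x. if x = g then c else 0) \<otimes>\<^bsub>group_algebra G\<^esub> (\<lambda>x. if x = h then d else 0)) x =
    (if x = g \<otimes>\<^bsub>G\<^esub> h then c * d else 0)"
    by (auto simp: group_algebra_def)
qed

lemma (in group) group_algebra_star_single:
  assumes "g \<in> carrier G"
  shows "group_algebra_star G (\<lambda>x. if x = g then c else 0) = (\<lambda>x. if x = inv g then cnj c else 0)"
  using assms by (auto simp: group_algebra_star_def fun_eq_iff)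

end

theory Submission
  imports Defs "HOL-Analysis.Analysis" "HOL-Real_Asymp.Real_Asymp" "HOL-Number_Theory.Residues"
begin

text \<open>Write \<open>G = \<Gamma> \<rtimes> \<int>\<^sup>2\<close> and attach to \<open>f\<close> in the group ring the almost periodic functions
  \<open>f\<^sub>t(\<theta>) = \<Sum>\<^sub>x f(x, t) e(\<theta> x)\<close> for \<open>t \<in> \<int>\<^sup>2\<close>. Existence is witnessed by the reduced norm. For uniqueness
  let \<open>N\<close> be any \<open>C\<^sup>*\<close>-norm.

  On elements supported in \<open>\<int> \<subseteq> \<Gamma>\<close>, polynomial growth gives \<open>N f \<le> sup \<bar>f\<^sub>0\<bar>\<close>, and the set of those
  \<open>\<theta>\<close> at which \<open>\<bar>f\<^sub>0(\<theta>)\<bar> \<le> N f\<close> for all such \<open>f\<close> is closed and invariant under multiplication by \<open>p\<close>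
  and \<open>q\<close>. It is not finite modulo 1, since otherwise some nonzero trigonometric polynomial would
  have norm 0; by Furstenberg's theorem it is everything, so \<open>N f = sup \<bar>f\<^sub>0\<bar>\<close>. Conjugation by
  \<open>\<int>\<^sup>2\<close> extends this to \<open>\<Gamma>\<close>.

  Since nontrivial elements of \<open>\<int>\<^sup>2\<close> fix only countably many \<open>\<theta>\<close> modulo 1, compressing \<open>f\<close> by peaking functions
  shows \<open>\<bar>f\<^sub>t(\<theta>)\<bar> \<le> N f\<close>. Hence two \<open>C\<^sup>*\<close>-norms differ on \<open>f\<close> at most by the factor
  \<open>\<bar>{t. f\<^sub>t \<noteq> 0}\<bar>\<close>, which grows polynomially along the powers of \<open>f\<^sup>* f\<close> and therefore disappears by the
  \<open>C\<^sup>*\<close>-identity.\<close>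

section \<open>The group ring\<close>

text \<open>The characters \<open>x -> e (\<theta> x)\<close> with real \<open>\<theta>\<close> are
  dense in the compact dual of \<open>\<Gamma>\<close>. Suprema over the line are therefore the
  norms of the C*-algebra of \<open>\<Gamma>\<close>, and conjugation by an element of Z^2 becomes
  dilation of \<open>\<theta>\<close>. The arithmetic obstacle is that a C*-norm on the group ring
  of \<open>\<Gamma>\<close> could a priori be the supremum over a smaller closed invariant set.
  Furstenberg's theorem, which excludes this, speaks about the circle; hence the detour through Z,
  where multiplication by p and q is available but division is not. Everything stays inside the
  group ring, without completions or Gelfand theory: upper bounds come from the C*-identity applied
  to high powers, lower bounds from explicit approximations. In the final comparison only degrees in
  Z^2 may be counted, because the group itself has exponential growth; this count takes the place of
  amenability.\<close>

definition supp :: "('a \<Rightarrow> complex) \<Rightarrow> 'a set" where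
  "supp f = {x. f x \<noteq> 0}"

text \<open>The integral of \<open>\<phi>\<close> against \<open>f\<close>, seen as a finitely
  supported complex measure. Identities in the group ring are proved by pairing both sides with an
  arbitrary \<open>\<phi>\<close>: convolution becomes an iterated pairing, and only group laws
  under \<open>\<phi>\<close> remain to be checked.\<close>

definition pairing :: "('a \<Rightarrow> complex) \<Rightarrow> ('a \<Rightarrow> complex) \<Rightarrow> complex" where
  "pairing f \<phi> = (\<Sum>x\<in>supp f. f x * \<phi> x)"

definition single :: "'a \<Rightarrow> 'a \<Rightarrow> complex" where
  "single g = (\<lambda>x. if x = g then 1 else 0)"

lemma supp_single [simp]: "supp (single g) = {g}"
  by (auto simp: supp_def single_def)

lemma pairing_superset:
  assumes "finite S" "supp f \<subseteq> S"
  shows "pairing f \<phi> = (\<Sum>x\<in>S. f x * \<phi> x)"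
  unfolding pairing_def using assms by (intro sum.mono_neutral_left) (auto simp: supp_def)

lemma pairing_single_left: "pairing (single g) \<phi> = \<phi> g"
  by (simp add: pairing_def) (simp add: single_def)

lemma pairing_single_right:
  assumes "finite (supp f)"
  shows "pairing f (single g) = f g"
proof -
  have "pairing f (single g) = (\<Sum>x\<in>insert g (supp f). f x * single g x)"
    using assms by (intro pairing_superset) auto
  also have "\<dots> = (\<Sum>x\<in>{g}. f x * single g x)"
    using assms by (intro sum.mono_neutral_right) (auto simp: single_def)
  finally show ?thesis
    by (simp add: single_def)
qed

lemma pairing_ext:
  assumes "finite (supp f)" "finite (supp g)" "\<And>\<phi>. pairing f \<phi> = pairing g \<phi>"
  shows "f = g"
  using pairing_single_right[OF assms(1)] pairing_single_right[OF assms(2)] assms(3)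
  by (metis ext)

lemma supp_add: "supp (\<lambda>x. f x + g x) \<subseteq> supp f \<union> supp g"
  by (auto simp: supp_def)

lemma pairing_add:
  assumes "finite (supp f)" "finite (supp g)"
  shows "pairing (\<lambda>x. f x + g x) \<phi> = pairing f \<phi> + pairing g \<phi>"
  using assms supp_add[of f g]
  by (simp add: pairing_superset[of "supp f \<union> supp g"] sum.distrib distrib_right)

lemma pairing_scale: "pairing (\<lambda>x. c * f x) \<phi> = c * pairing f \<phi>"
proof (cases "c = 0")
  case False
  then have "supp (\<lambda>x. c * f x) = supp f" by (simp add: supp_def)
  then show ?thesis by (simp add: pairing_def sum_distrib_left mult.assoc)
qed (simp add: pairing_def)

lemma pairing_add_right: "pairing f (\<lambda>x. \<phi> x + \<psi> x) = pairing f \<phi> + pairing f \<psi>"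
  by (simp add: pairing_def distrib_left sum.distrib)

lemma pairing_scale_right: "pairing f (\<lambda>x. c * \<phi> x) = c * pairing f \<phi>"
  by (simp add: pairing_def sum_distrib_left mult.left_commute)

lemma pairing_cong:
  assumes "supp f \<subseteq> S" "\<And>x. x \<in> S \<Longrightarrow> \<phi> x = \<psi> x"
  shows "pairing f \<phi> = pairing f \<psi>"
  using assms by (auto simp: pairing_def intro!: sum.cong)

lemma pairing_swap:
  "pairing f (\<lambda>a. pairing g (\<lambda>b. \<phi> a b)) = pairing g (\<lambda>b. pairing f (\<lambda>a. \<phi> a b))"
  unfolding pairing_def sum_distrib_left by (subst sum.swap) (simp add: mult.left_commute)

lemma cnj_pairing: "cnj (pairing f \<phi>) = (\<Sum>x\<in>supp f. cnj (f x) * cnj (\<phi> x))"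
  by (simp add: pairing_def)

lemma norm_pairing_le:
  assumes "\<And>x. x \<in> supp f \<Longrightarrow> cmod (\<phi> x) \<le> c"
  shows "cmod (pairing f \<phi>) \<le> c * (\<Sum>x\<in>supp f. cmod (f x))"
  unfolding pairing_def sum_distrib_left
  using assms by (intro sum_norm_le) (simp add: norm_mult mult.commute mult_right_mono)

lemma carrier_group_algebra:
  "f \<in> carrier (group_algebra G) \<longleftrightarrow> finite (supp f) \<and> supp f \<subseteq> carrier G"
  by (simp add: group_algebra_def supp_def)

lemma carrier_group_algebraD:
  assumes "f \<in> carrier (group_algebra G)"
  shows "finite (supp f)" "supp f \<subseteq> carrier G"
  using assms by (auto simp: carrier_group_algebra)

lemma group_algebra_simps:
  "f \<oplus>\<^bsub>group_algebra G\<^esub> g = (\<lambda>x. f x + g x)"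
  "\<zero>\<^bsub>group_algebra G\<^esub> = (\<lambda>_. 0)"
  "\<one>\<^bsub>group_algebra G\<^esub> = single \<one>\<^bsub>G\<^esub>"
  by (simp_all add: group_algebra_def single_def)

lemma mult_group_algebra_eq:
  "(f \<otimes>\<^bsub>group_algebra G\<^esub> g) x =
     (\<Sum>(a, b)\<in>{ab \<in> supp f \<times> supp g. (case ab of (a, b) \<Rightarrow> a \<otimes>\<^bsub>G\<^esub> b) = x}. f a * g b)"
  by (auto simp: group_algebra_def supp_def intro!: sum.cong)

lemma supp_mult:
  "supp (f \<otimes>\<^bsub>group_algebra G\<^esub> g) \<subseteq> (\<lambda>(a, b). a \<otimes>\<^bsub>G\<^esub> b) ` (supp f \<times> supp g)"
proof
  fix x assume "x \<in> supp (f \<otimes>\<^bsub>group_algebra G\<^esub> g)"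
  then have "(f \<otimes>\<^bsub>group_algebra G\<^esub> g) x \<noteq> 0" by (simp add: supp_def)
  then have "{ab \<in> supp f \<times> supp g. (case ab of (a, b) \<Rightarrow> a \<otimes>\<^bsub>G\<^esub> b) = x} \<noteq> {}"
    unfolding mult_group_algebra_eq by (metis (no_types, lifting) sum.empty)
  then show "x \<in> (\<lambda>(a, b). a \<otimes>\<^bsub>G\<^esub> b) ` (supp f \<times> supp g)" by auto
qed

text \<open>Convolution is the push-forward of the product measure along multiplication; the sum
  over all pairs is grouped by the fibres of the product map.\<close>

lemma pairing_mult:
  assumes "finite (supp f)" "finite (supp g)"
  shows "pairing (f \<otimes>\<^bsub>group_algebra G\<^esub> g) \<phi> = pairing f (\<lambda>a. pairing g (\<lambda>b. \<phi> (a \<otimes>\<^bsub>G\<^esub> b)))"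
proof -
  let ?m = "\<lambda>(a, b). a \<otimes>\<^bsub>G\<^esub> b"
  let ?P = "supp f \<times> supp g"
  have fin: "finite ?P" using assms by simp
  have "pairing (f \<otimes>\<^bsub>group_algebra G\<^esub> g) \<phi> =
      (\<Sum>x\<in>?m ` ?P. (f \<otimes>\<^bsub>group_algebra G\<^esub> g) x * \<phi> x)"
    using fin supp_mult[of G f g] by (intro pairing_superset) auto
  also have "\<dots> = (\<Sum>x\<in>?m ` ?P. \<Sum>ab\<in>{ab \<in> ?P. ?m ab = x}. (case ab of (a, b) \<Rightarrow> f a * (g b * \<phi> (a \<otimes>\<^bsub>G\<^esub> b))))"
    unfolding mult_group_algebra_eq sum_distrib_right
    by (intro sum.cong) (auto simp: mult.assoc)
  also have "\<dots> = (\<Sum>ab\<in>?P. case ab of (a, b) \<Rightarrow> f a * (g b * \<phi> (a \<otimes>\<^bsub>G\<^esub> b)))"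
    using sum.image_gen[OF fin, symmetric] by fast
  also have "\<dots> = pairing f (\<lambda>a. pairing g (\<lambda>b. \<phi> (a \<otimes>\<^bsub>G\<^esub> b)))"
    by (simp add: pairing_def sum_distrib_left sum.cartesian_product)
  finally show ?thesis .
qed

lemma group_algebra_scale_closed:
  assumes "f \<in> carrier (group_algebra G)"
  shows "(\<lambda>x. c * f x) \<in> carrier (group_algebra G)"
  using assms finite_subset[of "supp (\<lambda>x. c * f x)" "supp f"]
  by (auto simp: carrier_group_algebra supp_def)

lemma group_algebra_add_closed:
  assumes "f \<in> carrier (group_algebra G)" "g \<in> carrier (group_algebra G)"
  shows "(\<lambda>x. f x + g x) \<in> carrier (group_algebra G)"
  using assms supp_add[of f g] finite_subset[OF supp_add[of f g]]
  by (auto simp: carrier_group_algebra)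

lemma single_closed: "g \<in> carrier G \<Longrightarrow> single g \<in> carrier (group_algebra G)"
  by (simp add: carrier_group_algebra)

lemma group_algebra_sum_closed:
  assumes "\<And>i. i \<in> I \<Longrightarrow> f i \<in> carrier (group_algebra G)"
  shows "(\<lambda>x. \<Sum>i\<in>I. f i x) \<in> carrier (group_algebra G)"
  using assms
  by (induction I rule: infinite_finite_induct)
    (auto simp: group_algebra_add_closed, simp_all add: carrier_group_algebra supp_def)

lemma mult_add_left:
  assumes "finite (supp f)" "finite (supp g)" "finite (supp h)"
  shows "(\<lambda>x. f x + g x) \<otimes>\<^bsub>group_algebra G\<^esub> h =
    (\<lambda>x. (f \<otimes>\<^bsub>group_algebra G\<^esub> h) x + (g \<otimes>\<^bsub>group_algebra G\<^esub> h) x)"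
proof (rule pairing_ext)
  note fin = finite_subset[OF supp_mult] finite_subset[OF supp_add] finite_imageI finite_SigmaI assms
  show *: "finite (supp ((\<lambda>x. f x + g x) \<otimes>\<^bsub>group_algebra G\<^esub> h))"
    "finite (supp (\<lambda>x. (f \<otimes>\<^bsub>group_algebra G\<^esub> h) x + (g \<otimes>\<^bsub>group_algebra G\<^esub> h) x))"
    by (auto intro!: fin)
  fix \<phi>
  have "finite (supp (f \<otimes>\<^bsub>group_algebra G\<^esub> h))" "finite (supp (g \<otimes>\<^bsub>group_algebra G\<^esub> h))"
    "finite (supp (\<lambda>x. f x + g x))"
    by (auto intro!: fin)
  then show "pairing ((\<lambda>x. f x + g x) \<otimes>\<^bsub>group_algebra G\<^esub> h) \<phi> =
     pairing (\<lambda>x. (f \<otimes>\<^bsub>group_algebra G\<^esub> h) x + (g \<otimes>\<^bsub>group_algebra G\<^esub> h) x) \<phi>"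
    using assms by (simp add: pairing_add pairing_mult)
qed

lemma mult_add_right:
  assumes "finite (supp f)" "finite (supp g)" "finite (supp h)"
  shows "h \<otimes>\<^bsub>group_algebra G\<^esub> (\<lambda>x. f x + g x) =
    (\<lambda>x. (h \<otimes>\<^bsub>group_algebra G\<^esub> f) x + (h \<otimes>\<^bsub>group_algebra G\<^esub> g) x)"
proof (rule pairing_ext)
  note fin = finite_subset[OF supp_mult] finite_subset[OF supp_add] finite_imageI finite_SigmaI assms
  show *: "finite (supp (h \<otimes>\<^bsub>group_algebra G\<^esub> (\<lambda>x. f x + g x)))"
    "finite (supp (\<lambda>x. (h \<otimes>\<^bsub>group_algebra G\<^esub> f) x + (h \<otimes>\<^bsub>group_algebra G\<^esub> g) x))"
    by (auto intro!: fin)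
  fix \<phi>
  have "finite (supp (h \<otimes>\<^bsub>group_algebra G\<^esub> f))" "finite (supp (h \<otimes>\<^bsub>group_algebra G\<^esub> g))"
    "finite (supp (\<lambda>x. f x + g x))"
    by (auto intro!: fin)
  then show "pairing (h \<otimes>\<^bsub>group_algebra G\<^esub> (\<lambda>x. f x + g x)) \<phi> =
     pairing (\<lambda>x. (h \<otimes>\<^bsub>group_algebra G\<^esub> f) x + (h \<otimes>\<^bsub>group_algebra G\<^esub> g) x) \<phi>"
    using assms by (simp add: pairing_add pairing_mult pairing_add_right)
qed

lemma mult_scale_left:
  assumes "finite (supp f)" "finite (supp g)"
  shows "(\<lambda>x. c * f x) \<otimes>\<^bsub>group_algebra G\<^esub> g = (\<lambda>x. c * (f \<otimes>\<^bsub>group_algebra G\<^esub> g) x)"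
proof (rule pairing_ext)
  have sc: "finite (supp (\<lambda>x. c * u x))" if "finite (supp u)" for u :: "'a \<Rightarrow> complex"
    using that by (rule finite_subset[rotated]) (auto simp: supp_def)
  show *: "finite (supp ((\<lambda>x. c * f x) \<otimes>\<^bsub>group_algebra G\<^esub> g))"
    "finite (supp (\<lambda>x. c * (f \<otimes>\<^bsub>group_algebra G\<^esub> g) x))"
    by (auto intro!: finite_subset[OF supp_mult] finite_SigmaI sc assms)
  show "pairing ((\<lambda>x. c * f x) \<otimes>\<^bsub>group_algebra G\<^esub> g) \<phi> =
     pairing (\<lambda>x. c * (f \<otimes>\<^bsub>group_algebra G\<^esub> g) x) \<phi>" for \<phi>
    using assms sc[OF assms(1)] by (simp add: pairing_mult pairing_scale)
qed

context group
begin

abbreviation "A \<equiv> group_algebra G"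
abbreviation "st \<equiv> group_algebra_star G"

lemma mult_closed:
  assumes "f \<in> carrier A" "g \<in> carrier A"
  shows "f \<otimes>\<^bsub>A\<^esub> g \<in> carrier A"
proof -
  have "(\<lambda>(a, b). a \<otimes> b) ` (supp f \<times> supp g) \<subseteq> carrier G"
    using assms by (auto simp: carrier_group_algebra)
  moreover have "finite ((\<lambda>(a, b). a \<otimes> b) ` (supp f \<times> supp g))"
    using assms by (simp add: carrier_group_algebra)
  ultimately show ?thesis
    using supp_mult[of G f g] unfolding carrier_group_algebra by (meson finite_subset order_trans)
qed

lemma ring_group_algebra: "ring A"
proof (rule ringI)
  show "abelian_group A"
  proof (rule abelian_groupI)
    fix f assume f: "f \<in> carrier A"
    show "\<exists>y\<in>carrier A. y \<oplus>\<^bsub>A\<^esub> f = \<zero>\<^bsub>A\<^esub>"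
      using group_algebra_scale_closed[OF f, of "-1"]
      by (intro bexI[of _ "\<lambda>x. -1 * f x"]) (simp_all add: group_algebra_simps)
  next
    show "\<zero>\<^bsub>A\<^esub> \<in> carrier A"
      by (simp add: group_algebra_simps carrier_group_algebra supp_def)
  qed (simp_all add: group_algebra_simps group_algebra_add_closed add.assoc, simp add: add.commute)
  show "monoid A"
  proof (rule monoidI)
    show "\<one>\<^bsub>A\<^esub> \<in> carrier A" by (simp add: group_algebra_simps single_closed)
    fix f g h assume f: "f \<in> carrier A"
    note fs = carrier_group_algebraD[OF f]
    show "\<one>\<^bsub>A\<^esub> \<otimes>\<^bsub>A\<^esub> f = f" "f \<otimes>\<^bsub>A\<^esub> \<one>\<^bsub>A\<^esub> = f"
    proof -
      have "\<one>\<^bsub>A\<^esub> \<otimes>\<^bsub>A\<^esub> f \<in> carrier A" "f \<otimes>\<^bsub>A\<^esub> \<one>\<^bsub>A\<^esub> \<in> carrier A"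
        by (auto intro!: mult_closed f simp: group_algebra_simps single_closed)
      then have fin: "finite (supp (\<one>\<^bsub>A\<^esub> \<otimes>\<^bsub>A\<^esub> f))" "finite (supp (f \<otimes>\<^bsub>A\<^esub> \<one>\<^bsub>A\<^esub>))"
        by (simp_all add: carrier_group_algebra)
      have "pairing (\<one>\<^bsub>A\<^esub> \<otimes>\<^bsub>A\<^esub> f) \<phi> = pairing f \<phi>" for \<phi>
        unfolding group_algebra_simps using fs(1)
        by (simp add: pairing_mult pairing_single_left) (intro pairing_cong[OF fs(2)], simp)
      then show "\<one>\<^bsub>A\<^esub> \<otimes>\<^bsub>A\<^esub> f = f" by (intro pairing_ext fin fs(1))
      have "pairing (f \<otimes>\<^bsub>A\<^esub> \<one>\<^bsub>A\<^esub>) \<phi> = pairing f \<phi>" for \<phi>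
        unfolding group_algebra_simps using fs(1)
        by (simp add: pairing_mult pairing_single_left) (intro pairing_cong[OF fs(2)], simp)
      then show "f \<otimes>\<^bsub>A\<^esub> \<one>\<^bsub>A\<^esub> = f" by (intro pairing_ext fin fs(1))
    qed
    assume g: "g \<in> carrier A"
    then show "f \<otimes>\<^bsub>A\<^esub> g \<in> carrier A" using f by (rule mult_closed[rotated])
    assume h: "h \<in> carrier A"
    note gs = carrier_group_algebraD[OF g] and hs = carrier_group_algebraD[OF h]
    show "f \<otimes>\<^bsub>A\<^esub> g \<otimes>\<^bsub>A\<^esub> h = f \<otimes>\<^bsub>A\<^esub> (g \<otimes>\<^bsub>A\<^esub> h)"
    proof (rule pairing_ext)
      fix \<phi>
      have "finite (supp (f \<otimes>\<^bsub>A\<^esub> g))" "finite (supp (g \<otimes>\<^bsub>A\<^esub> h))"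
        using mult_closed f g h by (auto dest: carrier_group_algebraD(1))
      then show "pairing (f \<otimes>\<^bsub>A\<^esub> g \<otimes>\<^bsub>A\<^esub> h) \<phi> = pairing (f \<otimes>\<^bsub>A\<^esub> (g \<otimes>\<^bsub>A\<^esub> h)) \<phi>"
        using fs(1) gs(1) hs(1)
        by (simp add: pairing_mult)
          (intro pairing_cong[OF fs(2)] pairing_cong[OF gs(2)] pairing_cong[OF hs(2)], simp add: m_assoc)
    qed (use mult_closed f g h in \<open>auto dest: carrier_group_algebraD(1)\<close>)
  qed
qed (simp_all add: group_algebra_simps mult_add_left mult_add_right carrier_group_algebra)

interpretation A: ring A
  by (rule ring_group_algebra)

lemma supp_star:
  assumes "f \<in> carrier A"
  shows "supp (st f) = m_inv G ` supp f"
proof -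
  have "x \<in> m_inv G ` supp f" if "x \<in> carrier G" "f (inv x) \<noteq> 0" for x
    using that by (intro image_eqI[of _ _ "inv x"]) (auto simp: supp_def)
  then show ?thesis
    using assms by (auto simp: supp_def group_algebra_star_def carrier_group_algebra split: if_splits)
qed

lemma star_closed:
  assumes "f \<in> carrier A"
  shows "st f \<in> carrier A"
  using assms carrier_group_algebraD[OF assms] by (auto simp: carrier_group_algebra supp_star)

lemma star_star:
  assumes "f \<in> carrier A"
  shows "st (st f) = f"
proof
  fix x
  show "st (st f) x = f x"
    using carrier_group_algebraD(2)[OF assms]
    by (cases "x \<in> carrier G") (auto simp: group_algebra_star_def supp_def)
qed

lemma pairing_star:
  assumes "f \<in> carrier A"
  shows "pairing (st f) \<phi> = cnj (pairing f (\<lambda>x. cnj (\<phi> (inv x))))"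
proof -
  have "inj_on (m_inv G) (supp f)"
    using carrier_group_algebraD(2)[OF assms] by (meson inv_inj inj_on_subset)
  then have "pairing (st f) \<phi> = (\<Sum>x\<in>supp f. st f (inv x) * \<phi> (inv x))"
    unfolding pairing_def supp_star[OF assms] by (simp add: sum.reindex)
  also have "\<dots> = (\<Sum>x\<in>supp f. cnj (f x) * \<phi> (inv x))"
    using carrier_group_algebraD(2)[OF assms]
    by (intro sum.cong) (auto simp: group_algebra_star_def)
  finally show ?thesis
    by (simp add: cnj_pairing)
qed

lemma star_mult:
  assumes f: "f \<in> carrier A" and g: "g \<in> carrier A"
  shows "st (f \<otimes>\<^bsub>A\<^esub> g) = st g \<otimes>\<^bsub>A\<^esub> st f"
proof (rule pairing_ext)
  note fs = carrier_group_algebraD[OF f] and gs = carrier_group_algebraD[OF g]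
  fix \<phi>
  have "pairing (st (f \<otimes>\<^bsub>A\<^esub> g)) \<phi> =
      cnj (pairing f (\<lambda>a. pairing g (\<lambda>b. cnj (\<phi> (inv (a \<otimes> b))))))"
    by (simp only: pairing_star[OF mult_closed[OF f g]] pairing_mult[OF fs(1) gs(1)])
  also have "\<dots> = cnj (pairing f (\<lambda>a. pairing g (\<lambda>b. cnj (\<phi> (inv b \<otimes> inv a)))))"
    by (intro arg_cong[where f = cnj] pairing_cong[OF fs(2)] pairing_cong[OF gs(2)])
      (simp add: inv_mult_group)
  also have "\<dots> = cnj (pairing g (\<lambda>b. pairing f (\<lambda>a. cnj (\<phi> (inv b \<otimes> inv a)))))"
    by (simp only: pairing_swap[of f g])
  also have "\<dots> = pairing (st g \<otimes>\<^bsub>A\<^esub> st f) \<phi>"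
    by (simp add: pairing_mult[OF star_closed[OF g, THEN carrier_group_algebraD(1)]
          star_closed[OF f, THEN carrier_group_algebraD(1)]] pairing_star[OF f] pairing_star[OF g])
  finally show "pairing (st (f \<otimes>\<^bsub>A\<^esub> g)) \<phi> = pairing (st g \<otimes>\<^bsub>A\<^esub> st f) \<phi>" .
  show "finite (supp (st (f \<otimes>\<^bsub>A\<^esub> g)))" "finite (supp (st g \<otimes>\<^bsub>A\<^esub> st f))"
    by (intro carrier_group_algebraD(1)[of _ G] star_closed mult_closed f g)+
qed

lemma mult_apply:
  assumes f: "f \<in> carrier A" and g: "g \<in> carrier A" and x: "x \<in> carrier G"
  shows "(f \<otimes>\<^bsub>A\<^esub> g) x = pairing f (\<lambda>a. g (inv a \<otimes> x))"
proof -
  note fs = carrier_group_algebraD[OF f] and gs = carrier_group_algebraD[OF g]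
  have "(f \<otimes>\<^bsub>A\<^esub> g) x = pairing (f \<otimes>\<^bsub>A\<^esub> g) (single x)"
    using mult_closed[OF f g] by (simp add: pairing_single_right carrier_group_algebra)
  also have "\<dots> = pairing f (\<lambda>a. pairing g (\<lambda>b. single x (a \<otimes> b)))"
    using fs gs by (simp add: pairing_mult)
  also have "\<dots> = pairing f (\<lambda>a. pairing g (single (inv a \<otimes> x)))"
  proof (intro pairing_cong[OF fs(2)] pairing_cong[OF gs(2)])
    fix a b assume "a \<in> carrier G" "b \<in> carrier G"
    then have "a \<otimes> b = x \<longleftrightarrow> b = inv a \<otimes> x"
      using x by (metis inv_closed inv_solve_left)
    then show "single x (a \<otimes> b) = single (inv a \<otimes> x) b" by (simp add: single_def)
  qed
  finally show ?thesis
    using gs by (simp add: pairing_single_right)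
qed

end

section \<open>C*-norms and the reduced norm\<close>

text \<open>If \<open>x > y > 0\<close>, then \<open>(x / y) ^ m\<close> outgrows every quadratic
  polynomial in \<open>m\<close>, in particular along \<open>m = 2 ^ n\<close>; if
  \<open>y = 0\<close>, the instance \<open>n = 0\<close> already forces \<open>x \<le> 0\<close>.
  The quadratic factor is the growth rate of Z^2.\<close>

lemma le_of_power_growth:
  fixes x y a :: real
  assumes "0 \<le> x" "0 \<le> y" "\<And>n. x ^ (2 ^ n) \<le> (a * 2 ^ n) ^ 2 * y ^ (2 ^ n)"
  shows "x \<le> y"
proof (rule ccontr)
  assume "\<not> x \<le> y"
  then have "x > y" by simp
  show False
  proof (cases "y = 0")
    case True
    then show False using assms(3)[of 0] \<open>x > y\<close> by simp
  next
    case False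
    then have "y > 0" using assms by simp
    define r where "r = x / y"
    have "r > 1" using \<open>x > y\<close> \<open>y > 0\<close> by (simp add: r_def)
    have le: "r ^ (2 ^ n) \<le> (a * 2 ^ n) ^ 2" for n
      using assms(3)[of n] \<open>y > 0\<close> by (simp add: r_def power_divide pos_divide_le_eq)
    have "(\<lambda>m::nat. real m ^ 2 / r ^ m) \<longlonglongrightarrow> 0"
      using \<open>r > 1\<close> by real_asymp
    then have "((\<lambda>m::nat. (a * real m) ^ 2 / r ^ m) \<longlonglongrightarrow> 0)"
      by (drule_tac tendsto_mult_right_zero[of _ _ "a\<^sup>2"]) (simp add: power_mult_distrib)
    then have "(\<lambda>n. (a * real (2 ^ n)) ^ 2 / r ^ (2 ^ n)) \<longlonglongrightarrow> 0"
      by (rule filterlim_compose) (rule filterlim_at_top_mono[of "\<lambda>n. n"], simp_all add: filterlim_ident less_imp_le)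
    then have "eventually (\<lambda>n. (a * real (2 ^ n)) ^ 2 / r ^ (2 ^ n) < 1) sequentially"
      by (rule order_tendstoD) simp
    then obtain n where "(a * real (2 ^ n)) ^ 2 / r ^ (2 ^ n) < 1"
      by (meson eventually_happens trivial_limit_sequentially)
    then show False
      using le[of n] \<open>r > 1\<close> by (simp add: pos_divide_less_eq)
  qed
qed

lemma (in group) star_single: "g \<in> carrier G \<Longrightarrow> st (single g) = single (inv g)"
  using group_algebra_star_single[of g 1] unfolding single_def by (simp only: complex_cnj_one)

lemma single_mult_single: "single g \<otimes>\<^bsub>group_algebra G\<^esub> single h = single (g \<otimes>\<^bsub>G\<^esub> h)"
  using group_algebra_single_mult[where g = g and h = h and c = 1 and d = 1 and G = G]
  unfolding single_def by (simp only: mult_1)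

text \<open>The power of \<open>h\<close> with exponent \<open>2 ^ n\<close>. Exponents are doubled
  because for self-adjoint \<open>h\<close> the C*-identity computes the norm of a square
  exactly.\<close>

primrec (in group) iter_square :: "nat \<Rightarrow> ('a \<Rightarrow> complex) \<Rightarrow> 'a \<Rightarrow> complex" where
  "iter_square 0 h = h"
| "iter_square (Suc n) h = iter_square n h \<otimes>\<^bsub>A\<^esub> iter_square n h"

locale Cstar_norm = group G for G (structure) +
  fixes N :: "('a \<Rightarrow> complex) \<Rightarrow> real"
  assumes Cstar: "is_Cstar_norm G N"
begin

interpretation A: ring A by (rule ring_group_algebra)

lemma N_nonneg: "f \<in> carrier A \<Longrightarrow> 0 \<le> N f"
  and N_eq_0_iff: "f \<in> carrier A \<Longrightarrow> N f = 0 \<longleftrightarrow> f = (\<lambda>_. 0)"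
  and N_scale: "f \<in> carrier A \<Longrightarrow> N (\<lambda>x. c * f x) = cmod c * N f"
  and N_add: "f \<in> carrier A \<Longrightarrow> g \<in> carrier A \<Longrightarrow> N (\<lambda>x. f x + g x) \<le> N f + N g"
  and N_mult: "f \<in> carrier A \<Longrightarrow> g \<in> carrier A \<Longrightarrow> N (f \<otimes>\<^bsub>A\<^esub> g) \<le> N f * N g"
  and N_star_mult: "f \<in> carrier A \<Longrightarrow> N (st f \<otimes>\<^bsub>A\<^esub> f) = (N f)\<^sup>2"
  using Cstar by (simp_all add: is_Cstar_norm_def Let_def group_algebra_simps)

lemma N_sum:
  assumes "finite I" "\<And>i. i \<in> I \<Longrightarrow> f i \<in> carrier A"
  shows "N (\<lambda>x. \<Sum>i\<in>I. f i x) \<le> (\<Sum>i\<in>I. N (f i))"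
  using assms
proof (induction I rule: finite_induct)
  case empty
  then show ?case using N_eq_0_iff[of "\<lambda>_. 0"] by (simp add: carrier_group_algebra supp_def)
next
  case (insert i I)
  then have "N (\<lambda>x. f i x + (\<Sum>i\<in>I. f i x)) \<le> N (f i) + N (\<lambda>x. \<Sum>i\<in>I. f i x)"
    by (intro N_add group_algebra_sum_closed) auto
  then show ?case using insert by simp
qed

lemma N_one: "N (single \<one>) = 1"
proof -
  have c: "single \<one> \<in> carrier A" by (simp add: single_closed)
  have "(N (single \<one>))\<^sup>2 = N (single \<one>)"
    using N_star_mult[OF c] by (simp add: star_single single_mult_single)
  moreover have "N (single \<one>) \<noteq> 0"
    using N_eq_0_iff[OF c] by (auto simp: single_def fun_eq_iff)
  ultimately show ?thesis by (simp add: power2_eq_square)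
qed

lemma N_single: 
  assumes "g \<in> carrier G"
  shows "N (single g) = 1"
proof -
  have "(N (single g))\<^sup>2 = 1"
    using N_star_mult[OF single_closed[OF assms]] assms
    by (simp add: star_single single_mult_single N_one)
  then show ?thesis
    using N_nonneg[OF single_closed[OF assms]] by (simp add: power2_eq_1_iff)
qed

text \<open>Group elements are unitary, hence of norm 1; expand \<open>f\<close> in them.\<close>

lemma N_le_l1:
  assumes "f \<in> carrier A"
  shows "N f \<le> (\<Sum>x\<in>supp f. cmod (f x))"
proof -
  note fs = carrier_group_algebraD[OF assms]
  have "f = (\<lambda>x. \<Sum>g\<in>supp f. f g * single g x)"
  proof
    fix x
    have "(\<Sum>g\<in>supp f. f g * single g x) = (\<Sum>g\<in>supp f. if g = x then f g else 0)"
      by (intro sum.cong) (auto simp: single_def)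
    then show "f x = (\<Sum>g\<in>supp f. f g * single g x)"
      using fs by (simp add: supp_def)
  qed
  then have "N f = N (\<lambda>x. \<Sum>g\<in>supp f. f g * single g x)" by simp
  also have "\<dots> \<le> (\<Sum>g\<in>supp f. N (\<lambda>x. f g * single g x))"
    using fs by (intro N_sum group_algebra_scale_closed single_closed) auto
  also have "\<dots> = (\<Sum>g\<in>supp f. cmod (f g))"
    using fs by (intro sum.cong) (auto simp: N_scale N_single single_closed)
  finally show ?thesis .
qed

lemma N_star:
  assumes "f \<in> carrier A"
  shows "N (st f) = N f"
proof -
  have le: "N f \<le> N (st f)" if f: "f \<in> carrier A" for f
  proof (cases "N f = 0")
    case True
    then show ?thesis using N_nonneg[OF star_closed[OF f]] by simp
  next
    case False
    then have "N f > 0" using N_nonneg[OF f] by simp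
    moreover have "N f * N f \<le> N (st f) * N f"
      using N_star_mult[OF f] N_mult[OF star_closed[OF f] f] by (simp add: power2_eq_square)
    ultimately show ?thesis by simp
  qed
  show ?thesis
    using le[OF assms] le[OF star_closed[OF assms]] star_star[OF assms] by simp
qed

text \<open>Multiplication by a unitary is contractive, and so is multiplication by its
  inverse.\<close>

lemma N_mult_single:
  assumes f: "f \<in> carrier A" and g: "g \<in> carrier G"
  shows "N (f \<otimes>\<^bsub>A\<^esub> single g) = N f" "N (single g \<otimes>\<^bsub>A\<^esub> f) = N f"
proof -
  have one: "single \<one> = \<one>\<^bsub>A\<^esub>" by (simp add: group_algebra_simps)
  have 1: "N (f \<otimes>\<^bsub>A\<^esub> single g) \<le> N f" "N (single g \<otimes>\<^bsub>A\<^esub> f) \<le> N f"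
    if "f \<in> carrier A" "g \<in> carrier G" for f g
    using N_mult[OF that(1) single_closed[OF that(2)]] N_mult[OF single_closed[OF that(2)] that(1)] that
    by (simp_all add: N_single)
  have "f \<otimes>\<^bsub>A\<^esub> single g \<otimes>\<^bsub>A\<^esub> single (inv g) = f"
    "single (inv g) \<otimes>\<^bsub>A\<^esub> (single g \<otimes>\<^bsub>A\<^esub> f) = f"
    using f g
    by (simp_all add: A.m_assoc[of _ "single g"] A.m_assoc[of "single (inv g)", symmetric]
        single_closed single_mult_single one)
  then show "N (f \<otimes>\<^bsub>A\<^esub> single g) = N f" "N (single g \<otimes>\<^bsub>A\<^esub> f) = N f"
    using 1[OF f g] 1(1)[of "f \<otimes>\<^bsub>A\<^esub> single g" "inv g"] 1(2)[of "single g \<otimes>\<^bsub>A\<^esub> f" "inv g"] f g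
    by (auto simp: single_closed)
qed

lemma iter_square_selfadjoint:
  assumes "h \<in> carrier A" "st h = h"
  shows "iter_square n h \<in> carrier A" "st (iter_square n h) = iter_square n h"
    "N (iter_square n h) = N h ^ 2 ^ n"
proof -
  have "iter_square n h \<in> carrier A \<and> st (iter_square n h) = iter_square n h \<and>
    N (iter_square n h) = N h ^ 2 ^ n"
  proof (induction n)
    case (Suc n)
    then have "N (iter_square (Suc n) h) = (N h ^ 2 ^ n)\<^sup>2"
      using N_star_mult[of "iter_square n h"] by simp
    then show ?case
      using Suc by (simp add: star_mult mult.commute flip: power_mult)
  qed (use assms in auto)
  then show "iter_square n h \<in> carrier A" "st (iter_square n h) = iter_square n h"
    "N (iter_square n h) = N h ^ 2 ^ n" by auto
qed

text \<open>The iterated squares of a self-adjoint element recover its norm from estimates that lose a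
  factor growing polynomially in the exponent.\<close>

lemma N_le_of_growth:
  assumes h: "h \<in> carrier A" "st h = h"
    and nonneg: "\<And>f. f \<in> carrier A \<Longrightarrow> 0 \<le> \<Phi> f"
    and square: "\<And>n. \<Phi> (iter_square (Suc n) h) \<le> (\<Phi> (iter_square n h))\<^sup>2"
    and growth: "\<And>n. N (iter_square n h) \<le> (a * 2 ^ n) ^ 2 * \<Phi> (iter_square n h)"
  shows "N h \<le> \<Phi> h"
proof (rule le_of_power_growth)
  show "0 \<le> N h" "0 \<le> \<Phi> h" using N_nonneg nonneg h by auto
  have \<Phi>: "\<Phi> (iter_square n h) \<le> \<Phi> h ^ 2 ^ n" for n
  proof (induction n)
    case (Suc n)
    have "\<Phi> (iter_square (Suc n) h) \<le> (\<Phi> (iter_square n h))\<^sup>2" by (rule square)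
    also have "\<dots> \<le> (\<Phi> h ^ 2 ^ n)\<^sup>2"
      using Suc nonneg iter_square_selfadjoint(1)[OF h] by (intro power_mono) auto
    finally show ?case by (simp add: mult.commute flip: power_mult)
  qed simp
  show "N h ^ 2 ^ n \<le> (a * 2 ^ n)\<^sup>2 * \<Phi> h ^ 2 ^ n" for n
    using growth[of n] mult_left_mono[OF \<Phi>[of n], of "(a * 2 ^ n)\<^sup>2"]
    by (simp add: iter_square_selfadjoint(3)[OF h])
qed

end

section \<open>The left regular representation and its operator norm\<close>

definition l2 :: "('a \<Rightarrow> complex) \<Rightarrow> real" where
  "l2 f = L2_set (\<lambda>x. cmod (f x)) (supp f)"

lemma l2_nonneg: "0 \<le> l2 f"
  by (simp add: l2_def)

lemma L2_set_mono_set: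
  assumes "finite B" "A \<subseteq> B"
  shows "L2_set f A \<le> L2_set f B"
  unfolding L2_set_def using assms by (intro real_sqrt_le_mono sum_mono2) auto

lemma l2_superset:
  assumes "finite S" "supp f \<subseteq> S"
  shows "l2 f = L2_set (\<lambda>x. cmod (f x)) S"
  unfolding l2_def L2_set_def using assms
  by (intro arg_cong[where f = sqrt] sum.mono_neutral_left) (auto simp: supp_def)

lemma L2_set_le_l2:
  assumes "finite S" "finite (supp f)"
  shows "L2_set (\<lambda>x. cmod (f x)) S \<le> l2 f"
  using assms l2_superset[of "S \<union> supp f" f] by (simp add: L2_set_mono_set)

lemma l2_scale: "l2 (\<lambda>x. c * f x) = cmod c * l2 f"
proof (cases "c = 0")
  case False
  then have "supp (\<lambda>x. c * f x) = supp f" by (simp add: supp_def)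
  then show ?thesis by (simp add: l2_def norm_mult L2_set_right_distrib)
qed (simp add: l2_def supp_def)

lemma l2_add:
  assumes "finite (supp f)" "finite (supp g)"
  shows "l2 (\<lambda>x. f x + g x) \<le> l2 f + l2 g"
proof -
  let ?S = "supp f \<union> supp g"
  have "l2 (\<lambda>x. f x + g x) = L2_set (\<lambda>x. cmod (f x + g x)) ?S"
    using assms supp_add[of f g] by (intro l2_superset) auto
  also have "\<dots> \<le> L2_set (\<lambda>x. cmod (f x) + cmod (g x)) ?S"
    by (intro L2_set_mono norm_triangle_ineq) auto
  also have "\<dots> \<le> L2_set (\<lambda>x. cmod (f x)) ?S + L2_set (\<lambda>x. cmod (g x)) ?S"
    by (rule L2_set_triangle_ineq)
  also have "\<dots> = l2 f + l2 g"
    using assms by (simp add: l2_superset[of ?S])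
  finally show ?thesis .
qed

lemma l2_eq_0:
  assumes "finite (supp f)" "l2 f = 0"
  shows "f = (\<lambda>_. 0)"
  using assms by (auto simp: l2_def L2_set_eq_0_iff supp_def)

lemma pairing_cnj_self: "pairing f (\<lambda>x. cnj (f x)) = of_real ((l2 f)\<^sup>2)"
proof -
  have "(l2 f)\<^sup>2 = (\<Sum>x\<in>supp f. (cmod (f x))\<^sup>2)"
    by (simp add: l2_def L2_set_def sum_nonneg)
  then show ?thesis
    by (simp only: pairing_def of_real_sum complex_norm_square)
qed

lemma norm_pairing_le_l2: "cmod (pairing f \<phi>) \<le> l2 f * L2_set (\<lambda>x. cmod (\<phi> x)) (supp f)"
proof -
  have "cmod (pairing f \<phi>) \<le> (\<Sum>x\<in>supp f. \<bar>cmod (f x)\<bar> * \<bar>cmod (\<phi> x)\<bar>)"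
    unfolding pairing_def by (rule sum_norm_le) (simp add: norm_mult)
  also have "\<dots> \<le> l2 f * L2_set (\<lambda>x. cmod (\<phi> x)) (supp f)"
    unfolding l2_def by (rule L2_set_mult_ineq)
  finally show ?thesis .
qed

context group
begin

interpretation A: ring A by (rule ring_group_algebra)

text \<open>By duality: with \<open>h\<close> the product, the square of \<open>l2 h\<close> is a
  sum over \<open>a\<close> of \<open>f a\<close> times the inner product of \<open>g\<close> with a
  left translate of \<open>h\<close>, and Cauchy-Schwarz bounds each of these by
  \<open>l2 g * l2 h\<close>.\<close>

lemma l2_mult_le_l1:
  assumes f: "f \<in> carrier A" and g: "g \<in> carrier A"
  shows "l2 (f \<otimes>\<^bsub>A\<^esub> g) \<le> (\<Sum>x\<in>supp f. cmod (f x)) * l2 g"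
proof -
  note fs = carrier_group_algebraD[OF f] and gs = carrier_group_algebraD[OF g]
  define h where "h = f \<otimes>\<^bsub>A\<^esub> g"
  have h: "finite (supp h)" using mult_closed[OF f g] by (simp add: h_def carrier_group_algebra)
  have inner: "cmod (pairing g (\<lambda>b. cnj (h (a \<otimes> b)))) \<le> l2 g * l2 h" if "a \<in> supp f" for a
  proof -
    have "inj_on (\<lambda>b. a \<otimes> b) (supp g)"
      using that fs gs by (meson inj_on_cmult inj_on_subset subsetD)
    then have "L2_set (\<lambda>b. cmod (h (a \<otimes> b))) (supp g) = L2_set (\<lambda>x. cmod (h x)) ((\<lambda>b. a \<otimes> b) ` supp g)"
      by (simp add: L2_set_def sum.reindex)
    also have "\<dots> \<le> l2 h" using gs h by (intro L2_set_le_l2) auto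
    finally have "L2_set (\<lambda>b. cmod (h (a \<otimes> b))) (supp g) \<le> l2 h" .
    then show ?thesis
      using norm_pairing_le_l2[of g "\<lambda>b. cnj (h (a \<otimes> b))"] mult_left_mono[OF _ l2_nonneg[of g]]
      by (simp add: order_trans)
  qed
  have "(l2 h)\<^sup>2 = cmod (pairing h (\<lambda>x. cnj (h x)))"
    by (simp add: pairing_cnj_self norm_power)
  also have "\<dots> = cmod (pairing f (\<lambda>a. pairing g (\<lambda>b. cnj (h (a \<otimes> b)))))"
    using fs gs by (simp add: h_def pairing_mult)
  also have "\<dots> \<le> (l2 g * l2 h) * (\<Sum>x\<in>supp f. cmod (f x))"
    by (intro norm_pairing_le inner)
  finally have "l2 h * l2 h \<le> ((\<Sum>x\<in>supp f. cmod (f x)) * l2 g) * l2 h"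
    by (simp add: power2_eq_square algebra_simps)
  moreover have "0 \<le> (\<Sum>x\<in>supp f. cmod (f x)) * l2 g"
    by (intro mult_nonneg_nonneg sum_nonneg l2_nonneg) auto
  ultimately show ?thesis
    using l2_nonneg[of h] by (cases "l2 h = 0") (auto simp: h_def[symmetric])
qed

text \<open>Identifies the involution with the Hilbert space adjoint for the inner product
  \<open>pairing u (\<lambda>x. cnj (v x))\<close>; this is the source of the C*-identity for the
  operator norm.\<close>

lemma pairing_adjoint:
  assumes f: "f \<in> carrier A" and g: "g \<in> carrier A" and h: "h \<in> carrier A"
  shows "pairing (f \<otimes>\<^bsub>A\<^esub> g) (\<lambda>x. cnj (h x)) = pairing g (\<lambda>x. cnj ((st f \<otimes>\<^bsub>A\<^esub> h) x))"
proof -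
  note fs = carrier_group_algebraD[OF f] and gs = carrier_group_algebraD[OF g]
  have "pairing (f \<otimes>\<^bsub>A\<^esub> g) (\<lambda>x. cnj (h x)) = pairing g (\<lambda>b. pairing f (\<lambda>a. cnj (h (a \<otimes> b))))"
    using fs gs by (simp add: pairing_mult pairing_swap[of f g])
  also have "\<dots> = pairing g (\<lambda>b. cnj ((st f \<otimes>\<^bsub>A\<^esub> h) b))"
  proof (rule pairing_cong[OF gs(2)])
    fix b assume b: "b \<in> carrier G"
    have "cnj ((st f \<otimes>\<^bsub>A\<^esub> h) b) = pairing f (\<lambda>a. cnj (h (inv (inv a) \<otimes> b)))"
      using f h b star_closed[OF f] by (simp add: mult_apply pairing_star)
    also have "\<dots> = pairing f (\<lambda>a. cnj (h (a \<otimes> b)))"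
      by (rule pairing_cong[OF fs(2)]) simp
    finally show "pairing f (\<lambda>a. cnj (h (a \<otimes> b))) = cnj ((st f \<otimes>\<^bsub>A\<^esub> h) b)" ..
  qed
  finally show ?thesis .
qed

text \<open>The operator norm of left convolution by \<open>f\<close>, tested on finitely supported
  vectors only; these are dense in the Hilbert space. \<open>l2_mult_le_l1\<close> makes the set of
  admissible constants nonempty.\<close>

definition reduced_norm :: "('a \<Rightarrow> complex) \<Rightarrow> real" where
  "reduced_norm f = Inf {c. 0 \<le> c \<and> (\<forall>g\<in>carrier A. l2 (f \<otimes>\<^bsub>A\<^esub> g) \<le> c * l2 g)}"

lemma reduced_norm_le:
  assumes "0 \<le> c" "\<And>g. g \<in> carrier A \<Longrightarrow> l2 (f \<otimes>\<^bsub>A\<^esub> g) \<le> c * l2 g"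
  shows "reduced_norm f \<le> c"
  unfolding reduced_norm_def using assms by (intro cInf_lower bdd_belowI[of _ 0]) auto

lemma
  assumes f: "f \<in> carrier A"
  shows reduced_norm_nonneg: "0 \<le> reduced_norm f"
    and l2_mult_le: "g \<in> carrier A \<Longrightarrow> l2 (f \<otimes>\<^bsub>A\<^esub> g) \<le> reduced_norm f * l2 g"
proof -
  let ?C = "{c. 0 \<le> c \<and> (\<forall>g\<in>carrier A. l2 (f \<otimes>\<^bsub>A\<^esub> g) \<le> c * l2 g)}"
  have "(\<Sum>x\<in>supp f. cmod (f x)) \<in> ?C"
    using f by (auto intro: sum_nonneg l2_mult_le_l1)
  then have ne: "?C \<noteq> {}" by blast
  then show "0 \<le> reduced_norm f"
    unfolding reduced_norm_def by (intro cInf_greatest) auto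
  assume g: "g \<in> carrier A"
  show "l2 (f \<otimes>\<^bsub>A\<^esub> g) \<le> reduced_norm f * l2 g"
  proof (cases "l2 g = 0")
    case True
    then show ?thesis using l2_mult_le_l1[OF f g] by simp
  next
    case False
    then have pos: "l2 g > 0" using l2_nonneg[of g] by simp
    have "l2 (f \<otimes>\<^bsub>A\<^esub> g) / l2 g \<le> reduced_norm f"
      unfolding reduced_norm_def using ne g pos
      by (intro cInf_greatest) (auto simp: pos_divide_le_eq)
    then show ?thesis using pos by (simp add: pos_divide_le_eq)
  qed
qed

lemma reduced_norm_mult:
  assumes f: "f \<in> carrier A" and g: "g \<in> carrier A"
  shows "reduced_norm (f \<otimes>\<^bsub>A\<^esub> g) \<le> reduced_norm f * reduced_norm g"
proof (rule reduced_norm_le)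
  fix h assume h: "h \<in> carrier A"
  have "l2 (f \<otimes>\<^bsub>A\<^esub> g \<otimes>\<^bsub>A\<^esub> h) \<le> reduced_norm f * l2 (g \<otimes>\<^bsub>A\<^esub> h)"
    using f g h by (simp add: A.m_assoc l2_mult_le)
  also have "\<dots> \<le> reduced_norm f * (reduced_norm g * l2 h)"
    using f g h by (intro mult_left_mono l2_mult_le reduced_norm_nonneg)
  finally show "l2 (f \<otimes>\<^bsub>A\<^esub> g \<otimes>\<^bsub>A\<^esub> h) \<le> reduced_norm f * reduced_norm g * l2 h" by (simp add: mult.assoc)
qed (use f g reduced_norm_nonneg in auto)

text \<open>The inequality \<open>sq\<close> is the usual operator argument, moving \<open>f\<close>
  to the other side of the inner product. Combined with submultiplicativity it bounds the norm of
  \<open>f\<close> by that of \<open>st f\<close>; by symmetry the involution is isometric, and then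
  submultiplicativity is the converse inequality.\<close>

lemma reduced_norm_star_mult:
  assumes f: "f \<in> carrier A"
  shows "reduced_norm (st f \<otimes>\<^bsub>A\<^esub> f) = (reduced_norm f)\<^sup>2"
proof -
  have sq: "(reduced_norm f)\<^sup>2 \<le> reduced_norm (st f \<otimes>\<^bsub>A\<^esub> f)" if f: "f \<in> carrier A" for f
  proof -
    let ?r = "reduced_norm (st f \<otimes>\<^bsub>A\<^esub> f)"
    have ff: "st f \<otimes>\<^bsub>A\<^esub> f \<in> carrier A" using f by (simp add: star_closed)
    have "reduced_norm f \<le> sqrt ?r"
    proof (rule reduced_norm_le)
      fix g assume g: "g \<in> carrier A"
      have "(l2 (f \<otimes>\<^bsub>A\<^esub> g))\<^sup>2 = cmod (pairing (f \<otimes>\<^bsub>A\<^esub> g) (\<lambda>x. cnj ((f \<otimes>\<^bsub>A\<^esub> g) x)))"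
        by (simp add: pairing_cnj_self norm_power)
      also have "\<dots> = cmod (pairing g (\<lambda>x. cnj ((st f \<otimes>\<^bsub>A\<^esub> f \<otimes>\<^bsub>A\<^esub> g) x)))"
        using f g star_closed[OF f] by (simp add: pairing_adjoint A.m_assoc)
      also have "\<dots> \<le> l2 g * L2_set (\<lambda>x. cmod (cnj ((st f \<otimes>\<^bsub>A\<^esub> f \<otimes>\<^bsub>A\<^esub> g) x))) (supp g)"
        by (rule norm_pairing_le_l2)
      also have "\<dots> \<le> l2 g * l2 (st f \<otimes>\<^bsub>A\<^esub> f \<otimes>\<^bsub>A\<^esub> g)"
        using carrier_group_algebraD(1)[OF g] carrier_group_algebraD(1)[OF mult_closed[OF ff g]]
        by (auto intro!: mult_left_mono l2_nonneg L2_set_le_l2)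
      also have "\<dots> \<le> l2 g * (?r * l2 g)"
        using ff g by (intro mult_left_mono l2_nonneg l2_mult_le)
      finally have "sqrt ((l2 (f \<otimes>\<^bsub>A\<^esub> g))\<^sup>2) \<le> sqrt (?r * (l2 g)\<^sup>2)"
        by (intro real_sqrt_le_mono) (simp add: power2_eq_square algebra_simps)
      then show "l2 (f \<otimes>\<^bsub>A\<^esub> g) \<le> sqrt ?r * l2 g"
        using l2_nonneg[of g] l2_nonneg[of "f \<otimes>\<^bsub>A\<^esub> g"] by (simp add: real_sqrt_mult)
    qed (use reduced_norm_nonneg[OF ff] in simp)
    then have "(reduced_norm f)\<^sup>2 \<le> (sqrt ?r)\<^sup>2"
      using reduced_norm_nonneg[OF f] by (intro power_mono)
    then show ?thesis using reduced_norm_nonneg[OF ff] by simp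
  qed
  have le: "reduced_norm f \<le> reduced_norm (st f)" if f: "f \<in> carrier A" for f
    using order_trans[OF sq[OF f] reduced_norm_mult[OF star_closed[OF f] f]]
      reduced_norm_nonneg[OF f] reduced_norm_nonneg[OF star_closed[OF f]]
    by (cases "reduced_norm f = 0") (auto simp: power2_eq_square)
  have "reduced_norm (st f) = reduced_norm f"
    using le[OF f] le[OF star_closed[OF f]] star_star[OF f] by simp
  then show ?thesis
    using sq[OF f] reduced_norm_mult[OF star_closed[OF f] f] by (simp add: power2_eq_square)
qed

lemma reduced_norm_scale:
  assumes f: "f \<in> carrier A"
  shows "reduced_norm (\<lambda>x. c * f x) = cmod c * reduced_norm f"
proof -
  have le: "reduced_norm (\<lambda>x. c * f x) \<le> cmod c * reduced_norm f" if f: "f \<in> carrier A" for c f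
  proof (rule reduced_norm_le)
    fix g assume g: "g \<in> carrier A"
    show "l2 ((\<lambda>x. c * f x) \<otimes>\<^bsub>A\<^esub> g) \<le> cmod c * reduced_norm f * l2 g"
      using l2_mult_le[OF f g] carrier_group_algebraD(1)[OF f] carrier_group_algebraD(1)[OF g]
      by (simp add: mult_scale_left l2_scale mult.assoc mult_left_mono)
  qed (use reduced_norm_nonneg[OF f] in simp)
  show ?thesis
  proof (cases "c = 0")
    case True
    then show ?thesis
      using le[OF f, of c] reduced_norm_nonneg[OF group_algebra_scale_closed[OF f, of c]] by simp
  next
    case False
    have "reduced_norm (\<lambda>x. inverse c * (c * f x)) \<le> cmod (inverse c) * reduced_norm (\<lambda>x. c * f x)"
      by (intro le group_algebra_scale_closed f)
    moreover have "(\<lambda>x. inverse c * (c * f x)) = f" using False by auto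
    ultimately have "cmod c * reduced_norm f \<le> reduced_norm (\<lambda>x. c * f x)"
      using False by (simp add: norm_inverse norm_divide field_simps)
    then show ?thesis using le[OF f, of c] by simp
  qed
qed

lemma reduced_norm_add:
  assumes f: "f \<in> carrier A" and g: "g \<in> carrier A"
  shows "reduced_norm (\<lambda>x. f x + g x) \<le> reduced_norm f + reduced_norm g"
proof (rule reduced_norm_le)
  fix h assume h: "h \<in> carrier A"
  note fin = carrier_group_algebraD(1)
  have "l2 ((\<lambda>x. f x + g x) \<otimes>\<^bsub>A\<^esub> h) \<le> l2 (f \<otimes>\<^bsub>A\<^esub> h) + l2 (g \<otimes>\<^bsub>A\<^esub> h)"
    using fin[OF f] fin[OF g] fin[OF h] fin[OF mult_closed[OF f h]] fin[OF mult_closed[OF g h]]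
    by (simp add: mult_add_left l2_add)
  also have "\<dots> \<le> (reduced_norm f + reduced_norm g) * l2 h"
    using l2_mult_le[OF f h] l2_mult_le[OF g h] by (simp add: distrib_right)
  finally show "l2 ((\<lambda>x. f x + g x) \<otimes>\<^bsub>A\<^esub> h) \<le> (reduced_norm f + reduced_norm g) * l2 h" .
qed (use reduced_norm_nonneg f g in auto)

text \<open>Faithful because the unit of the ring is itself a vector, and \<open>f\<close> is its
  image under left convolution by \<open>f\<close>.\<close>

lemma reduced_norm_eq_0_iff:
  assumes f: "f \<in> carrier A"
  shows "reduced_norm f = 0 \<longleftrightarrow> f = (\<lambda>_. 0)"
proof
  assume "reduced_norm f = 0"
  then have "l2 (f \<otimes>\<^bsub>A\<^esub> \<one>\<^bsub>A\<^esub>) \<le> 0" using l2_mult_le[OF f A.one_closed] by simp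
  then have "l2 f = 0" using f l2_nonneg[of f] by simp
  then show "f = (\<lambda>_. 0)" using carrier_group_algebraD(1)[OF f] by (intro l2_eq_0)
next
  assume "f = (\<lambda>_. 0)"
  then show "reduced_norm f = 0" using reduced_norm_scale[OF f, of 0] by simp
qed

lemma is_Cstar_norm_reduced_norm: "is_Cstar_norm G reduced_norm"
  by (simp add: is_Cstar_norm_def Let_def group_algebra_simps reduced_norm_nonneg
      reduced_norm_eq_0_iff reduced_norm_scale reduced_norm_add reduced_norm_mult reduced_norm_star_mult)

end

section \<open>Furstenberg's theorem\<close>

definition mult_independent :: "nat \<Rightarrow> nat \<Rightarrow> bool" where
  "mult_independent p q \<longleftrightarrow> 2 \<le> p \<and> 2 \<le> q \<and> (\<forall>r s. 0 < r \<longrightarrow> 0 < s \<longrightarrow> p ^ r \<noteq> q ^ s)"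

text \<open>A closed subset of the circle R/Z, encoded by its 1-periodic preimage in the line, so
  that dilations and distances are those of the reals.\<close>

definition times_invariant :: "nat \<Rightarrow> nat \<Rightarrow> real set \<Rightarrow> bool" where
  "times_invariant p q X \<longleftrightarrow> closed X \<and>
     (\<forall>x\<in>X. x + 1 \<in> X \<and> x - 1 \<in> X \<and> real p * x \<in> X \<and> real q * x \<in> X)"

lemma mult_independent_power:
  assumes "mult_independent p q" "u > 0"
  shows "mult_independent (p ^ u) (q ^ u)"
proof -
  have "2 \<le> a ^ u" if "2 \<le> a" for a :: nat
    using self_le_power[of a u] that \<open>u > 0\<close> by simp
  then show ?thesis
    using assms by (auto simp: mult_independent_def simp flip: power_mult)
qed

lemma times_invariant_add_int:
  assumes "times_invariant p q X" "x \<in> X"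
  shows "x + of_int n \<in> X"
proof (induction n rule: int_induct[of _ 0])
  case (step1 i)
  then have "x + of_int i + 1 \<in> X" using assms(1) by (auto simp: times_invariant_def)
  then show ?case by (simp add: add.assoc)
next
  case (step2 i)
  then have "x + of_int i - 1 \<in> X" using assms(1) by (auto simp: times_invariant_def)
  then show ?case by (simp add: algebra_simps)
qed (use assms in simp)

lemma times_invariant_diff_int:
  assumes "times_invariant p q X" "x \<in> X"
  shows "x - of_int n \<in> X"
  using times_invariant_add_int[OF assms, of "- n"] by simp

lemma times_invariant_power:
  assumes "times_invariant p q X"
  shows "x \<in> X \<Longrightarrow> real p ^ i * real q ^ j * x \<in> X"
proof (induction i)
  case 0
  then show ?case
    using assms by (induction j) (auto simp: times_invariant_def mult.assoc)
qed (use assms in \<open>auto simp: times_invariant_def mult.assoc\<close>)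

lemma times_invariant_powers:
  assumes "times_invariant p q X"
  shows "times_invariant (p ^ u) (q ^ u) X"
  using assms times_invariant_power[OF assms, of _ u 0] times_invariant_power[OF assms, of _ 0 u]
  by (auto simp: times_invariant_def)

section \<open>Density of the semigroup generated by p and q on the logarithmic scale\<close>

text \<open>Start from the largest multiple of the block \<open>l * b\<close> below \<open>y\<close>
  and exchange blocks \<open>l * b\<close> for \<open>k * a\<close>, one at a time; each exchange
  raises the sum by a positive amount of at most \<open>\<epsilon>\<close>. Once \<open>y\<close> is
  large, there are enough blocks to bridge the gap to \<open>y\<close>.\<close>

lemma nat_combinations_dense_aux:
  fixes a b \<epsilon> :: real
  assumes "0 < b" "0 < l" "0 < real k * a - real l * b" "real k * a - real l * b \<le> \<epsilon>"
  shows "\<exists>c. \<forall>y\<ge>c. \<exists>i j. y \<le> real i * a + real j * b \<and> real i * a + real j * b \<le> y + \<epsilon>"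
proof -
  define \<delta> where "\<delta> = real k * a - real l * b"
  have \<delta>: "0 < \<delta>" "\<delta> \<le> \<epsilon>" using assms by (auto simp: \<delta>_def)
  have lb: "0 < real l * b" using assms by simp
  \<comment> \<open>So many exchanges cover a whole block, wherever \<open>y\<close> lies within
    it.\<close>
  define M where "M = nat \<lceil>real l * b / \<delta>\<rceil>"
  have M: "real l * b / \<delta> \<le> real M" unfolding M_def by linarith
  show ?thesis
  proof (rule exI[of _ "real M * (real l * b)"], intro allI impI)
    fix y assume y: "y \<ge> real M * (real l * b)"
    define m where "m = nat \<lfloor>y / (real l * b)\<rfloor>"
    have "real M \<le> y / (real l * b)" using y lb by (simp add: pos_le_divide_eq)
    then have mM: "M \<le> m" and m: "real m \<le> y / (real l * b)" "y / (real l * b) \<le> real m + 1"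
      unfolding m_def by linarith+
    have m': "real m * (real l * b) \<le> y" "y \<le> (real m + 1) * (real l * b)"
      using m lb by (simp_all add: pos_le_divide_eq pos_divide_le_eq)
    define n where "n = nat \<lceil>(y - real m * (real l * b)) / \<delta>\<rceil>"
    have nonneg: "0 \<le> (y - real m * (real l * b)) / \<delta>" using m' \<delta> by simp
    have n: "(y - real m * (real l * b)) / \<delta> \<le> real n"
      "real n \<le> (y - real m * (real l * b)) / \<delta> + 1"
      unfolding n_def using nonneg by linarith+
    have "(y - real m * (real l * b)) / \<delta> \<le> real l * b / \<delta>"
      using m'(2) \<delta> by (intro divide_right_mono) (auto simp: algebra_simps)
    also have "\<dots> \<le> real m" using M mM by linarith
    finally have "n \<le> m" unfolding n_def by linarith
    then have eq: "real (n * k) * a + real ((m - n) * l) * b = real m * (real l * b) + real n * \<delta>"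
      by (simp add: \<delta>_def of_nat_diff algebra_simps)
    have "y \<le> real m * (real l * b) + real n * \<delta>" "real m * (real l * b) + real n * \<delta> \<le> y + \<delta>"
      using n \<delta> by (simp_all add: field_simps)
    then show "\<exists>i j. y \<le> real i * a + real j * b \<and> real i * a + real j * b \<le> y + \<epsilon>"
      using eq \<delta> by (intro exI[of _ "n * k"] exI[of _ "(m - n) * l"]) linarith
  qed
qed

text \<open>Dirichlet approximation of \<open>a / b\<close> makes \<open>k * a - l * b\<close>
  small, and independence makes it nonzero; its sign decides which generator plays the role of
  \<open>a\<close> in the auxiliary lemma.\<close>

lemma nat_combinations_dense:
  fixes a b \<epsilon> :: real
  assumes "0 < a" "0 < b" "0 < \<epsilon>" and indep: "\<And>k l. 0 < k \<Longrightarrow> 0 < l \<Longrightarrow> real k * a \<noteq> real l * b"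
  shows "\<exists>c. \<forall>y\<ge>c. \<exists>i j. y \<le> real i * a + real j * b \<and> real i * a + real j * b \<le> y + \<epsilon>"
proof -
  \<comment> \<open>The first bound becomes \<open>\<epsilon>\<close> after multiplication by
    \<open>b\<close>; the second forces \<open>h > 0\<close>, since \<open>k * (a / b)\<close> is at
    least \<open>a / b\<close>.\<close>
  define \<eta> where "\<eta> = min (\<epsilon> / b) (a / b)"
  have "\<eta> > 0" using assms by (simp add: \<eta>_def)
  then obtain M where M: "M > 0" "inverse (real M) < \<eta>"
    using ex_inverse_of_nat_less by blast
  obtain h k where hk: "0 < k" "\<bar>of_int k * (a / b) - of_int h\<bar> < 1 / real M"
    using Dirichlet_approx[OF M(1)] by metis
  have lt: "\<bar>of_int k * (a / b) - of_int h\<bar> < \<epsilon> / b" "\<bar>of_int k * (a / b) - of_int h\<bar> < a / b"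
    using hk(2) M(2) by (auto simp: \<eta>_def inverse_eq_divide)
  have "a / b \<le> of_int k * (a / b)" using hk(1) assms by (simp add: pos_divide_le_eq)
  with lt(2) have "h > 0" by (smt (verit) of_int_0_le_iff of_int_le_0_iff)
  define k' l' where "k' = nat k" and "l' = nat h"
  have kl: "0 < k'" "0 < l'" "real k' = of_int k" "real l' = of_int h"
    using hk(1) \<open>h > 0\<close> by (auto simp: k'_def l'_def)
  have "real k' * a - real l' * b = b * (of_int k * (a / b) - of_int h)"
    using \<open>0 < b\<close> by (simp add: kl field_simps)
  then have "\<bar>real k' * a - real l' * b\<bar> = b * \<bar>of_int k * (a / b) - of_int h\<bar>"
    using \<open>0 < b\<close> by (simp only: abs_mult)
  also have "\<dots> \<le> \<epsilon>" using lt(1) \<open>0 < b\<close> by (simp add: field_simps)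
  finally have le: "\<bar>real k' * a - real l' * b\<bar> \<le> \<epsilon>" .
  show ?thesis
  proof (cases "real k' * a - real l' * b > 0")
    case True
    then show ?thesis using nat_combinations_dense_aux[of b l' k' a \<epsilon>] le kl assms by auto
  next
    case False
    then have "real l' * b - real k' * a > 0" using indep[OF kl(1,2)] by linarith
    then have "\<exists>c. \<forall>y\<ge>c. \<exists>i j. y \<le> real i * b + real j * a \<and> real i * b + real j * a \<le> y + \<epsilon>"
      using le kl assms by (intro nat_combinations_dense_aux[of a k' l']) auto
    then show ?thesis by (metis add.commute)
  qed
qed

section \<open>Invariant sets that accumulate at a rational point\<close>

text \<open>On the logarithmic scale the numbers \<open>p ^ i * q ^ j\<close> are eventually
  \<open>\<epsilon>\<close>-dense. A point of \<open>X\<close> close to 0 starts so far down that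
  its multiples reach any target \<open>z \<ge> 1\<close> within that dense range.\<close>

lemma times_invariant_UNIV_pos:
  assumes ind: "mult_independent p q" and inv: "times_invariant p q X"
    and small: "\<And>d. d > 0 \<Longrightarrow> \<exists>x\<in>X. 0 < x \<and> x < d"
  shows "X = UNIV"
proof -
  have p: "2 \<le> p" "2 \<le> q" using ind by (auto simp: mult_independent_def)
  have lnp: "ln (real p) > 0" "ln (real q) > 0" using p by auto
  have indep: "real k * ln (real p) \<noteq> real l * ln (real q)" if "0 < k" "0 < l" for k l
  proof
    assume "real k * ln (real p) = real l * ln (real q)"
    then have "ln (real (p ^ k)) = ln (real (q ^ l))" using p by (simp add: ln_realpow)
    then have "real (p ^ k) = real (q ^ l)" using p ln_inj_iff[of "real (p ^ k)" "real (q ^ l)"] by simp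
    then have "p ^ k = q ^ l" by (rule of_nat_eq_iff[THEN iffD1])
    then show False using ind that by (auto simp: mult_independent_def)
  qed
  have "y \<in> closure X" for y
    unfolding closure_approachable
  proof (intro allI impI)
    fix e :: real assume "e > 0"
    \<comment> \<open>An integer translation moves \<open>y\<close> to a target of size at least 1,
      where logarithms make sense; periodicity of \<open>X\<close> undoes it at the end.\<close>
    define n where "n = max 0 (\<lceil>1 - y\<rceil>)"
    define z where "z = y + of_int n"
    have z: "z \<ge> 1" unfolding z_def n_def by linarith
    define \<epsilon> where "\<epsilon> = ln (1 + e / (2 * z))"
    have "1 < 1 + e / (2 * z)" using \<open>e > 0\<close> z by simp
    then have "\<epsilon> > 0" unfolding \<epsilon>_def by (rule ln_gt_zero)
    have exp\<epsilon>: "z * exp \<epsilon> = z + e / 2" using \<open>e > 0\<close> z by (simp add: \<epsilon>_def add_pos_pos field_simps)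
    obtain c where c: "\<And>t. t \<ge> c \<Longrightarrow> \<exists>i j. t \<le> real i * ln (real p) + real j * ln (real q) \<and>
        real i * ln (real p) + real j * ln (real q) \<le> t + \<epsilon>"
      using nat_combinations_dense[OF lnp \<open>\<epsilon> > 0\<close> indep] by blast
    \<comment> \<open>Small enough that \<open>ln (z / x)\<close> lies beyond the threshold
      \<open>c\<close>.\<close>
    obtain x where x: "x \<in> X" "0 < x" "x < z * exp (- c)"
      using small[of "z * exp (- c)"] z by auto
    have "x * exp c < z" using x(3) by (simp add: exp_minus field_simps)
    then have "exp c \<le> z / x" using x(2) by (simp add: field_simps)
    then have "c \<le> ln (z / x)" using x z by (simp add: ln_ge_iff)
    then obtain i j where ij: "ln (z / x) \<le> real i * ln (real p) + real j * ln (real q)"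
        "real i * ln (real p) + real j * ln (real q) \<le> ln (z / x) + \<epsilon>"
      using c by blast
    define s where "s = real p ^ i * real q ^ j"
    have s: "s > 0" "ln s = real i * ln (real p) + real j * ln (real q)"
      using p by (auto simp: s_def ln_mult ln_realpow)
    have "z / x \<le> s" using ij(1) s x z ln_le_cancel_iff[of "z / x" s] by simp
    then have 1: "z \<le> s * x" using x by (simp add: field_simps)
    have "s = exp (ln s)" by (rule exp_ln[symmetric]) (rule s)
    also have "\<dots> \<le> exp (ln (z / x) + \<epsilon>)" using ij(2) s by simp
    also have "\<dots> = z * exp \<epsilon> / x" using x z by (simp add: exp_add)
    finally have "s * x \<le> z + e / 2" using x exp\<epsilon> by (simp add: field_simps)
    then have "dist (s * x - of_int n) y < e"
      using 1 \<open>e > 0\<close> by (simp add: dist_real_def z_def)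
    moreover have "s * x - of_int n \<in> X"
      using times_invariant_diff_int[OF inv] times_invariant_power[OF inv x(1)] by (simp add: s_def)
    ultimately show "\<exists>x\<in>X. dist x y < e" by blast
  qed
  then show ?thesis using inv by (auto simp: times_invariant_def)
qed

text \<open>Points of \<open>X\<close> may approach 0 from the left only; then the positive case is
  applied to the reflected set.\<close>

lemma times_invariant_UNIV:
  assumes ind: "mult_independent p q" and inv: "times_invariant p q X"
    and lim: "0 islimpt X"
  shows "X = UNIV"
proof (cases "\<forall>d>0. \<exists>x\<in>X. 0 < x \<and> x < d")
  case True
  then show ?thesis using times_invariant_UNIV_pos[OF ind inv] by blast
next
  case False
  then obtain d0 where d0: "d0 > 0" "\<And>x. x \<in> X \<Longrightarrow> 0 < x \<Longrightarrow> d0 \<le> x" by force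
  let ?Y = "uminus ` X"
  have inv': "times_invariant p q ?Y"
  proof -
    have "- x + 1 \<in> ?Y" "- x - 1 \<in> ?Y" "real p * - x \<in> ?Y" "real q * - x \<in> ?Y" if "x \<in> X" for x
    proof -
      have "x - 1 \<in> X" "x + 1 \<in> X" "real p * x \<in> X" "real q * x \<in> X"
        using inv that by (auto simp: times_invariant_def)
      from this[THEN imageI[of _ _ uminus]] show "- x + 1 \<in> ?Y" "- x - 1 \<in> ?Y" "real p * - x \<in> ?Y" "real q * - x \<in> ?Y"
        by simp_all
    qed
    moreover have "closed ?Y" using inv by (simp add: times_invariant_def closed_negations)
    ultimately show ?thesis unfolding times_invariant_def by blast
  qed
  have "?Y = UNIV"
  proof (rule times_invariant_UNIV_pos[OF ind inv'])
    fix d :: real assume "d > 0"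
    then obtain x where x: "x \<in> X" "x \<noteq> 0" "dist x 0 < min d d0"
      using lim d0 unfolding islimpt_approachable by (metis min_less_iff_conj)
    then have "0 < - x" "- x < d" using d0(2)[of x] x by (auto simp: dist_real_def abs_real_def split: if_splits)
    then show "\<exists>x\<in>?Y. 0 < x \<and> x < d" using \<open>x \<in> X\<close> by blast
  qed
  have "x \<in> X" for x
  proof -
    have "- x \<in> ?Y" using \<open>?Y = UNIV\<close> by simp
    then show ?thesis by (simp only: image_iff) auto
  qed
  then show ?thesis by auto
qed

text \<open>Each of the four maps scales distances by a positive constant, so it carries limit
  points to limit points.\<close>

lemma times_invariant_limpts:
  assumes p: "2 \<le> p" "2 \<le> q" and inv: "times_invariant p q X"
  shows "times_invariant p q {x. x islimpt X}"
proof -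
  have shift: "f x islimpt X"
    if x: "x islimpt X" and f: "\<And>x. x \<in> X \<Longrightarrow> f x \<in> X" "c > 0" "\<And>x y. dist (f x) (f y) = c * dist x y" for f x c
    unfolding islimpt_approachable
  proof (intro allI impI)
    fix e :: real assume "e > 0"
    then obtain y where y: "y \<in> X" "y \<noteq> x" "dist y x < e / c"
      using x \<open>c > 0\<close> by (meson divide_pos_pos islimpt_approachable)
    have "dist (f y) (f x) < e" using y f by (simp add: field_simps)
    moreover have "dist (f y) (f x) \<noteq> 0" using y f by simp
    ultimately show "\<exists>x'\<in>X. x' \<noteq> f x \<and> dist x' (f x) < e" using f(1)[OF y(1)] by auto
  qed
  have m: "dist (real n * x) (real n * y) = real n * dist x y" for n x y
    by (simp add: dist_real_def abs_mult flip: right_diff_distrib)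
  show ?thesis
    using inv p shift[of _ "\<lambda>x. x + 1" 1] shift[of _ "\<lambda>x. x - 1" 1]
      shift[of _ "\<lambda>x. real p * x" "real p"] shift[of _ "\<lambda>x. real q * x" "real q"]
    by (auto simp: times_invariant_def closed_limpts m) (auto simp: dist_real_def)
qed

text \<open>A rational point is preperiodic modulo 1: some multiple \<open>s\<close> of
  \<open>r\<close>, still a limit point, is fixed modulo 1 by \<open>p ^ u\<close> and
  \<open>q ^ u\<close>. Translating \<open>s\<close> to 0 leads back to the previous lemma for the
  pair \<open>p ^ u\<close>, \<open>q ^ u\<close>, which is still independent.\<close>

lemma times_invariant_UNIV_rational:
  assumes ind: "mult_independent p q" and inv: "times_invariant p q X"
    and r: "r \<in> \<rat>" "r islimpt X"
  shows "X = UNIV"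
proof -
  have p: "2 \<le> p" "2 \<le> q" using ind by (auto simp: mult_independent_def)
  obtain a b where ab: "b > 0" "r = of_int a / of_int b"
    using r(1) by (metis Rats_cases')
  \<comment> \<open>Pairs of residues, so that the pigeonhole principle yields the same
    \<open>m < n\<close> for \<open>p\<close> and for \<open>q\<close>.\<close>
  define F where "F = (\<lambda>n::nat. (int p ^ n mod b, int q ^ n mod b))"
  have "range F \<subseteq> {0..<b} \<times> {0..<b}" using ab by (auto simp: F_def)
  then have "\<not> inj F"
    by (meson finite_SigmaI finite_atLeastLessThan_int finite_imageD finite_subset infinite_UNIV_nat)
  then obtain m n where mn: "m < n" "F m = F n"
    by (metis injI linorder_neqE_nat)
  define u where "u = n - m"
  have u: "u > 0" using mn by (simp add: u_def)
  \<comment> \<open>Both powers are put in because the congruence for \<open>p\<close> needs a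
    factor \<open>p ^ m\<close> and the one for \<open>q\<close> a factor
    \<open>q ^ m\<close>.\<close>
  define s where "s = real p ^ m * real q ^ m * r"
  have s: "s islimpt X"
    using times_invariant_power[OF times_invariant_limpts[OF p inv]] r(2) by (simp add: s_def)
  have int: "\<exists>k. real c ^ u * s - s = of_int k" if c: "int c ^ m mod b = int c ^ n mod b" "c = p \<or> c = q" for c
  proof -
    have "b dvd int c ^ n - int c ^ m" using c by (simp add: mod_eq_dvd_iff[symmetric])
    then obtain k where k: "int c ^ n - int c ^ m = b * k" by (elim dvdE)
    obtain d where d: "real p ^ m * real q ^ m = real c ^ m * of_int d"
    proof (cases "c = p")
      case True
      show ?thesis by (rule that[of "int q ^ m"]) (simp add: True)
    next
      case False
      show ?thesis by (rule that[of "int p ^ m"]) (use False c in simp)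
    qed
    have "real c ^ u * real c ^ m = real c ^ n" using mn by (simp add: u_def flip: power_add)
    then have "real c ^ u * s - s = (real c ^ n - real c ^ m) * of_int d * r"
      by (simp add: s_def d algebra_simps)
    also have "real c ^ n - real c ^ m = of_int (int c ^ n - int c ^ m)" by simp
    also have "\<dots> * of_int d * r = of_int (k * d * a)"
      using ab by (simp add: k)
    finally show ?thesis by blast
  qed
  have "int p ^ m mod b = int p ^ n mod b" "int q ^ m mod b = int q ^ n mod b"
    using mn(2) by (simp_all add: F_def)
  then obtain kp kq where k: "real p ^ u * s - s = of_int kp" "real q ^ u * s - s = of_int kq"
    using int[of p] int[of q] by blast
  let ?Y = "(\<lambda>x. x - s) ` X"
  have inv': "times_invariant (p ^ u) (q ^ u) ?Y"
  proof -
    have "closed ?Y" using inv by (simp add: times_invariant_def closed_translation_subtract)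
    moreover have "x - s + 1 \<in> ?Y" "x - s - 1 \<in> ?Y" if "x \<in> X" for x
    proof -
      have "x - 1 \<in> X" "x + 1 \<in> X" using inv that by (auto simp: times_invariant_def)
      from this[THEN imageI[of _ _ "\<lambda>x. x - s"]] show "x - s + 1 \<in> ?Y" "x - s - 1 \<in> ?Y"
        by (simp_all add: algebra_simps)
    qed
    moreover have "real c ^ u * (x - s) \<in> ?Y" 
      if "x \<in> X" "real c ^ u * s - s = of_int k" "c = p \<or> c = q" for x c k
    proof -
      have "real c ^ u * x \<in> X"
        using that times_invariant_power[OF inv, of x u 0] times_invariant_power[OF inv, of x 0 u] by auto
      then have "real c ^ u * x - of_int k \<in> X" by (rule times_invariant_diff_int[OF inv])
      moreover have "real c ^ u * (x - s) = (real c ^ u * x - of_int k) - s"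
        using that(2) by (simp add: algebra_simps)
      ultimately show ?thesis by blast
    qed
    ultimately show ?thesis using k unfolding times_invariant_def of_nat_power by blast
  qed
  have "0 islimpt ?Y"
    unfolding islimpt_approachable
  proof (intro allI impI)
    fix e :: real assume "e > 0"
    then obtain x where "x \<in> X" "x \<noteq> s" "dist x s < e" using s by (auto simp: islimpt_approachable)
    then show "\<exists>x'\<in>?Y. x' \<noteq> 0 \<and> dist x' 0 < e" by (intro bexI[of _ "x - s"]) (auto simp: dist_real_def)
  qed
  then have Y: "?Y = UNIV"
    using times_invariant_UNIV[OF mult_independent_power[OF ind u] inv'] by simp
  have "x \<in> X" for x
  proof -
    have "x - s \<in> ?Y" using Y by simp
    then show ?thesis by auto
  qed
  then show ?thesis by auto
qed

section \<open>Difference sets and progressions in invariant sets\<close>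

text \<open>The difference set of \<open>Y\<close> is again closed and invariant. The orbit of the
  irrational \<open>y\<close> makes \<open>Y\<close> infinite modulo 1, so differences accumulate at
  0; hence the difference set is the whole line and contains \<open>c\<close>.\<close>

lemma times_invariant_differences:
  assumes ind: "mult_independent p q" and inv: "times_invariant p q Y"
    and y: "y \<in> Y" "y \<notin> \<rat>"
  shows "\<exists>x\<in>Y. x + c \<in> Y"
proof -
  have p: "2 \<le> p" "2 \<le> q" using ind by (auto simp: mult_independent_def)
  define D where "D = {x - y | x y. x \<in> Y \<and> y \<in> Y}"
  have memD: "x - y \<in> D" if "x \<in> Y" "y \<in> Y" for x y using that by (auto simp: D_def)
  \<comment> \<open>By periodicity one of the two points can be taken from a compact interval, and
    differences of a closed and a compact set form a closed set.\<close>
  have "D = (\<Union>x\<in>Y. \<Union>y\<in>Y \<inter> {0..1}. {x - y})"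
  proof
    show "D \<subseteq> (\<Union>x\<in>Y. \<Union>y\<in>Y \<inter> {0..1}. {x - y})"
    proof
      fix z assume "z \<in> D"
      then obtain x y where xy: "x \<in> Y" "y \<in> Y" "z = x - y" by (auto simp: D_def)
      let ?n = "\<lfloor>y\<rfloor>"
      have "x - of_int ?n \<in> Y" "y - of_int ?n \<in> Y"
        using xy times_invariant_diff_int[OF inv] by auto
      moreover have "y - of_int ?n \<in> {0..1}" unfolding atLeastAtMost_iff by linarith
      ultimately show "z \<in> (\<Union>x\<in>Y. \<Union>y\<in>Y \<inter> {0..1}. {x - y})"
        using xy(3) by (intro UN_I[of "x - of_int ?n"] UN_I[of "y - of_int ?n"]) auto
    qed
  qed (auto simp: D_def)
  moreover have "closed (\<Union>x\<in>Y. \<Union>y\<in>Y \<inter> {0..1}. {x - y})"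
    using inv by (intro closed_compact_differences closed_Int_compact) (auto simp: times_invariant_def)
  ultimately have "closed D" by simp
  moreover have "z + 1 \<in> D \<and> z - 1 \<in> D \<and> real p * z \<in> D \<and> real q * z \<in> D" if zD: "z \<in> D" for z
  proof -
    obtain x y where xy: "x \<in> Y" "y \<in> Y" "z = x - y" using zD unfolding D_def by blast
    have "z + 1 = (x + 1) - y" "z - 1 = (x - 1) - y" "real p * z = real p * x - real p * y"
      "real q * z = real q * x - real q * y"
      unfolding xy(3) by (simp_all add: right_diff_distrib)
    then show ?thesis using inv xy(1,2) memD unfolding times_invariant_def by metis
  qed
  ultimately have invD: "times_invariant p q D" by (simp add: times_invariant_def)
  define F where "F = (\<lambda>n. frac (real p ^ n * y))"
  have "inj F"
  proof (rule linorder_injI)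
    fix m n :: nat assume "m < n"
    show "F m \<noteq> F n"
    proof
      assume "F m = F n"
      then have "real p ^ n * y - real p ^ m * y = of_int (\<lfloor>real p ^ n * y\<rfloor> - \<lfloor>real p ^ m * y\<rfloor>)"
        by (simp add: F_def frac_def)
      then have "real p ^ n * y - real p ^ m * y \<in> \<int>" by (metis Ints_of_int)
      then have *: "(real p ^ n - real p ^ m) * y \<in> \<rat>"
        using Ints_subset_Rats by (auto simp: left_diff_distrib)
      have "real p ^ n - real p ^ m \<noteq> 0" using p \<open>m < n\<close> by simp
      moreover have "real p ^ n - real p ^ m \<in> \<rat>" by simp
      ultimately have "y \<in> \<rat>"
        using Rats_divide[OF *, of "real p ^ n - real p ^ m"] by simp
      then show False using y by simp
    qed
  qed
  moreover have "range F \<subseteq> Y \<inter> {0..1}"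
  proof
    fix z assume "z \<in> range F"
    then obtain n where z: "z = frac (real p ^ n * y)" by (auto simp: F_def)
    have "real p ^ n * y \<in> Y" using times_invariant_power[OF inv y(1), of n 0] by simp
    then have "z \<in> Y" using times_invariant_diff_int[OF inv] by (simp add: z frac_def)
    then show "z \<in> Y \<inter> {0..1}" using frac_lt_1[of "real p ^ n * y"] by (simp add: z less_imp_le)
  qed
  ultimately have "infinite (Y \<inter> {0..1})"
    by (meson finite_imageD finite_subset infinite_UNIV_nat)
  moreover have "compact (Y \<inter> {0..1})"
    using inv by (intro closed_Int_compact) (auto simp: times_invariant_def)
  ultimately obtain z where z: "z \<in> Y" "z islimpt Y \<inter> {0..1}"
    by (metis IntE Heine_Borel_imp_Bolzano_Weierstrass subset_refl)
  have "0 islimpt D"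
    unfolding islimpt_approachable
  proof (intro allI impI)
    fix e :: real assume "e > 0"
    then obtain x where "x \<in> Y" "x \<noteq> z" "dist x z < e" using z(2) by (auto simp: islimpt_approachable)
    then show "\<exists>x'\<in>D. x' \<noteq> 0 \<and> dist x' 0 < e"
      using memD[of x z] z(1) by (intro bexI[of _ "x - z"]) (auto simp: dist_real_def)
  qed
  then have "c \<in> D" using times_invariant_UNIV[OF ind invD] by simp
  then show ?thesis by (force simp: D_def)
qed

text \<open>Both multiplications fix \<open>c\<close> modulo 1, so the set of \<open>x\<close> with
  \<open>x\<close> and \<open>x + c\<close> in \<open>Y\<close> is again invariant; it is nonempty
  by \<open>times_invariant_differences\<close> and contains no rational. Each such passage
  lengthens the progression by one term.\<close>

lemma times_invariant_progression:
  assumes ind: "mult_independent p q" and t: "real p * c - c \<in> \<int>" "real q * c - c \<in> \<int>"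
  shows "times_invariant p q Y \<Longrightarrow> Y \<noteq> {} \<Longrightarrow> Y \<inter> \<rat> = {} \<Longrightarrow> \<exists>x. \<forall>i\<le>n. x + real i * c \<in> Y"
proof (induction n arbitrary: Y)
  case 0
  then show ?case by auto
next
  case (Suc n)
  define Z where "Z = {x\<in>Y. x + c \<in> Y}"
  note inv = Suc.prems(1)
  have "closed Z"
  proof -
    have "Z = Y \<inter> (\<lambda>x. x - c) ` Y" by (force simp: Z_def image_iff)
    then show ?thesis using inv by (auto simp: times_invariant_def closed_translation_subtract)
  qed
  moreover have "x + 1 \<in> Z \<and> x - 1 \<in> Z" if "x \<in> Z" for x
  proof -
    have "x + c + 1 \<in> Y" "x + c - 1 \<in> Y" "x + 1 \<in> Y" "x - 1 \<in> Y"
      using inv that by (auto simp: times_invariant_def Z_def)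
    then show ?thesis by (simp add: Z_def algebra_simps)
  qed
  moreover have mult: "real r * x \<in> Z" if xZ: "x \<in> Z" and r: "r = p \<or> r = q" for x r
  proof -
    obtain k where k: "real r * c - c = of_int k" using t r by (auto elim: Ints_cases)
    have *: "real r * (x + c) \<in> Y" "real r * x \<in> Y"
      using inv xZ r by (auto simp: times_invariant_def Z_def)
    have "real r * (x + c) - of_int k \<in> Y" by (rule times_invariant_diff_int[OF inv *(1)])
    also have "real r * (x + c) - of_int k = real r * x + c" using k by (simp add: algebra_simps)
    finally show ?thesis using * by (simp add: Z_def)
  qed
  ultimately have "times_invariant p q Z" by (simp add: times_invariant_def)
  moreover have "Z \<noteq> {}"
  proof -
    obtain y where "y \<in> Y" using Suc.prems by auto
    then show ?thesis
      using times_invariant_differences[OF ind inv, of y c] Suc.prems(3) by (auto simp: Z_def)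
  qed
  moreover have "Z \<inter> \<rat> = {}" using Suc.prems(3) by (auto simp: Z_def)
  ultimately obtain x where x: "\<forall>i\<le>n. x + real i * c \<in> Z" using Suc.IH by blast
  have "x + real i * c \<in> Y" if "i \<le> Suc n" for i
  proof (cases i)
    case 0
    then show ?thesis using x by (auto simp: Z_def)
  next
    case (Suc j)
    then have "x + real j * c + c \<in> Y" using x that by (auto simp: Z_def)
    then show ?thesis using Suc by (simp add: algebra_simps)
  qed
  then show ?case by blast
qed

text \<open>Boshernitzan's argument: if the set of limit points contained no rational number, it would
  contain a progression with difference \<open>1 / t\<close> and \<open>t\<close> terms for arbitrarily large \<open>t\<close> coprime to
  \<open>p q\<close>, hence be dense.\<close>

theorem Furstenberg:
  assumes ind: "mult_independent p q" and inv: "times_invariant p q X"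
    and inf: "infinite (X \<inter> {0..<1})"
  shows "X = UNIV"
proof -
  have p: "2 \<le> p" "2 \<le> q" using ind by (auto simp: mult_independent_def)
  define Y where "Y = {x. x islimpt X}"
  have invY: "times_invariant p q Y" unfolding Y_def by (rule times_invariant_limpts[OF p inv])
  have "\<exists>r\<in>Y. r \<in> \<rat>"
  proof (rule ccontr)
    assume "\<not> (\<exists>r\<in>Y. r \<in> \<rat>)"
    then have irr: "Y \<inter> \<rat> = {}" by auto
    have "Y \<noteq> {}"
    proof -
      have "X \<inter> {0..<1} \<subseteq> {0..1}" by auto
      then obtain z where "z islimpt X \<inter> {0..<1}"
        using inf Heine_Borel_imp_Bolzano_Weierstrass[of "{0..1::real}"] by auto
      then have "z islimpt X" by (rule islimpt_subset) auto
      then show ?thesis by (auto simp: Y_def)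
    qed
    have "y \<in> closure Y" for y
      unfolding closure_approachable
    proof (intro allI impI)
      fix e :: real assume "e > 0"
      then obtain m where m: "inverse (real (Suc m)) < e" using reals_Archimedean by blast
      define t where "t = p * q * m + 1"
      have "1 \<le> p * q" using p by (simp add: Suc_le_eq)
      then have "m \<le> p * q * m" using mult_le_mono1[of 1 "p * q" m] by simp
      then have "m < t" unfolding t_def by linarith
      then have t: "0 < t" "1 / real t < e"
        using m by (auto simp: inverse_eq_divide intro!: le_less_trans[OF _ m] divide_left_mono)
      \<comment> \<open>By Euler's theorem \<open>p ^ u\<close> and \<open>q ^ u\<close> are 1
        modulo \<open>t\<close>, so multiplication by them fixes \<open>1 / t\<close> modulo 1, as
        \<open>times_invariant_progression\<close> requires.\<close>
      define u where "u = totient t"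
      have u: "u > 0" using t by (simp add: u_def)
      have int: "real (r ^ u) * (1 / real t) - 1 / real t \<in> \<int>" if "r = p \<or> r = q" for r
      proof -
        have "r dvd p * q * m" using that by auto
        then have "coprime r (p * q * m + 1)"
          by (intro coprimeI) (meson dvd_add_right_iff dvd_trans)
        then have "[r ^ u = 1] (mod t)" unfolding u_def t_def by (rule euler_theorem)
        then have "int t dvd int r ^ u - 1"
          by (metis cong_iff_dvd_diff cong_int_iff of_nat_1 of_nat_power)
        then obtain k where "int r ^ u - 1 = int t * k" by (elim dvdE)
        then have "real_of_int (int r ^ u - 1) = of_int (int t * k)" by simp
        then have "real (r ^ u) - 1 = real t * of_int k" by simp
        then have "real (r ^ u) * (1 / real t) - 1 / real t = of_int k"
          using t by (simp add: field_simps)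
        then show ?thesis by simp
      qed
      obtain x where x: "\<forall>i\<le>t. x + real i * (1 / real t) \<in> Y"
        using times_invariant_progression[OF mult_independent_power[OF ind u] int int
            times_invariant_powers[OF invY] \<open>Y \<noteq> {}\<close> irr] by auto
      \<comment> \<open>\<open>x + k / t\<close> is the last point not exceeding \<open>y\<close> in
        the full lattice of step \<open>1 / t\<close> through \<open>x\<close>; splitting
        \<open>k\<close> modulo \<open>t\<close> places it in the progression up to an integer
        translation.\<close>
      define k where "k = \<lfloor>(y - x) * real t\<rfloor>"
      define i where "i = nat (k mod int t)"
      have "i \<le> t" using t by (simp add: i_def nat_le_iff less_imp_le)
      then have "x + real i * (1 / real t) + of_int (k div int t) \<in> Y"
        using x by (intro times_invariant_add_int[OF invY]) auto
      also have "x + real i * (1 / real t) + of_int (k div int t) = x + of_int k / real t"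
      proof -
        have "real i = of_int (k mod int t)" using t by (simp add: i_def)
        then have "real_of_int k = of_int (k div int t) * real t + real i"
          by (metis div_mult_mod_eq of_int_add of_int_mult of_int_of_nat_eq)
        then show ?thesis using t by (simp add: field_simps)
      qed
      finally have mem: "x + of_int k / real t \<in> Y" .
      have "of_int k \<le> (y - x) * real t" "(y - x) * real t \<le> of_int k + 1"
        unfolding k_def by linarith+
      then have "of_int k / real t \<le> y - x" "y - x \<le> of_int k / real t + 1 / real t"
        using t by (simp_all add: field_simps)
      then have "dist (x + of_int k / real t) y < e" using t(2) by (simp add: dist_real_def)
      then show "\<exists>x\<in>Y. dist x y < e" using mem by blast
    qed
    then have "0 \<in> Y" using invY by (simp add: times_invariant_def)
    then show False using irr by auto
  qed
  then show ?thesis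
    using times_invariant_UNIV_rational[OF ind inv] by (auto simp: Y_def)
qed

section \<open>Seminorms on algebras of periodic functions\<close>

text \<open>The instance in view is the trigonometric polynomials with a C*-norm transported along
  the symbol map. \<open>M_le\<close> says that the supremum norm dominates
  \<open>M\<close>.\<close>

locale periodic_function_algebra =
  fixes P :: "(real \<Rightarrow> complex) set" and M :: "(real \<Rightarrow> complex) \<Rightarrow> real"
  assumes const_closed: "(\<lambda>_. c) \<in> P"
    and add_closed: "f \<in> P \<Longrightarrow> g \<in> P \<Longrightarrow> (\<lambda>\<theta>. f \<theta> + g \<theta>) \<in> P"
    and mult_closed: "f \<in> P \<Longrightarrow> g \<in> P \<Longrightarrow> (\<lambda>\<theta>. f \<theta> * g \<theta>) \<in> P"
    and cnj_closed: "f \<in> P \<Longrightarrow> (\<lambda>\<theta>. cnj (f \<theta>)) \<in> P"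
    and continuous: "f \<in> P \<Longrightarrow> continuous_on UNIV f"
    and periodic: "f \<in> P \<Longrightarrow> f (\<theta> + 1) = f \<theta>"
    and M_nonneg: "f \<in> P \<Longrightarrow> 0 \<le> M f"
    and M_add: "f \<in> P \<Longrightarrow> g \<in> P \<Longrightarrow> M (\<lambda>\<theta>. f \<theta> + g \<theta>) \<le> M f + M g"
    and M_mult: "f \<in> P \<Longrightarrow> g \<in> P \<Longrightarrow> M (\<lambda>\<theta>. f \<theta> * g \<theta>) \<le> M f * M g"
    and M_cnj: "f \<in> P \<Longrightarrow> M (\<lambda>\<theta>. cnj (f \<theta>)) \<le> M f"
    and M_le: "f \<in> P \<Longrightarrow> (\<And>\<theta>. cmod (f \<theta>) \<le> B) \<Longrightarrow> M f \<le> B"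
begin

lemma power_closed: "f \<in> P \<Longrightarrow> (\<lambda>\<theta>. f \<theta> ^ n) \<in> P"
  by (induction n) (auto intro: const_closed mult_closed)

lemma sum_closed: "(\<And>i. i \<in> I \<Longrightarrow> f i \<in> P) \<Longrightarrow> (\<lambda>\<theta>. \<Sum>i\<in>I. f i \<theta>) \<in> P"
  by (induction I rule: infinite_finite_induct) (auto intro: const_closed add_closed)

lemma scale_closed: "f \<in> P \<Longrightarrow> (\<lambda>\<theta>. c * f \<theta>) \<in> P"
  by (intro mult_closed const_closed)

lemma M_power: "f \<in> P \<Longrightarrow> M (\<lambda>\<theta>. f \<theta> ^ n) \<le> M f ^ n"
proof (induction n)
  case 0
  then show ?case using M_le[OF const_closed[of 1], of 1] by simp
next
  case (Suc n)
  have "M (\<lambda>\<theta>. f \<theta> * f \<theta> ^ n) \<le> M f * M (\<lambda>\<theta>. f \<theta> ^ n)"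
    using Suc.prems by (intro M_mult power_closed)
  also have "\<dots> \<le> M f * M f ^ n" using Suc M_nonneg by (intro mult_left_mono) auto
  finally show ?case by simp
qed

lemma M_sum:
  assumes "finite I" "\<And>i. i \<in> I \<Longrightarrow> f i \<in> P"
  shows "M (\<lambda>\<theta>. \<Sum>i\<in>I. f i \<theta>) \<le> (\<Sum>i\<in>I. M (f i))"
  using assms
proof (induction I rule: finite_induct)
  case empty
  then show ?case using M_le[OF const_closed[of 0], of 0] by simp
next
  case (insert i I)
  then have "M (\<lambda>\<theta>. f i \<theta> + (\<Sum>i\<in>I. f i \<theta>)) \<le> M (f i) + M (\<lambda>\<theta>. \<Sum>i\<in>I. f i \<theta>)"
    by (intro M_add sum_closed) auto
  then show ?case using insert by simp
qed

lemma M_scale: "f \<in> P \<Longrightarrow> M (\<lambda>\<theta>. c * f \<theta>) \<le> cmod c * M f"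
  using M_mult[OF const_closed[of c], of f] mult_right_mono[OF M_le[OF const_closed[of c], of "cmod c"], of "M f"]
    M_nonneg[of f] by simp

lemma shift_int:
  assumes "f \<in> P"
  shows "f (\<theta> + of_int n) = f \<theta>"
proof (induction n rule: int_induct[of _ 0])
  case (step1 i)
  then show ?case using periodic[OF assms, of "\<theta> + of_int i"] by (simp add: add.assoc)
next
  case (step2 i)
  then show ?case using periodic[OF assms, of "\<theta> + of_int (i - 1)"] by (simp add: add.assoc)
qed simp

lemma frac_eq: "f \<in> P \<Longrightarrow> f (frac \<theta>) = f \<theta>"
  using shift_int[of f \<theta> "- \<lfloor>\<theta>\<rfloor>"] by (simp add: frac_def)

lemma bounded:
  assumes "f \<in> P"
  obtains B where "1 \<le> B" "\<And>\<theta>. cmod (f \<theta>) \<le> B"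
proof -
  have "compact (f ` {0..1})"
    using continuous[OF assms] by (intro compact_continuous_image) (auto intro: continuous_on_subset)
  then obtain B where B: "\<forall>z\<in>f ` {0..1}. cmod z \<le> B"
    using compact_imp_bounded bounded_iff by metis
  have "cmod (f \<theta>) \<le> max 1 B" for \<theta>
    using B frac_eq[OF assms, of \<theta>] frac_lt_1[of \<theta>]
    by (metis atLeastAtMost_iff frac_ge_0 imageI less_imp_le max.coboundedI2)
  then show ?thesis using that[of "max 1 B"] by simp
qed

text \<open>The points whose evaluation is contractive for \<open>M\<close>: in Gelfand terms, the
  part of the spectrum of the completion that is visible on the line.\<close>

definition K :: "real set" where
  "K = {\<theta>. \<forall>f\<in>P. cmod (f \<theta>) \<le> M f}"

text \<open>If \<open>f\<close> vanishes on \<open>K\<close>, then by compactness the set where \<open>f\<close> is not small is covered by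
  finitely many sets \<open>{h > 1}\<close> with \<open>h \<ge> 0\<close> and \<open>M h < 1\<close>. The sum \<open>g\<close> of high powers of these \<open>h\<close>
  is at least 1 there but has tiny \<open>M g\<close>. With \<open>w = 1 - g / B\<close>, in \<open>f = f w\<^sup>J + f (1 - w\<^sup>J)\<close> the first
  summand is uniformly small and the second one is a multiple of \<open>g\<close>.\<close>

lemma M_eq_0:
  assumes f: "f \<in> P" and vanish: "\<And>\<theta>. \<theta> \<in> K \<Longrightarrow> f \<theta> = 0"
  shows "M f = 0"
proof -
  have "M f \<le> e" if "e > 0" for e
  proof -
    define \<epsilon> where "\<epsilon> = e / 2"
    have \<epsilon>: "\<epsilon> > 0" using that by (simp add: \<epsilon>_def)
    define C where "C = {\<theta>\<in>{0..1}. cmod (f \<theta>) \<ge> \<epsilon>}"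
    have "closed {\<theta>. \<epsilon> \<le> cmod (f \<theta>)}"
      using continuous[OF f] by (intro closed_Collect_le continuous_intros)
    moreover have "C = {\<theta>. \<epsilon> \<le> cmod (f \<theta>)} \<inter> {0..1}" by (auto simp: C_def)
    ultimately have "compact C" by (simp add: closed_Int_compact)
    define H where "H = {h\<in>P. (\<forall>\<theta>. h \<theta> = of_real (Re (h \<theta>)) \<and> 0 \<le> Re (h \<theta>)) \<and> M h < 1}"
    have "\<exists>h\<in>H. 1 < Re (h \<theta>)" if "\<theta> \<in> C" for \<theta>
    proof -
      have "f \<theta> \<noteq> 0" using that \<epsilon> by (auto simp: C_def)
      then have "\<theta> \<notin> K" using vanish by auto
      then obtain g where g: "g \<in> P" "M g < cmod (g \<theta>)" by (auto simp: K_def not_le)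
      then obtain c where c: "M g < c" "c < cmod (g \<theta>)" using dense by blast
      have c0: "c > 0" using M_nonneg[OF g(1)] c by linarith
      define u where "u = (\<lambda>\<theta>. of_real (1 / c) * g \<theta>)"
      have u: "u \<in> P" unfolding u_def using g(1) by (rule scale_closed)
      have "M u \<le> cmod (of_real (1 / c)) * M g" unfolding u_def using g(1) by (rule M_scale)
      also have "\<dots> < 1" using c c0 by (simp add: norm_divide)
      finally have Mu: "M u < 1" .
      \<comment> \<open>The squared modulus is nonnegative, so no cancellation can occur when powers
        of several such functions are added.\<close>
      define h where "h = (\<lambda>\<theta>. u \<theta> * cnj (u \<theta>))"
      have h: "h \<in> P" unfolding h_def using u by (intro mult_closed cnj_closed)
      have "M h \<le> M u * M (\<lambda>\<theta>. cnj (u \<theta>))"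
        unfolding h_def using u by (intro M_mult cnj_closed)
      also have "\<dots> \<le> M u * M u" using u M_nonneg M_cnj by (intro mult_left_mono) auto
      also have "\<dots> < 1" using Mu M_nonneg[OF u] mult_strict_mono[of "M u" 1 "M u" 1] by simp
      finally have "M h < 1" .
      have eq: "h \<theta> = of_real ((cmod (u \<theta>))\<^sup>2)" for \<theta>
        by (simp only: h_def complex_norm_square)
      have "cmod (u \<theta>) > 1" using c c0 by (simp add: u_def norm_mult norm_divide)
      then have "1 < Re (h \<theta>)" by (simp add: eq)
      moreover have "h \<in> H" using h \<open>M h < 1\<close> by (simp add: H_def eq)
      ultimately show ?thesis by blast
    qed
    then have cover: "C \<subseteq> (\<Union>h\<in>H. {\<theta>. 1 < Re (h \<theta>)})" by auto
    have open_h: "open {\<theta>. 1 < Re (h \<theta>)}" if "h \<in> H" for h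
      using that continuous[of h] by (intro open_Collect_less continuous_intros) (auto simp: H_def)
    obtain H' where H': "H' \<subseteq> H" "finite H'" "C \<subseteq> (\<Union>h\<in>H'. {\<theta>. 1 < Re (h \<theta>)})"
      by (rule compactE_image[OF \<open>compact C\<close> open_h cover])
    obtain Bf where Bf: "1 \<le> Bf" "\<And>\<theta>. cmod (f \<theta>) \<le> Bf" using bounded[OF f] by blast
    \<comment> \<open>Chosen to make \<open>Bf * exp (- \<Lambda>) \<le> \<epsilon>\<close>, for
      which \<open>\<Lambda> \<le> exp \<Lambda>\<close> is enough.\<close>
    define \<Lambda> where "\<Lambda> = Bf / \<epsilon>"
    have \<Lambda>: "\<Lambda> > 0" using Bf \<epsilon> by (simp add: \<Lambda>_def)
    have exp\<Lambda>: "Bf * exp (- \<Lambda>) \<le> \<epsilon>"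
    proof -
      have "\<Lambda> \<le> exp \<Lambda>" using exp_ge_add_one_self[of \<Lambda>] by linarith
      then have "Bf \<le> \<epsilon> * exp \<Lambda>" using \<epsilon> by (simp add: \<Lambda>_def field_simps)
      then show ?thesis by (simp add: exp_minus field_simps)
    qed
    have "(\<lambda>n. \<Sum>h\<in>H'. M h ^ n) \<longlonglongrightarrow> (\<Sum>h\<in>H'. 0)"
      using H'(1) M_nonneg by (intro tendsto_sum LIMSEQ_realpow_zero) (auto simp: H_def)
    \<comment> \<open>This bound anticipates the cofactor of \<open>g\<close> in the final
      decomposition, whose modulus is at most \<open>Bf * (\<Lambda> + 1)\<close>.\<close>
    then have "eventually (\<lambda>n. (\<Sum>h\<in>H'. M h ^ n) < \<epsilon> / (Bf * (\<Lambda> + 1))) sequentially"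
      using \<epsilon> Bf \<Lambda> by (intro order_tendstoD) auto
    then obtain n where n: "(\<Sum>h\<in>H'. M h ^ n) < \<epsilon> / (Bf * (\<Lambda> + 1))"
      by (meson eventually_happens trivial_limit_sequentially)
    define g where "g = (\<lambda>\<theta>. \<Sum>h\<in>H'. h \<theta> ^ n)"
    define G where "G = (\<lambda>\<theta>. \<Sum>h\<in>H'. Re (h \<theta>) ^ n)"
    have gG: "g \<theta> = of_real (G \<theta>)" for \<theta>
      unfolding g_def G_def of_real_sum of_real_power using H'(1) by (intro sum.cong) (auto simp: H_def)
    have g: "g \<in> P" unfolding g_def using H'(1) by (intro sum_closed power_closed) (auto simp: H_def)
    have "M g \<le> (\<Sum>h\<in>H'. M (\<lambda>\<theta>. h \<theta> ^ n))"
      unfolding g_def using H' by (intro M_sum power_closed) (auto simp: H_def)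
    also have "\<dots> \<le> (\<Sum>h\<in>H'. M h ^ n)" using H' by (intro sum_mono M_power) (auto simp: H_def)
    finally have Mg: "M g \<le> \<epsilon> / (Bf * (\<Lambda> + 1))" using n by simp
    have G0: "0 \<le> G \<theta>" for \<theta>
      unfolding G_def using H'(1) by (intro sum_nonneg zero_le_power) (auto simp: H_def)
    have G1: "1 \<le> G \<theta>" if \<theta>: "\<theta> \<in> C" for \<theta>
    proof -
      obtain h where h: "h \<in> H'" "1 < Re (h \<theta>)" using H'(3) \<theta> by auto
      have "1 \<le> Re (h \<theta>) ^ n" using h by (intro one_le_power) simp
      also have "\<dots> \<le> G \<theta>"
        unfolding G_def using H' h by (intro member_le_sum zero_le_power) (auto simp: H_def)
      finally show ?thesis .
    qed
    obtain B where B: "1 \<le> B" "\<And>\<theta>. cmod (g \<theta>) \<le> B" using bounded[OF g] by blast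
    have GB: "G \<theta> \<le> B" for \<theta> using B(2)[of \<theta>] G0[of \<theta>] by (simp add: gG)
    \<comment> \<open>\<open>B\<close> depends on \<open>n\<close>, so the choice of
      \<open>n\<close> could not take it into account. With \<open>J\<close> about
      \<open>B * \<Lambda>\<close> only the ratio \<open>J / B\<close> matters: where
      \<open>f\<close> is not small, \<open>w ^ J\<close> has modulus at most
      \<open>exp (- \<Lambda>)\<close>, and the cofactor \<open>r\<close> is bounded by
      \<open>\<Lambda> + 1\<close> whatever \<open>B\<close> is.\<close>
    define J where "J = nat \<lceil>B * \<Lambda>\<rceil>"
    have J: "B * \<Lambda> \<le> real J" "real J \<le> B * \<Lambda> + 1"
      using mult_nonneg_nonneg[of B \<Lambda>] B \<Lambda> unfolding J_def by linarith+
    have J2: "real J / B \<le> \<Lambda> + 1"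
      using J(2) B(1) by (simp add: pos_divide_le_eq algebra_simps)
    define w where "w = (\<lambda>\<theta>. 1 + of_real (- 1 / B) * g \<theta>)"
    have w: "w \<in> P" unfolding w_def using g by (intro add_closed const_closed scale_closed)
    have wG: "w \<theta> = of_real (1 - G \<theta> / B)" for \<theta> by (simp add: w_def gG)
    have w01: "0 \<le> 1 - G \<theta> / B" "1 - G \<theta> / B \<le> 1" for \<theta>
      using G0[of \<theta>] GB[of \<theta>] B(1) by auto
    then have w1: "cmod (w \<theta>) \<le> 1" for \<theta> unfolding wG by (simp del: of_real_diff)
    \<comment> \<open>The quotient of \<open>1 - w ^ J\<close> by \<open>g\<close>, written as a
      geometric sum because \<open>g\<close> may vanish.\<close>
    define r where "r = (\<lambda>\<theta>. of_real (1 / B) * (\<Sum>j<J. w \<theta> ^ j))"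
    have r: "r \<in> P" unfolding r_def using w by (intro scale_closed sum_closed power_closed)
    have r_le: "cmod (r \<theta>) \<le> real J / B" for \<theta>
    proof -
      have "cmod (\<Sum>j<J. w \<theta> ^ j) \<le> (\<Sum>j<J. 1)"
        using w1 by (intro sum_norm_le) (auto simp: norm_power power_le_one)
      then show ?thesis using B(1) by (simp add: r_def norm_mult norm_divide divide_right_mono)
    qed
    have id: "f \<theta> = f \<theta> * w \<theta> ^ J + g \<theta> * (f \<theta> * r \<theta>)" for \<theta>
    proof -
      have "1 - w \<theta> ^ J = (1 - w \<theta>) * (\<Sum>j<J. w \<theta> ^ j)" by (rule one_diff_power_eq)
      also have "\<dots> = g \<theta> * r \<theta>" by (simp add: w_def r_def)
      finally have "f \<theta> * (w \<theta> ^ J + g \<theta> * r \<theta>) = f \<theta> * 1" by (simp add: algebra_simps)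
      then show ?thesis by (simp add: algebra_simps)
    qed
    have fw: "cmod (f \<theta> * w \<theta> ^ J) \<le> \<epsilon>" for \<theta>
    proof (cases "cmod (f \<theta>) < \<epsilon>")
      case True
      have "cmod (f \<theta>) * cmod (w \<theta>) ^ J \<le> \<epsilon> * 1"
        using True w1 \<epsilon> by (intro mult_mono power_le_one) auto
      then show ?thesis by (simp add: norm_mult norm_power)
    next
      case False
      then have "frac \<theta> \<in> C" using frac_lt_1[of \<theta>] by (simp add: C_def frac_eq[OF f] less_imp_le)
      then have "1 \<le> G (frac \<theta>)" by (rule G1)
      moreover have "G (frac \<theta>) = G \<theta>" using frac_eq[OF g, of \<theta>] by (simp add: gG)
      ultimately have "1 / B \<le> G \<theta> / B" using B(1) by (intro divide_right_mono) auto
      then have "1 - G \<theta> / B \<le> exp (- (1 / B))"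
        using exp_ge_add_one_self[of "- (1 / B)"] by linarith
      then have "(1 - G \<theta> / B) ^ J \<le> exp (- (1 / B)) ^ J" using w01 by (intro power_mono)
      also have "\<dots> = exp (- (real J / B))" by (simp flip: exp_of_nat_mult)
      also have "\<dots> \<le> exp (- \<Lambda>)" using J(1) B(1) by (simp add: pos_le_divide_eq mult.commute)
      finally have "cmod (w \<theta>) ^ J \<le> exp (- \<Lambda>)" using w01[of \<theta>] by (simp add: wG del: of_real_diff)
      then have "cmod (f \<theta>) * cmod (w \<theta>) ^ J \<le> Bf * exp (- \<Lambda>)"
        using Bf by (intro mult_mono) auto
      then show ?thesis using exp\<Lambda> by (simp add: norm_mult norm_power)
    qed
    have "M (\<lambda>\<theta>. f \<theta> * r \<theta>) \<le> Bf * (\<Lambda> + 1)"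
    proof (rule M_le)
      show "cmod (f \<theta> * r \<theta>) \<le> Bf * (\<Lambda> + 1)" for \<theta>
        unfolding norm_mult using Bf r_le[of \<theta>] J2 by (intro mult_mono) auto
    qed (use f r mult_closed in auto)
    then have "M g * M (\<lambda>\<theta>. f \<theta> * r \<theta>) \<le> \<epsilon> / (Bf * (\<Lambda> + 1)) * (Bf * (\<Lambda> + 1))"
      using Mg Bf \<Lambda> \<epsilon> M_nonneg[OF mult_closed[OF f r]] by (intro mult_mono) auto
    also have "\<dots> = \<epsilon>" using Bf \<Lambda> by simp
    finally have 2: "M (\<lambda>\<theta>. g \<theta> * (f \<theta> * r \<theta>)) \<le> \<epsilon>"
      using M_mult[OF g mult_closed[OF f r]] by linarith
    have 1: "M (\<lambda>\<theta>. f \<theta> * w \<theta> ^ J) \<le> \<epsilon>"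
      using fw f w by (intro M_le mult_closed power_closed)
    have "f = (\<lambda>\<theta>. f \<theta> * w \<theta> ^ J + g \<theta> * (f \<theta> * r \<theta>))" using id by blast
    then have "M f \<le> M (\<lambda>\<theta>. f \<theta> * w \<theta> ^ J) + M (\<lambda>\<theta>. g \<theta> * (f \<theta> * r \<theta>))"
      using M_add[OF mult_closed[OF f power_closed[OF w, of J]] mult_closed[OF g mult_closed[OF f r]]]
      by simp
    then show ?thesis using 1 2 by (simp add: \<epsilon>_def)
  qed
  then have "M f \<le> 0" by (rule field_le_epsilon) simp
  then show ?thesis using M_nonneg[OF f] by simp
qed

end

section \<open>Symbols\<close>

definition e :: "real \<Rightarrow> complex" where
  "e y = cis (2 * pi * y)"

lemma e_add: "e (x + y) = e x * e y"
  by (simp add: e_def cis_mult algebra_simps)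

lemma e_0 [simp]: "e 0 = 1"
  by (simp add: e_def)

lemma norm_e [simp]: "cmod (e y) = 1"
  by (simp add: e_def)

lemma e_minus: "e (- y) = cnj (e y)"
  by (simp add: e_def cis_cnj)

lemma e_power: "e y ^ n = e (real n * y)"
  unfolding e_def Complex.DeMoivre by (simp add: algebra_simps)

lemma e_eq_1_iff: "e y = 1 \<longleftrightarrow> y \<in> \<int>"
proof
  assume "e y = 1"
  then have "cos (2 * pi * y) = 1" by (metis Re_complex_of_real cis.sel(1) e_def of_real_1)
  then obtain n :: int where "2 * pi * y = of_int n * 2 * pi"
    by (auto simp: cos_one_2pi_int)
  then have "y = of_int n" by simp
  then show "y \<in> \<int>" by simp
next
  assume "y \<in> \<int>"
  then show "e y = 1"
    unfolding e_def by (rule cis_multiple_2pi)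
qed

lemma e_add_int: "n \<in> \<int> \<Longrightarrow> e (x + n) = e x"
  by (simp add: e_add e_eq_1_iff)

lemma e_eq_iff: "e x = e y \<longleftrightarrow> x - y \<in> \<int>"
proof -
  have "e x = e y * e (x - y)" by (simp flip: e_add)
  moreover have "e y \<noteq> 0" by (metis norm_e norm_zero zero_neq_one)
  ultimately show ?thesis by (auto simp: e_eq_1_iff[symmetric])
qed

lemma continuous_on_e [continuous_intros]:
  "continuous_on S f \<Longrightarrow> continuous_on S (\<lambda>x. e (f x))"
  unfolding e_def by (intro continuous_intros)

lemma Re_e: "Re (e y) = 2 * (cos (pi * y))\<^sup>2 - 1"
  using cos_double_cos[of "pi * y"] by (simp add: e_def algebra_simps)

locale pq_setting =
  fixes p q :: int
  assumes p: "2 \<le> p" and q: "2 \<le> q"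
    and indep: "\<not> (\<exists>r s :: nat. r > 0 \<and> s > 0 \<and> p ^ r = q ^ s)"
begin

definition G :: "(rat \<times> int \<times> int) monoid" where
  "G = semidirect_product (Z_inverting (p * q)) (integer_group \<times>\<times> integer_group) (pq_action p q)"

definition \<Gamma> :: "rat set" where
  "\<Gamma> = carrier (Z_inverting (p * q))"

text \<open>The dilation factor of \<open>t\<close> twice: \<open>scale\<close> is its rational
  value, acting on \<open>\<Gamma>\<close>, and \<open>\<rho>\<close> its real value, acting on the
  dual variable.\<close>

definition scale :: "int \<times> int \<Rightarrow> rat" where
  "scale t = of_int p powi fst t * of_int q powi snd t"

definition \<rho> :: "int \<times> int \<Rightarrow> real" where
  "\<rho> t = of_int p powi fst t * of_int q powi snd t"

sublocale group G
  unfolding G_def using p q by (intro group_semidirect_product_pq_action) auto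

lemma pq_action_eq: "pq_action p q t x = scale t * x"
  by (simp add: pq_action_def scale_def split_def)

lemma carrier_G: "(x, t) \<in> carrier G \<longleftrightarrow> x \<in> \<Gamma>"
  by (simp add: G_def \<Gamma>_def semidirect_product_def)

lemma mult_G: "(x, s) \<otimes>\<^bsub>G\<^esub> (y, t) = (x + scale s * y, s + t)"
  by (cases s; cases t) (simp add: G_def semidirect_product_def Z_inverting_def pq_action_eq)

lemma one_G: "\<one>\<^bsub>G\<^esub> = (0, 0)"
  by (simp add: G_def semidirect_product_def Z_inverting_def zero_prod_def)

lemma scale_0 [simp]: "scale 0 = 1"
  by (simp add: scale_def)

lemma of_rat_scale: "of_rat (scale t) = \<rho> t"
  by (simp add: scale_def \<rho>_def of_rat_mult power_int_def of_rat_power of_rat_inverse)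

lemma \<rho>_0 [simp]: "\<rho> 0 = 1"
  by (simp add: \<rho>_def)

lemma \<rho>_pos: "\<rho> t > 0"
  using p q by (simp add: \<rho>_def)

text \<open>Take logarithms: exponents of equal sign cannot cancel, and for opposite signs
  cancellation would mean that a positive power of \<open>p\<close> equals one of \<open>q\<close>.
  This is the freeness behind the generic points used later.\<close>

lemma \<rho>_eq_1_iff: "\<rho> t = 1 \<longleftrightarrow> t = 0"
proof
  assume *: "\<rho> t = 1"
  obtain n m where t: "t = (n, m)" by (cases t)
  have pos: "ln (real_of_int p) > 0" "ln (real_of_int q) > 0" using p q by auto
  have "ln (\<rho> t) = of_int n * ln (of_int p) + of_int m * ln (of_int q)"
    using p q by (simp add: \<rho>_def t ln_mult powr_real_of_int' flip: ln_powr)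
  then have eq: "of_int n * ln (real_of_int p) + of_int m * ln (real_of_int q) = 0" using * by simp
  have False if nz: "n \<noteq> 0 \<or> m \<noteq> 0"
  proof -
    have "real_of_int (n * m) < 0"
    proof (rule ccontr)
      assume "\<not> real_of_int (n * m) < 0"
      then have "0 \<le> n * m" by linarith
      then consider "0 \<le> n" "0 \<le> m" | "n \<le> 0" "m \<le> 0" by (auto simp: zero_le_mult_iff)
      then show False
      proof cases
        case 1
        then have "0 < of_int n * ln (real_of_int p) + of_int m * ln (real_of_int q)"
          using nz pos by (cases "n = 0") (auto intro: add_pos_nonneg)
        then show False using eq by simp
      next
        case 2
        then have "of_int n * ln (real_of_int p) \<le> 0" "of_int m * ln (real_of_int q) \<le> 0"
          using pos by (auto simp: mult_le_0_iff)
        moreover have "of_int n * ln (real_of_int p) < 0 \<or> of_int m * ln (real_of_int q) < 0"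
          using 2 nz pos by (auto simp: mult_less_0_iff)
        ultimately show False using eq by linarith
      qed
    qed
    then have ne: "n \<noteq> 0" "m \<noteq> 0" by auto
    have "\<bar>of_int n * ln (real_of_int p)\<bar> = \<bar>of_int m * ln (real_of_int q)\<bar>" using eq by linarith
    then have "real (nat \<bar>n\<bar>) * ln (real_of_int p) = real (nat \<bar>m\<bar>) * ln (real_of_int q)"
      using pos by (simp add: abs_mult)
    then have "ln (real_of_int (p ^ nat \<bar>n\<bar>)) = ln (real_of_int (q ^ nat \<bar>m\<bar>))"
      using p q by (simp add: ln_realpow)
    then have "real_of_int (p ^ nat \<bar>n\<bar>) = real_of_int (q ^ nat \<bar>m\<bar>)"
      using p q by (subst (asm) ln_inj_iff) auto
    then have "p ^ nat \<bar>n\<bar> = q ^ nat \<bar>m\<bar>" by (simp only: of_int_eq_iff)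
    then show False using indep ne by (metis zero_less_abs_iff zero_less_nat_eq)
  qed
  then show "t = 0" by (auto simp: t zero_prod_def)
qed simp

lemma \<Gamma>_scale: "x \<in> \<Gamma> \<Longrightarrow> scale t * x \<in> \<Gamma>"
  unfolding \<Gamma>_def using pq_action_closed[of p q x t] p q by (simp add: pq_action_eq)

lemma \<Gamma>_of_int: "of_int k \<in> \<Gamma>"
  unfolding \<Gamma>_def carrier_Z_inverting using p q
  by (intro exI[of _ "k * (p * q)"] exI[of _ 1]) simp

lemma \<Gamma>_0: "0 \<in> \<Gamma>"
  using \<Gamma>_of_int[of 0] by simp

lemma \<Gamma>_minus: "x \<in> \<Gamma> \<Longrightarrow> - x \<in> \<Gamma>"
  unfolding \<Gamma>_def carrier_Z_inverting by (metis minus_divide_left of_int_minus)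

lemma \<Gamma>_clear_denominator:
  assumes "x \<in> \<Gamma>"
  shows "\<exists>n. \<forall>k\<ge>n. scale (int k, int k) * x \<in> \<int>"
proof -
  obtain a n where x: "x = of_int a / of_int (p * q) ^ n"
    using assms by (auto simp: \<Gamma>_def carrier_Z_inverting)
  have "scale (int k, int k) * x \<in> \<int>" if "n \<le> k" for k
  proof -
    have "scale (int k, int k) * x = of_int (p * q) ^ (k - n) * of_int a"
      using that p q by (simp add: scale_def x power_diff power_mult_distrib field_simps)
    then show ?thesis by simp
  qed
  then show ?thesis by blast
qed

lemma inv_G: "x \<in> \<Gamma> \<Longrightarrow> inv\<^bsub>G\<^esub> (x, 0) = (- x, 0)" "inv\<^bsub>G\<^esub> (0, t) = (0, - t)"
  by (rule inv_equality; simp add: carrier_G mult_G one_G \<Gamma>_minus \<Gamma>_0)+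

definition symbol :: "(rat \<times> int \<times> int \<Rightarrow> complex) \<Rightarrow> int \<times> int \<Rightarrow> real \<Rightarrow> complex" where
  "symbol f t \<theta> = pairing f (\<lambda>(x, s). if s = t then e (\<theta> * of_rat x) else 0)"

definition homogeneous :: "int \<times> int \<Rightarrow> (rat \<times> int \<times> int \<Rightarrow> complex) set" where
  "homogeneous t = {f \<in> carrier A. snd ` supp f \<subseteq> {t}}"

definition integral_elements :: "(rat \<times> int \<times> int \<Rightarrow> complex) set" where
  "integral_elements = {f \<in> homogeneous 0. fst ` supp f \<subseteq> \<int>}"

lemma homogeneousD: "f \<in> homogeneous t \<Longrightarrow> f \<in> carrier A" "f \<in> homogeneous t \<Longrightarrow> (x, s) \<in> supp f \<Longrightarrow> s = t"
  by (auto simp: homogeneous_def)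

lemma integral_elementsD: "f \<in> integral_elements \<Longrightarrow> f \<in> homogeneous 0"
  "f \<in> integral_elements \<Longrightarrow> f \<in> carrier A"
  by (auto simp: integral_elements_def homogeneous_def)

lemma supp_in_\<Gamma>: "f \<in> carrier A \<Longrightarrow> (x, s) \<in> supp f \<Longrightarrow> x \<in> \<Gamma>"
  using carrier_group_algebraD(2) carrier_G by blast

lemma finite_supp: "f \<in> carrier A \<Longrightarrow> finite (supp f)"
  by (simp add: carrier_group_algebra)

lemma symbol_add:
  "f \<in> carrier A \<Longrightarrow> g \<in> carrier A \<Longrightarrow> symbol (\<lambda>x. f x + g x) t \<theta> = symbol f t \<theta> + symbol g t \<theta>"
  by (simp add: symbol_def pairing_add finite_supp)

lemma symbol_scale: "symbol (\<lambda>x. c * f x) t \<theta> = c * symbol f t \<theta>"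
  by (simp add: symbol_def pairing_scale)

lemma symbol_single: "symbol (single (x, s)) t \<theta> = (if s = t then e (\<theta> * of_rat x) else 0)"
  by (simp add: symbol_def pairing_single_left)

lemma symbol_zero_if_homogeneous: "f \<in> homogeneous s \<Longrightarrow> s \<noteq> t \<Longrightarrow> symbol f t \<theta> = 0"
  unfolding symbol_def pairing_def by (intro sum.neutral) (auto dest: homogeneousD(2))

text \<open>The multiplication of a crossed product: moving a function past the group element
  \<open>s\<close> dilates its variable, since \<open>e (\<theta> * (x + scale s * y)) = e (\<theta>
  * x) * e (\<theta> * \<rho> s * y)\<close>.\<close>

lemma symbol_mult:
  assumes "f \<in> carrier A" "g \<in> carrier A"
  shows "symbol (f \<otimes>\<^bsub>A\<^esub> g) t \<theta> = pairing f (\<lambda>(x, s). e (\<theta> * of_rat x) * symbol g (t - s) (\<theta> * \<rho> s))"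
proof -
  have inner: "pairing g (\<lambda>b. case a \<otimes>\<^bsub>G\<^esub> b of (x, s) \<Rightarrow> if s = t then e (\<theta> * of_rat x) else 0) =
    (case a of (x, s) \<Rightarrow> e (\<theta> * of_rat x) * symbol g (t - s) (\<theta> * \<rho> s))" for a
  proof -
    obtain x s where a: "a = (x, s)" by (cases a)
    have "(\<lambda>b. case a \<otimes>\<^bsub>G\<^esub> b of (x, s) \<Rightarrow> if s = t then e (\<theta> * of_rat x) else 0) =
      (\<lambda>b. e (\<theta> * of_rat x) * (case b of (y, r) \<Rightarrow> if r = t - s then e (\<theta> * \<rho> s * of_rat y) else 0))"
      by (auto simp: fun_eq_iff a mult_G of_rat_add of_rat_mult of_rat_scale distrib_left mult.assoc
          eq_diff_eq add.commute simp flip: e_add)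
    then show ?thesis by (simp add: a symbol_def pairing_scale_right)
  qed
  show ?thesis
    unfolding symbol_def[of "f \<otimes>\<^bsub>A\<^esub> g"] pairing_mult[OF finite_supp[OF assms(1)] finite_supp[OF assms(2)]]
    by (simp only: inner)
qed

lemma symbol_mult_left:
  assumes f: "f \<in> homogeneous s" and g: "g \<in> carrier A"
  shows "symbol (f \<otimes>\<^bsub>A\<^esub> g) t \<theta> = symbol f s \<theta> * symbol g (t - s) (\<theta> * \<rho> s)"
proof -
  have "symbol (f \<otimes>\<^bsub>A\<^esub> g) t \<theta> = pairing f (\<lambda>x. symbol g (t - s) (\<theta> * \<rho> s) *
      (case x of (x, s') \<Rightarrow> if s' = s then e (\<theta> * of_rat x) else 0))"
    unfolding symbol_mult[OF homogeneousD(1)[OF f] g]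
    by (rule pairing_cong[OF subset_refl]) (auto dest: homogeneousD(2)[OF f])
  then show ?thesis by (simp add: pairing_scale_right symbol_def[of f])
qed

lemma symbol_mult_right:
  assumes f: "f \<in> carrier A" and g: "g \<in> homogeneous r"
  shows "symbol (f \<otimes>\<^bsub>A\<^esub> g) t \<theta> = symbol f (t - r) \<theta> * symbol g r (\<theta> * \<rho> (t - r))"
proof -
  have "symbol (f \<otimes>\<^bsub>A\<^esub> g) t \<theta> = pairing f (\<lambda>x. symbol g r (\<theta> * \<rho> (t - r)) *
      (case x of (x, s') \<Rightarrow> if s' = t - r then e (\<theta> * of_rat x) else 0))"
    unfolding symbol_mult[OF f homogeneousD(1)[OF g]]
  proof (rule pairing_cong[OF subset_refl])
    fix a :: "rat \<times> int \<times> int"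
    obtain x s where a: "a = (x, s)" by (cases a)
    show "(case a of (x, s) \<Rightarrow> e (\<theta> * of_rat x) * symbol g (t - s) (\<theta> * \<rho> s)) = symbol g r (\<theta> * \<rho> (t - r)) *
      (case a of (x, s') \<Rightarrow> if s' = t - r then e (\<theta> * of_rat x) else 0)"
      using symbol_zero_if_homogeneous[OF g, of "t - s"] by (auto simp: a algebra_simps)
  qed
  then show ?thesis by (simp add: pairing_scale_right symbol_def[of f])
qed

lemma symbol_star:
  assumes f: "f \<in> homogeneous 0"
  shows "symbol (st f) 0 \<theta> = cnj (symbol f 0 \<theta>)"
proof -
  have "pairing f (\<lambda>x. cnj (case inv\<^bsub>G\<^esub> x of (x, s) \<Rightarrow> if s = 0 then e (\<theta> * of_rat x) else 0)) =
    pairing f (\<lambda>(x, s). if s = 0 then e (\<theta> * of_rat x) else 0)"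
  proof (rule pairing_cong[OF subset_refl])
    fix a assume a: "a \<in> supp f"
    obtain x s where xs: "a = (x, s)" by (cases a)
    have "s = 0" using homogeneousD(2)[OF f] a xs by auto
    moreover have "x \<in> \<Gamma>"
      using supp_in_\<Gamma>[OF homogeneousD(1)[OF f]] a xs by blast
    ultimately show "cnj (case inv\<^bsub>G\<^esub> a of (x, s) \<Rightarrow> if s = 0 then e (\<theta> * of_rat x) else 0) =
      (case a of (x, s) \<Rightarrow> if s = 0 then e (\<theta> * of_rat x) else 0)"
      by (simp add: xs inv_G of_rat_minus e_minus)
  qed
  then show ?thesis
    unfolding symbol_def by (simp only: pairing_star[OF homogeneousD(1)[OF f]])
qed

lemma norm_symbol_le: "cmod (symbol f t \<theta>) \<le> (\<Sum>x\<in>supp f. cmod (f x))"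
  unfolding symbol_def using norm_pairing_le[of f _ 1] by (auto split: prod.splits if_splits)

lemma continuous_on_symbol: "continuous_on UNIV (symbol f t)"
proof -
  have "continuous_on UNIV (\<lambda>\<theta>. case x of (x, s) \<Rightarrow> if s = t then e (\<theta> * of_rat x) else 0)" for x :: "rat \<times> int \<times> int"
    by (cases "snd x = t") (auto simp: split_def intro!: continuous_intros)
  then have "continuous_on UNIV (\<lambda>\<theta>. symbol f t \<theta>)"
    unfolding symbol_def pairing_def by (intro continuous_intros)
  then show ?thesis .
qed

lemma single_homogeneous: "x \<in> \<Gamma> \<Longrightarrow> single (x, t) \<in> homogeneous t"
  by (simp add: homogeneous_def single_closed carrier_G)

lemma homogeneous_add: "f \<in> homogeneous t \<Longrightarrow> g \<in> homogeneous t \<Longrightarrow> (\<lambda>x. f x + g x) \<in> homogeneous t"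
  using image_mono[OF supp_add[of f g], of snd] unfolding homogeneous_def mem_Collect_eq image_Un
  by (intro conjI group_algebra_add_closed) (blast, blast, blast)

lemma supp_scale: "supp (\<lambda>x. c * f x) \<subseteq> supp f"
  by (auto simp: supp_def)

lemma homogeneous_scale: "f \<in> homogeneous t \<Longrightarrow> (\<lambda>x. c * f x) \<in> homogeneous t"
  using supp_scale[of c f] by (auto simp: homogeneous_def group_algebra_scale_closed)

lemma supp_multE:
  assumes "z \<in> supp (f \<otimes>\<^bsub>A\<^esub> g)"
  obtains x s y t where "(x, s) \<in> supp f" "(y, t) \<in> supp g" "z = (x + scale s * y, s + t)"
  using assms supp_mult[of G f g] by (fastforce simp: mult_G)

lemma homogeneous_mult:
  assumes "f \<in> homogeneous s" "g \<in> homogeneous t"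
  shows "f \<otimes>\<^bsub>A\<^esub> g \<in> homogeneous (s + t)"
proof -
  have "f \<otimes>\<^bsub>A\<^esub> g \<in> carrier A" using assms by (intro mult_closed homogeneousD)
  moreover have "snd z = s + t" if "z \<in> supp (f \<otimes>\<^bsub>A\<^esub> g)" for z
    using that by (rule supp_multE) (auto dest: homogeneousD(2)[OF assms(1)] homogeneousD(2)[OF assms(2)])
  ultimately show ?thesis by (auto simp: homogeneous_def)
qed

lemma supp_star_homogeneous:
  assumes f: "f \<in> homogeneous 0"
  shows "supp (st f) = (\<lambda>(x, s). (- x, 0)) ` supp f"
proof -
  have "inv\<^bsub>G\<^esub> a = (case a of (x, s) \<Rightarrow> (- x, 0))" if a: "a \<in> supp f" for a
  proof -
    obtain x s where xs: "a = (x, s)" by (cases a)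
    have "s = 0" using homogeneousD(2)[OF f] a xs by auto
    moreover have "x \<in> \<Gamma>"
      using supp_in_\<Gamma>[OF homogeneousD(1)[OF f]] a xs by blast
    ultimately show ?thesis by (simp add: xs inv_G)
  qed
  then show ?thesis unfolding supp_star[OF homogeneousD(1)[OF f]] by (intro image_cong) auto
qed

lemma homogeneous_star: "f \<in> homogeneous 0 \<Longrightarrow> st f \<in> homogeneous 0"
  using supp_star_homogeneous[of f] star_closed[of f] by (auto simp: homogeneous_def)

lemma integral_elements_add:
  "f \<in> integral_elements \<Longrightarrow> g \<in> integral_elements \<Longrightarrow> (\<lambda>x. f x + g x) \<in> integral_elements"
  using supp_add[of f g] by (fastforce simp: integral_elements_def homogeneous_add)

lemma integral_elements_scale: "f \<in> integral_elements \<Longrightarrow> (\<lambda>x. c * f x) \<in> integral_elements"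
  using supp_scale[of c f] by (fastforce simp: integral_elements_def homogeneous_scale)

lemma integral_elements_mult:
  assumes f: "f \<in> integral_elements" and g: "g \<in> integral_elements"
  shows "f \<otimes>\<^bsub>A\<^esub> g \<in> integral_elements"
proof -
  have "f \<otimes>\<^bsub>A\<^esub> g \<in> homogeneous 0"
    using homogeneous_mult[of f 0 g 0] f g by (simp add: integral_elementsD)
  moreover have "fst z \<in> \<int>" if z: "z \<in> supp (f \<otimes>\<^bsub>A\<^esub> g)" for z
  proof -
    obtain x s y t where *: "(x, s) \<in> supp f" "(y, t) \<in> supp g" "z = (x + scale s * y, s + t)"
      using z by (rule supp_multE)
    have "s = 0" using homogeneousD(2)[OF integral_elementsD(1)[OF f] *(1)] .
    moreover have "x \<in> \<int>" "y \<in> \<int>" using f g *(1,2) by (force simp: integral_elements_def)+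
    ultimately show ?thesis using *(3) by simp
  qed
  ultimately show ?thesis by (auto simp: integral_elements_def)
qed

lemma integral_elements_star: "f \<in> integral_elements \<Longrightarrow> st f \<in> integral_elements"
  using supp_star_homogeneous[of f] homogeneous_star[of f]
  by (auto simp: integral_elements_def)

lemma single_integral: "single (of_int k, 0) \<in> integral_elements"
  by (simp add: integral_elements_def single_homogeneous \<Gamma>_of_int)

definition part :: "int \<times> int \<Rightarrow> (rat \<times> int \<times> int \<Rightarrow> complex) \<Rightarrow> rat \<times> int \<times> int \<Rightarrow> complex" where
  "part t f = (\<lambda>x. if snd x = t then f x else 0)"

lemma part_homogeneous:
  assumes "f \<in> carrier A"
  shows "part t f \<in> homogeneous t"
proof -
  have "supp (part t f) \<subseteq> supp f" by (auto simp: supp_def part_def)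
  moreover have "snd ` supp (part t f) \<subseteq> {t}" by (auto simp: supp_def part_def split: if_splits)
  ultimately show ?thesis
    using assms finite_subset[of "supp (part t f)" "supp f"] by (auto simp: homogeneous_def carrier_group_algebra)
qed

lemma symbol_part:
  assumes "f \<in> carrier A"
  shows "symbol (part t f) t \<theta> = symbol f t \<theta>"
proof -
  have "supp (part t f) \<subseteq> supp f" by (auto simp: supp_def part_def)
  then have "symbol (part t f) t \<theta> = (\<Sum>x\<in>supp f. part t f x * (case x of (x, s) \<Rightarrow> if s = t then e (\<theta> * of_rat x) else 0))"
    unfolding symbol_def using finite_supp[OF assms] by (intro pairing_superset)
  also have "\<dots> = symbol f t \<theta>"
    unfolding symbol_def pairing_def by (intro sum.cong) (auto simp: part_def)
  finally show ?thesis .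
qed

lemma sum_parts:
  assumes "finite T" "snd ` supp f \<subseteq> T"
  shows "f x = (\<Sum>t\<in>T. part t f x)"
proof (cases "x \<in> supp f")
  case True
  then have "snd x \<in> T" using assms by auto
  then show ?thesis using assms(1) by (simp add: part_def)
next
  case False
  then have "f x = 0" by (simp add: supp_def)
  moreover from this have "(\<Sum>t\<in>T. part t f x) = 0" by (intro sum.neutral) (simp add: part_def)
  ultimately show ?thesis by simp
qed

text \<open>The symbol of \<open>single (0, - t)\<close> is the constant 1, so multiplying by it on
  the right lowers the degree without touching the function. Questions about degree \<open>t\<close>
  thus reduce to degree 0.\<close>

lemma shift_homogeneous:
  assumes "f \<in> carrier A"
  shows "symbol (f \<otimes>\<^bsub>A\<^esub> single (0, - t)) 0 \<theta> = symbol f t \<theta>"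
    "f \<in> homogeneous t \<Longrightarrow> f \<otimes>\<^bsub>A\<^esub> single (0, - t) \<in> homogeneous 0"
  using symbol_mult_right[OF assms single_homogeneous[OF \<Gamma>_0, of "- t"], of 0]
    homogeneous_mult[OF _ single_homogeneous[OF \<Gamma>_0, of "- t"], of f t]
  by (simp_all add: symbol_single)

section \<open>Conjugation by Z^2 and reduction to integral elements\<close>

definition conjugate :: "int \<times> int \<Rightarrow> (rat \<times> int \<times> int \<Rightarrow> complex) \<Rightarrow> rat \<times> int \<times> int \<Rightarrow> complex" where
  "conjugate t f = single (0, t) \<otimes>\<^bsub>A\<^esub> f \<otimes>\<^bsub>A\<^esub> single (0, - t)"

lemma
  assumes f: "f \<in> homogeneous 0"
  shows conjugate_homogeneous: "conjugate t f \<in> homogeneous 0"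
    and symbol_conjugate: "symbol (conjugate t f) 0 \<theta> = symbol f 0 (\<theta> * \<rho> t)"
    and supp_conjugate: "supp (conjugate t f) \<subseteq> (\<lambda>(x, s). (scale t * x, 0)) ` supp f"
proof -
  have s: "single (0, t) \<in> homogeneous t" "single (0, - t) \<in> homogeneous (- t)"
    using \<Gamma>_0 by (auto intro: single_homogeneous)
  have 1: "single (0, t) \<otimes>\<^bsub>A\<^esub> f \<in> homogeneous t" using homogeneous_mult[OF s(1) f] by simp
  then show "conjugate t f \<in> homogeneous 0"
    using homogeneous_mult[OF 1 s(2)] by (simp add: conjugate_def)
  show "symbol (conjugate t f) 0 \<theta> = symbol f 0 (\<theta> * \<rho> t)"
    unfolding conjugate_def
    by (simp add: shift_homogeneous(1)[OF homogeneousD(1)[OF 1]] symbol_mult_left[OF s(1) homogeneousD(1)[OF f]] symbol_single)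
  show "supp (conjugate t f) \<subseteq> (\<lambda>(x, s). (scale t * x, 0)) ` supp f"
  proof
    fix z assume "z \<in> supp (conjugate t f)"
    then obtain x s y r where *: "(x, s) \<in> supp (single (0, t) \<otimes>\<^bsub>A\<^esub> f)" "(y, r) \<in> supp (single (0, - t))"
        "z = (x + scale s * y, s + r)"
      unfolding conjugate_def by (rule supp_multE)
    then obtain y' r' where "(y', r') \<in> supp f" "(x, s) = (0 + scale t * y', t + r')"
      by (elim supp_multE) auto
    moreover have "r' = 0" using homogeneousD(2)[OF f] calculation by auto
    ultimately show "z \<in> (\<lambda>(x, s). (scale t * x, 0)) ` supp f" using * by force
  qed
qed

text \<open>Conjugation by \<open>(k, k)\<close> multiplies the support by the \<open>k\<close>-th
  power of \<open>p * q\<close> and so clears its finitely many denominators at once; the sum of the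
  individual thresholds serves as a common one.\<close>

lemma conjugate_integral:
  assumes f: "f \<in> homogeneous 0"
  obtains t where "conjugate t f \<in> integral_elements"
proof -
  have fin: "finite (supp f)" using f by (simp add: finite_supp homogeneousD)
  have "\<forall>z\<in>supp f. \<exists>n. \<forall>k\<ge>n. scale (int k, int k) * fst z \<in> \<int>"
    using supp_in_\<Gamma>[OF homogeneousD(1)[OF f]] \<Gamma>_clear_denominator by fastforce
  then obtain n where n: "\<And>z k. z \<in> supp f \<Longrightarrow> n z \<le> k \<Longrightarrow> scale (int k, int k) * fst z \<in> \<int>"
    by metis
  define k where "k = (\<Sum>z\<in>supp f. n z)"
  have int: "scale (int k, int k) * fst z \<in> \<int>" if z: "z \<in> supp f" for z
    using fin unfolding k_def by (intro n[OF z] member_le_sum[OF z]) auto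
  have "fst z \<in> \<int>" if z: "z \<in> supp (conjugate (int k, int k) f)" for z
  proof -
    obtain x s where "(x, s) \<in> supp f" "z = (scale (int k, int k) * x, 0)"
      using z supp_conjugate[OF f, of "(int k, int k)"] by auto
    then show ?thesis using int[of "(x, s)"] by simp
  qed
  then have "conjugate (int k, int k) f \<in> integral_elements"
    using conjugate_homogeneous[OF f] by (auto simp: integral_elements_def)
  then show ?thesis using that by blast
qed

end

text \<open>Squaring doubles the radius, so the radius grows linearly in the exponent
  \<open>2 ^ n\<close>. Used for intervals in Z and for boxes in Z^2.\<close>

lemma (in group) supp_iter_square:
  fixes S :: "nat \<Rightarrow> 'a set"
  assumes "supp h \<subseteq> S R" "\<And>a x y. x \<in> S a \<Longrightarrow> y \<in> S a \<Longrightarrow> x \<otimes> y \<in> S (2 * a)"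
  shows "supp (iter_square n h) \<subseteq> S (2 ^ n * R)"
proof (induction n)
  case (Suc n)
  have "supp (iter_square (Suc n) h) \<subseteq> (\<lambda>(a, b). a \<otimes> b) ` (supp (iter_square n h) \<times> supp (iter_square n h))"
    using supp_mult by simp
  also have "\<dots> \<subseteq> S (2 * (2 ^ n * R))" using Suc assms(2) by fast
  finally show ?case by (simp add: mult.assoc)
qed (use assms in simp)

context pq_setting
begin

definition zball :: "nat \<Rightarrow> (rat \<times> int \<times> int) set" where
  "zball R = (\<lambda>k. (of_int k, 0)) ` {- int R..int R}"

lemma finite_zball: "finite (zball R)"
  by (simp add: zball_def)

lemma card_zball: "card (zball R) \<le> 2 * R + 1"
  unfolding zball_def by (rule order_trans[OF card_image_le]) auto

lemma zball_mult: "x \<in> zball a \<Longrightarrow> y \<in> zball a \<Longrightarrow> x \<otimes>\<^bsub>G\<^esub> y \<in> zball (2 * a)"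
  by (auto simp: zball_def mult_G simp flip: of_int_add)

lemma integral_zball:
  assumes f: "f \<in> integral_elements"
  obtains R where "supp f \<subseteq> zball R"
proof -
  define R where "R = (\<Sum>z\<in>supp f. nat \<bar>\<lfloor>fst z\<rfloor>\<bar>)"
  have "z \<in> zball R" if z: "z \<in> supp f" for z
  proof -
    have "nat \<bar>\<lfloor>fst z\<rfloor>\<bar> \<le> R"
      unfolding R_def using f z by (intro member_le_sum) (auto simp: finite_supp integral_elementsD)
    moreover have "fst z = of_int \<lfloor>fst z\<rfloor>" "snd z = 0"
      using f z homogeneousD(2)[OF integral_elementsD(1)[OF f], of "fst z" "snd z"]
      by (auto simp: integral_elements_def elim!: Ints_cases)
    ultimately show ?thesis
      unfolding zball_def by (intro image_eqI[of _ _ "\<lfloor>fst z\<rfloor>"]) (auto simp: prod_eq_iff)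
  qed
  then show ?thesis using that by blast
qed

text \<open>A Fourier coefficient is an average of the symbol against a character. Averaging over
  \<open>n\<close> equidistant points is exact for frequencies up to \<open>R\<close> and avoids
  integrals.\<close>

lemma norm_coefficient_le:
  assumes supp: "supp f \<subseteq> zball R" and B: "\<And>\<theta>. cmod (symbol f 0 \<theta>) \<le> B"
  shows "cmod (f z) \<le> B"
proof (cases "z \<in> zball R")
  case False
  then have "f z = 0" using supp by (auto simp: supp_def)
  then show ?thesis using order_trans[OF norm_ge_zero B[of 0]] by simp
next
  case True
  then obtain k where z: "z = (of_int k, 0)" and k: "k \<in> {- int R..int R}" by (auto simp: zball_def)
  \<comment> \<open>Two frequencies in the range differ by at most \<open>2 * R\<close>, so distinct
    ones remain distinct modulo \<open>n\<close>.\<close>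
  define n where "n = 2 * R + 1"
  have n: "n > 0" by (simp add: n_def)
  let ?I = "{- int R..int R}"
  have "inj_on (\<lambda>k. (rat_of_int k, 0 :: int \<times> int)) ?I" by (auto simp: inj_on_def)
  then have sym: "symbol f 0 \<theta> = (\<Sum>l\<in>?I. f (of_int l, 0) * e (\<theta> * of_int l))" for \<theta>
    unfolding symbol_def pairing_superset[OF finite_zball supp] unfolding zball_def
    by (subst sum.reindex) auto
  have inner: "(\<Sum>j<n. e (real j / real n * of_int l) * e (- (real j / real n * of_int k))) =
      (if l = k then of_nat n else 0)" if l: "l \<in> ?I" for l
  proof -
    define w where "w = e (of_int (l - k) / real n)"
    have "(\<Sum>j<n. e (real j / real n * of_int l) * e (- (real j / real n * of_int k))) = (\<Sum>j<n. w ^ j)"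
      by (intro sum.cong refl) (simp add: w_def e_power algebra_simps diff_divide_distrib flip: e_add)
    also have "\<dots> = (if l = k then of_nat n else 0)"
    proof (cases "l = k")
      case False
      have "w \<noteq> 1"
      proof
        assume "w = 1"
        then obtain m where "of_int (l - k) / real n = of_int m"
          unfolding w_def e_eq_1_iff by (elim Ints_cases)
        then have "real_of_int (l - k) = of_int (m * int n)" using n by (simp add: field_simps)
        then have "l - k = m * int n" by (simp only: of_int_eq_iff)
        moreover have "\<bar>l - k\<bar> < int n" using l k by (auto simp: n_def)
        ultimately show False using False
          by (metis abs_mult abs_of_nat abs_ge_zero dvd_imp_le_int dvd_triv_right eq_iff_diff_eq_0 not_less)
      qed
      moreover have "w ^ n = 1" using n by (simp add: w_def e_power e_eq_1_iff)
      ultimately show ?thesis using False by (simp add: sum_gp_strict)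
    qed (simp add: w_def)
    finally show ?thesis .
  qed
  have "(\<Sum>j<n. symbol f 0 (real j / real n) * e (- (real j / real n * of_int k))) =
    (\<Sum>l\<in>?I. f (of_int l, 0) * (\<Sum>j<n. e (real j / real n * of_int l) * e (- (real j / real n * of_int k))))"
    unfolding sym sum_distrib_left sum_distrib_right mult.assoc by (rule sum.swap)
  also have "\<dots> = (\<Sum>l\<in>?I. f (of_int l, 0) * (if l = k then of_nat n else 0))"
    by (intro sum.cong refl arg_cong2[where f = "(*)"] inner)
  also have "\<dots> = (\<Sum>l\<in>?I. if l = k then f (of_int l, 0) * of_nat n else 0)"
    by (intro sum.cong) auto
  also have "\<dots> = f z * of_nat n"
    using k by (simp add: z)
  finally have "real n * cmod (f z) = cmod (\<Sum>j<n. symbol f 0 (real j / real n) * e (- (real j / real n * of_int k)))"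
    by (simp add: norm_mult)
  also have "\<dots> \<le> (\<Sum>j<n. B)" using B by (intro sum_norm_le) (simp add: norm_mult)
  finally show ?thesis using n by simp
qed

text \<open>Uniqueness of Fourier coefficients: if the difference has zero symbol, its coefficients
  are bounded by 0.\<close>

lemma integral_elements_eqI:
  assumes f: "f \<in> integral_elements" and g: "g \<in> integral_elements"
    and eq: "symbol f 0 = symbol g 0"
  shows "f = g"
proof -
  let ?d = "\<lambda>x. f x + (-1) * g x"
  have d: "?d \<in> integral_elements" using f g by (intro integral_elements_add integral_elements_scale)
  then obtain R where R: "supp ?d \<subseteq> zball R" by (rule integral_zball)
  have "symbol ?d 0 \<theta> = 0" for \<theta>
    using f g eq symbol_add[of f "\<lambda>x. (-1) * g x" 0 \<theta>] symbol_scale[of "-1" g 0 \<theta>] integral_elements_scale[OF g, of "-1"]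
    by (simp add: integral_elementsD)
  then have "cmod (?d z) \<le> 0" for z by (intro norm_coefficient_le[OF R]) simp
  then show ?thesis by (simp add: fun_eq_iff)
qed

lemma symbol_mult_0:
  assumes "f \<in> homogeneous 0" "g \<in> carrier A"
  shows "symbol (f \<otimes>\<^bsub>A\<^esub> g) 0 \<theta> = symbol f 0 \<theta> * symbol g 0 \<theta>"
  using symbol_mult_left[OF assms, of 0] by simp

end

section \<open>Uniqueness of the norm\<close>

locale pq_Cstar = pq_setting +
  fixes N :: "(rat \<times> int \<times> int \<Rightarrow> complex) \<Rightarrow> real"
  assumes is_Cstar_norm_N: "is_Cstar_norm G N"
begin

sublocale Cstar_norm G N
  by unfold_locales (rule is_Cstar_norm_N)

text \<open>Each coefficient is at most the supremum of the symbol, so the norm of a power of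
  \<open>h\<close> is at most that supremum times the size of the support. This size grows linearly
  in the exponent and is removed by \<open>N_le_of_growth\<close>; that lemma needs
  self-adjointness, hence \<open>st f\<close> times \<open>f\<close>.\<close>

lemma N_integral_le:
  assumes f: "f \<in> integral_elements" and B: "\<And>\<theta>. cmod (symbol f 0 \<theta>) \<le> B"
  shows "N f \<le> B"
proof -
  note fA = integral_elementsD(2)[OF f]
  define h where "h = st f \<otimes>\<^bsub>A\<^esub> f"
  have h: "h \<in> integral_elements" unfolding h_def using f by (intro integral_elements_mult integral_elements_star)
  have hA: "h \<in> carrier A" using h by (rule integral_elementsD)
  have sa: "st h = h" using fA star_closed[OF fA] by (simp add: h_def star_mult star_star)
  have it: "iter_square n h \<in> integral_elements" for n
    by (induction n) (auto intro: h integral_elements_mult)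
  define \<Phi> where "\<Phi> = (\<lambda>g. SUP \<theta>. cmod (symbol g 0 \<theta>))"
  have bdd: "bdd_above (range (\<lambda>\<theta>. cmod (symbol g 0 \<theta>)))" for g
    by (rule bdd_aboveI2) (rule norm_symbol_le)
  have le: "cmod (symbol g 0 \<theta>) \<le> \<Phi> g" for g \<theta>
    unfolding \<Phi>_def by (rule cSUP_upper[OF _ bdd]) simp
  have least: "\<Phi> g \<le> c" if "\<And>\<theta>. cmod (symbol g 0 \<theta>) \<le> c" for g c
    unfolding \<Phi>_def using that by (intro cSUP_least) auto
  have nonneg: "0 \<le> \<Phi> g" for g using order_trans[OF norm_ge_zero le] .
  obtain R where R: "supp h \<subseteq> zball R" using h by (rule integral_zball)
  have "N h \<le> \<Phi> h"
  proof (rule N_le_of_growth[OF hA sa nonneg])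
    fix n
    show "\<Phi> (iter_square (Suc n) h) \<le> (\<Phi> (iter_square n h))\<^sup>2"
    proof (rule least)
      fix \<theta>
      have "cmod (symbol (iter_square (Suc n) h) 0 \<theta>) = (cmod (symbol (iter_square n h) 0 \<theta>))\<^sup>2"
        using it[of n] by (simp add: symbol_mult_0 integral_elementsD norm_mult power2_eq_square)
      also have "\<dots> \<le> (\<Phi> (iter_square n h))\<^sup>2" using le by (intro power_mono) auto
      finally show "cmod (symbol (iter_square (Suc n) h) 0 \<theta>) \<le> (\<Phi> (iter_square n h))\<^sup>2" .
    qed
    let ?g = "iter_square n h" and ?R = "2 ^ n * R"
    have supp: "supp ?g \<subseteq> zball ?R" by (rule supp_iter_square[OF R zball_mult])
    have "N ?g \<le> (\<Sum>x\<in>supp ?g. cmod (?g x))" using it by (intro N_le_l1 integral_elementsD)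
    also have "\<dots> \<le> (\<Sum>x\<in>supp ?g. \<Phi> ?g)" by (intro sum_mono norm_coefficient_le[OF supp] le)
    also have "\<dots> = real (card (supp ?g)) * \<Phi> ?g" by simp
    also have "\<dots> \<le> (real (2 * R + 1) * 2 ^ n)\<^sup>2 * \<Phi> ?g"
    proof (rule mult_right_mono[OF _ nonneg])
      have "card (supp ?g) \<le> 2 * ?R + 1"
        using card_mono[OF finite_zball supp] card_zball[of ?R] by linarith
      also have "\<dots> \<le> (2 * R + 1) * 2 ^ n" by (simp add: algebra_simps)
      \<comment> \<open>The growth lemma carries a quadratic factor, as needed for Z^2; the linear
        count is simply bounded by its square.\<close>
      also have "\<dots> \<le> ((2 * R + 1) * 2 ^ n)\<^sup>2"
        using mult_le_mono[of 1 "2 * R + 1" 1 "2 ^ n"] by (intro self_le_power) simp_all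
      finally have "real (card (supp ?g)) \<le> real (((2 * R + 1) * 2 ^ n)\<^sup>2)" by (rule of_nat_mono)
      then show "real (card (supp ?g)) \<le> (real (2 * R + 1) * 2 ^ n)\<^sup>2"
        by (simp only: of_nat_power of_nat_mult[of _ "2 ^ n"] of_nat_numeral)
    qed
    finally show "N ?g \<le> (real (2 * R + 1) * 2 ^ n)\<^sup>2 * \<Phi> ?g" .
  qed
  also have "\<Phi> h \<le> B\<^sup>2"
  proof (rule least)
    fix \<theta>
    have "cmod (symbol h 0 \<theta>) = (cmod (symbol f 0 \<theta>))\<^sup>2"
      using f by (simp add: h_def symbol_mult_0 symbol_star homogeneous_star integral_elementsD norm_mult power2_eq_square)
    also have "\<dots> \<le> B\<^sup>2" using B by (intro power_mono) auto
    finally show "cmod (symbol h 0 \<theta>) \<le> B\<^sup>2" .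
  qed
  finally have "(N f)\<^sup>2 \<le> B\<^sup>2" using fA by (simp add: h_def N_star_mult)
  then show ?thesis using order_trans[OF norm_ge_zero B] by (rule power2_le_imp_le)
qed

lemma N_conjugate:
  assumes "f \<in> carrier A"
  shows "N (conjugate t f) = N f"
proof -
  have c: "(0, s) \<in> carrier G" for s by (simp add: carrier_G \<Gamma>_0)
  show ?thesis
    unfolding conjugate_def
    by (simp add: N_mult_single[OF mult_closed[OF single_closed[OF c] assms] c] N_mult_single[OF assms c])
qed

section \<open>Transfer to trigonometric polynomials on the circle\<close>

definition trig :: "(real \<Rightarrow> complex) set" where
  "trig = (\<lambda>f. symbol f 0) ` integral_elements"

text \<open>Meaningful on \<open>trig\<close> because a symbol determines its integral element, by
  \<open>integral_elements_eqI\<close>.\<close>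

definition trig_norm :: "(real \<Rightarrow> complex) \<Rightarrow> real" where
  "trig_norm u = N (the_inv_into integral_elements (\<lambda>f. symbol f 0) u)"

lemma trig_norm_symbol: "f \<in> integral_elements \<Longrightarrow> trig_norm (symbol f 0) = N f"
  unfolding trig_norm_def
  by (subst the_inv_into_f_f[of "\<lambda>f. symbol f 0"]) (auto intro: inj_onI integral_elements_eqI)

lemma symbol_add_fun:
  "f \<in> carrier A \<Longrightarrow> g \<in> carrier A \<Longrightarrow> (\<lambda>\<theta>. symbol f 0 \<theta> + symbol g 0 \<theta>) = symbol (\<lambda>x. f x + g x) 0"
  by (simp add: fun_eq_iff symbol_add)

lemma symbol_mult_fun:
  "f \<in> homogeneous 0 \<Longrightarrow> g \<in> carrier A \<Longrightarrow> (\<lambda>\<theta>. symbol f 0 \<theta> * symbol g 0 \<theta>) = symbol (f \<otimes>\<^bsub>A\<^esub> g) 0"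
  by (simp add: fun_eq_iff symbol_mult_0)

lemma symbol_star_fun:
  "f \<in> homogeneous 0 \<Longrightarrow> (\<lambda>\<theta>. cnj (symbol f 0 \<theta>)) = symbol (st f) 0"
  by (simp add: fun_eq_iff symbol_star)

lemma periodic_function_algebra_trig: "periodic_function_algebra trig trig_norm"
proof
  fix c
  have "(\<lambda>x. c * single (of_int 0, 0) x) \<in> integral_elements"
    by (intro integral_elements_scale single_integral)
  moreover have "symbol (\<lambda>x. c * single (of_int 0, 0) x) 0 = (\<lambda>_. c)"
    by (simp add: fun_eq_iff symbol_scale symbol_single)
  ultimately show "(\<lambda>_. c) \<in> trig" unfolding trig_def by (metis imageI)
next
  fix u v assume "u \<in> trig" "v \<in> trig"
  then obtain f g where f: "f \<in> integral_elements" "u = symbol f 0" and g: "g \<in> integral_elements" "v = symbol g 0"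
    by (auto simp: trig_def)
  note A = integral_elementsD[OF f(1)] integral_elementsD[OF g(1)]
  show "(\<lambda>\<theta>. u \<theta> + v \<theta>) \<in> trig" "(\<lambda>\<theta>. u \<theta> * v \<theta>) \<in> trig"
    unfolding f g symbol_add_fun[OF A(2,4)] symbol_mult_fun[OF A(1,4)] trig_def
    by (intro imageI integral_elements_add integral_elements_mult f g)+
  show "trig_norm (\<lambda>\<theta>. u \<theta> + v \<theta>) \<le> trig_norm u + trig_norm v"
    unfolding f g symbol_add_fun[OF A(2,4)]
    using f g A by (simp add: trig_norm_symbol integral_elements_add N_add)
  show "trig_norm (\<lambda>\<theta>. u \<theta> * v \<theta>) \<le> trig_norm u * trig_norm v"
    unfolding f g symbol_mult_fun[OF A(1,4)]
    using f g A by (simp add: trig_norm_symbol integral_elements_mult N_mult)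
next
  fix u assume "u \<in> trig"
  then obtain f where f: "f \<in> integral_elements" "u = symbol f 0" by (auto simp: trig_def)
  note A = integral_elementsD[OF f(1)]
  show "(\<lambda>\<theta>. cnj (u \<theta>)) \<in> trig"
    unfolding f symbol_star_fun[OF A(1)] trig_def by (intro imageI integral_elements_star f)
  show "trig_norm (\<lambda>\<theta>. cnj (u \<theta>)) \<le> trig_norm u"
    unfolding f symbol_star_fun[OF A(1)] using f A by (simp add: trig_norm_symbol integral_elements_star N_star)
  show "continuous_on UNIV u" unfolding f by (rule continuous_on_symbol)
  show "0 \<le> trig_norm u" using f A by (simp add: trig_norm_symbol N_nonneg)
  show "u (\<theta> + 1) = u \<theta>" for \<theta>
    unfolding f symbol_def
  proof (rule pairing_cong[OF subset_refl])
    fix a assume "a \<in> supp f"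
    then obtain k where "fst a = of_int k" using f(1) by (auto simp: integral_elements_def elim!: Ints_cases)
    then show "(case a of (x, s) \<Rightarrow> if s = 0 then e ((\<theta> + 1) * of_rat x) else 0) =
      (case a of (x, s) \<Rightarrow> if s = 0 then e (\<theta> * of_rat x) else 0)"
      by (cases a) (simp add: distrib_right e_add_int)
  qed
  show "trig_norm u \<le> B" if "\<And>\<theta>. cmod (u \<theta>) \<le> B" for B
    using N_integral_le[OF f(1)] that f by (simp add: trig_norm_symbol)
qed

text \<open>The invariance of \<open>T.K\<close> comes from conjugation by the generators of Z^2: it
  preserves \<open>N\<close>, dilates symbols by \<open>p\<close> or \<open>q\<close>, and keeps
  supports integral. Conjugation by their inverses would not keep them integral, so only the
  multiplicative semigroup acts on the circle.\<close>

lemma norm_symbol_integral_le: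
  assumes f: "f \<in> integral_elements"
  shows "cmod (symbol f 0 \<theta>) \<le> N f"
proof -
  interpret T: periodic_function_algebra trig trig_norm by (rule periodic_function_algebra_trig)
  have K_iff: "\<theta> \<in> T.K \<longleftrightarrow> (\<forall>f\<in>integral_elements. cmod (symbol f 0 \<theta>) \<le> N f)" for \<theta>
    unfolding T.K_def by (auto simp: trig_def trig_norm_symbol)
  have mult: "real (nat c) * \<theta> \<in> T.K" if \<theta>: "\<theta> \<in> T.K" and c: "c = p \<or> c = q" for \<theta> c
    unfolding K_iff
  proof
    fix f assume f: "f \<in> integral_elements"
    define t where "t = (if c = p then (1, 0) else (0, 1) :: int \<times> int)"
    have t: "scale t = of_int c" "\<rho> t = of_int c" using c by (auto simp: t_def scale_def \<rho>_def)
    have "fst z \<in> \<int>" if z: "z \<in> supp (conjugate t f)" for z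
    proof -
      obtain x s where "(x, s) \<in> supp f" "z = (of_int c * x, 0)"
        using z supp_conjugate[OF integral_elementsD(1)[OF f], of t] t by auto
      then show ?thesis using f by (force simp: integral_elements_def)
    qed
    then have "conjugate t f \<in> integral_elements"
      using conjugate_homogeneous[OF integral_elementsD(1)[OF f]] by (auto simp: integral_elements_def)
    then have "cmod (symbol (conjugate t f) 0 \<theta>) \<le> N (conjugate t f)" using \<theta> K_iff by blast
    then show "cmod (symbol f 0 (real (nat c) * \<theta>)) \<le> N f"
      using c p q f by (auto simp: symbol_conjugate integral_elementsD N_conjugate t mult.commute)
  qed
  have "closed T.K"
  proof -
    have "T.K = (\<Inter>u\<in>trig. {\<theta>. cmod (u \<theta>) \<le> trig_norm u})" by (auto simp: T.K_def)
    moreover have "closed {\<theta>. cmod (u \<theta>) \<le> trig_norm u}" if "u \<in> trig" for u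
      using T.continuous[OF that] by (intro closed_Collect_le continuous_intros)
    ultimately show ?thesis by auto
  qed
  moreover have shift: "\<theta> + of_int n \<in> T.K" if "\<theta> \<in> T.K" for \<theta> n
    using that by (auto simp: T.K_def T.shift_int)
  ultimately have inv: "times_invariant (nat p) (nat q) T.K"
    using mult shift[of _ 1] shift[of _ "-1"] by (auto simp: times_invariant_def)
  have ind: "mult_independent (nat p) (nat q)"
    unfolding mult_independent_def
  proof (intro conjI allI impI)
    fix r s :: nat assume rs: "0 < r" "0 < s"
    show "nat p ^ r \<noteq> nat q ^ s"
    proof
      assume "nat p ^ r = nat q ^ s"
      then have "int (nat p ^ r) = int (nat q ^ s)" by simp
      then have "p ^ r = q ^ s" using p q by simp
      then show False using indep rs by blast
    qed
  qed (use p q in auto)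
  have "infinite (T.K \<inter> {0..<1})"
  proof
    let ?F = "T.K \<inter> {0..<1}"
    assume fin: "finite ?F"
    \<comment> \<open>A trigonometric polynomial whose zeros modulo 1 are exactly the finitely many
      points of \<open>T.K\<close>; it is not zero, but \<open>T.M_eq_0\<close> gives it norm
      0.\<close>
    define u where "u = (\<lambda>\<theta>. \<Prod>z\<in>?F. (e \<theta> + - e z))"
    have e_trig: "e \<in> trig"
    proof -
      have "symbol (single (of_int 1, 0)) 0 = e" by (simp add: fun_eq_iff symbol_single)
      then show ?thesis unfolding trig_def using single_integral by (metis imageI)
    qed
    have u: "u \<in> trig"
    proof -
      have "(\<lambda>\<theta>. \<Prod>z\<in>F. (e \<theta> + - e z)) \<in> trig" if "finite F" for F
        using that
        by (induction F rule: finite_induct)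
          (auto intro!: T.const_closed T.mult_closed T.add_closed e_trig simp del: add_uminus_conv_diff)
      then show ?thesis unfolding u_def using fin by blast
    qed
    have "u \<theta> = 0" if "\<theta> \<in> T.K" for \<theta>
    proof -
      have "frac \<theta> \<in> ?F" using shift[OF that, of "- \<lfloor>\<theta>\<rfloor>"] by (simp add: frac_def frac_lt_1[unfolded frac_def])
      moreover have "e \<theta> = e (frac \<theta>)" by (simp add: e_eq_iff frac_def)
      ultimately show ?thesis unfolding u_def using fin by (intro prod_zero) auto
    qed
    then have "trig_norm u = 0" using T.M_eq_0[OF u] by blast
    moreover obtain f where f: "f \<in> integral_elements" "u = symbol f 0" using u by (auto simp: trig_def)
    ultimately have "N f = 0" by (simp add: trig_norm_symbol)
    then have "f = (\<lambda>_. 0)" using N_eq_0_iff f by (simp add: integral_elementsD)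
    then have u0: "u \<theta> = 0" for \<theta> by (simp add: f symbol_def pairing_def)
    have "infinite ({0..<1::real} - ?F)" using fin by (intro Diff_infinite_finite) auto
    then have "{0..<1::real} - ?F \<noteq> {}" by (metis finite.emptyI)
    then obtain \<theta> where \<theta>: "\<theta> \<in> {0..<1}" "\<theta> \<notin> ?F" by blast
    have "e \<theta> + - e z \<noteq> 0" if z: "z \<in> ?F" for z
    proof
      assume "e \<theta> + - e z = 0"
      then have "\<theta> - z \<in> \<int>" by (simp add: e_eq_iff)
      then obtain n where n: "\<theta> - z = of_int n" by (elim Ints_cases)
      moreover have "\<bar>\<theta> - z\<bar> < 1" using \<theta>(1) z by auto
      ultimately have "\<bar>real_of_int n\<bar> < 1" by simp
      then have "n = 0" by linarith
      then have "\<theta> = z" using n by simp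
      then show False using \<theta> z by simp
    qed
    then have "u \<theta> \<noteq> 0" unfolding u_def using fin by (simp only: prod_zero_iff) blast
    then show False using u0 by simp
  qed
  then have "T.K = UNIV" by (rule Furstenberg[OF ind inv])
  then show ?thesis using K_iff f by auto
qed

text \<open>Both bounds are carried over from an integral conjugate: conjugation preserves
  \<open>N\<close> and dilates the variable of the symbol by a positive number.\<close>

lemma homogeneous_0:
  assumes f: "f \<in> homogeneous 0"
  shows norm_symbol_homogeneous_0_le: "cmod (symbol f 0 \<theta>) \<le> N f"
    and N_homogeneous_0_le: "(\<And>\<theta>. cmod (symbol f 0 \<theta>) \<le> B) \<Longrightarrow> N f \<le> B"
proof -
  obtain t where t: "conjugate t f \<in> integral_elements" using f by (rule conjugate_integral)
  note fA = homogeneousD(1)[OF f]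
  show "cmod (symbol f 0 \<theta>) \<le> N f"
    using norm_symbol_integral_le[OF t, of "\<theta> / \<rho> t"] \<rho>_pos[of t] by (simp add: symbol_conjugate[OF f] N_conjugate[OF fA])
  show "N f \<le> B" if "\<And>\<theta>. cmod (symbol f 0 \<theta>) \<le> B"
    using N_integral_le[OF t] that by (simp add: symbol_conjugate[OF f] N_conjugate[OF fA])
qed

lemma N_shift:
  assumes "f \<in> carrier A"
  shows "N (f \<otimes>\<^bsub>A\<^esub> single (0, t)) = N f"
  using assms by (intro N_mult_single) (simp_all add: carrier_G \<Gamma>_0)

lemma N_homogeneous_le:
  assumes f: "f \<in> homogeneous t" and B: "\<And>\<theta>. cmod (symbol f t \<theta>) \<le> B"
  shows "N f \<le> B"
  using N_homogeneous_0_le[OF shift_homogeneous(2)[OF homogeneousD(1)[OF f] f], of B] B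
  by (simp add: shift_homogeneous(1)[OF homogeneousD(1)[OF f]] N_shift[OF homogeneousD(1)[OF f]])

text \<open>The symbol of the degree \<open>0\<close> part at a point \<open>\<theta>\<close> with trivial stabiliser is isolated by
  compressing \<open>f\<close> with an element \<open>a\<close> whose symbol peaks at \<open>\<theta>\<close>: in \<open>a f a\<close> the part of degree
  \<open>t \<noteq> 0\<close> is multiplied by the product of two peaks at different places.\<close>

lemma norm_symbol_0_le_generic:
  assumes f: "f \<in> carrier A" and T: "T = snd ` supp f - {0}"
    and generic: "\<And>t. t \<in> T \<Longrightarrow> (\<rho> t - 1) * \<theta>1 \<notin> \<int>"
  shows "cmod (symbol f 0 \<theta>1) \<le> N f"
proof -
  have finT: "finite T" using finite_supp[OF f] by (simp add: T)
  \<comment> \<open>A peak of height 1 at \<open>\<theta>1\<close>. A squared cosine has only the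
    frequencies 0, \<open>x\<close> and \<open>- x\<close>, so it is a symbol of degree 0 whenever
    \<open>x\<close> lies in \<open>\<Gamma>\<close>.\<close>
  define c where "c = (\<lambda>x \<theta>. (cos (pi * ((\<theta> - \<theta>1) * x)))\<^sup>2)"
  have c01: "0 \<le> c x \<theta>" "c x \<theta> \<le> 1" for x \<theta> by (auto simp: c_def abs_square_le_1)
  \<comment> \<open>The frequencies are matched: in
    \<open>\<beta> \<theta> * \<beta> (\<theta> * \<rho> t)\<close> the frequency
    \<open>scale t\<close> of the first factor and the frequency 1 of the second give squared
    cosines whose phases differ by \<open>pi * ((\<rho> t - 1) * \<theta>1)\<close>, independently
    of \<open>\<theta>\<close>.\<close>
  define X where "X = insert 1 (scale ` T)"
  have finX: "finite X" using finT by (simp add: X_def)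
  have X\<Gamma>: "X \<subseteq> \<Gamma>" using \<Gamma>_of_int[of 1] \<Gamma>_scale[of 1] by (auto simp: X_def)
  define \<beta> where "\<beta> = (\<lambda>\<theta>. \<Prod>x\<in>X. c (of_rat x) \<theta>)"
  have \<beta>0: "0 \<le> \<beta> \<theta>" for \<theta> unfolding \<beta>_def using c01 by (intro prod_nonneg) auto
  have \<beta>c: "\<beta> \<theta> \<le> c (of_rat x) \<theta>" if x: "x \<in> X" for x \<theta>
  proof -
    have "\<beta> \<theta> = c (of_rat x) \<theta> * (\<Prod>x\<in>X - {x}. c (of_rat x) \<theta>)"
      unfolding \<beta>_def by (rule prod.remove[OF finX x])
    also have "\<dots> \<le> c (of_rat x) \<theta> * 1"
      using c01 by (intro mult_left_mono prod_le_1) auto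
    finally show ?thesis by simp
  qed
  have \<beta>1: "\<beta> \<theta> \<le> 1" for \<theta> using order_trans[OF \<beta>c c01(2), of 1] by (simp add: X_def)
  have \<beta>\<theta>1: "\<beta> \<theta>1 = 1" by (simp add: \<beta>_def c_def)
  define Q where "Q = {u. \<exists>a\<in>homogeneous 0. \<forall>\<theta>. symbol a 0 \<theta> = of_real (u \<theta>)}"
  have Q_mult: "(\<lambda>\<theta>. u \<theta> * v \<theta>) \<in> Q" if uv: "u \<in> Q" "v \<in> Q" for u v
  proof -
    obtain a b where ab: "a \<in> homogeneous 0" "b \<in> homogeneous 0"
      "\<And>\<theta>. symbol a 0 \<theta> = of_real (u \<theta>)" "\<And>\<theta>. symbol b 0 \<theta> = of_real (v \<theta>)"
      using uv unfolding Q_def by blast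
    then have "symbol (a \<otimes>\<^bsub>A\<^esub> b) 0 \<theta> = of_real (u \<theta> * v \<theta>)" for \<theta>
      by (simp add: symbol_mult_0 homogeneousD)
    moreover have "a \<otimes>\<^bsub>A\<^esub> b \<in> homogeneous 0" using homogeneous_mult[OF ab(1,2)] by simp
    ultimately show ?thesis unfolding Q_def by blast
  qed
  have Q_1: "(\<lambda>_. 1) \<in> Q"
    unfolding Q_def using single_homogeneous[OF \<Gamma>_0, of 0]
    by (intro CollectI bexI[of _ "single (0, 0)"]) (auto simp: symbol_single)
  have Q_c: "c (of_rat x) \<in> Q" if x: "x \<in> \<Gamma>" for x
  proof -
    let ?y = "real_of_rat x"
    define a :: "rat \<times> int \<times> int \<Rightarrow> complex" where "a = (\<lambda>z. (1 / 2) * single (0, 0) z + ((e (- \<theta>1 * ?y) / 4) * single (x, 0) z + (e (\<theta>1 * ?y) / 4) * single (- x, 0) z))"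
    note s = single_homogeneous[OF \<Gamma>_0, of 0] single_homogeneous[OF x, of 0] single_homogeneous[OF \<Gamma>_minus[OF x], of 0]
    have "a \<in> homogeneous 0" unfolding a_def by (intro homogeneous_add homogeneous_scale s)
    moreover have "symbol a 0 \<theta> = of_real (c ?y \<theta>)" for \<theta>
    proof -
      have "symbol a 0 \<theta> = 1 / 2 + (e (- \<theta>1 * ?y) / 4 * e (\<theta> * ?y) + e (\<theta>1 * ?y) / 4 * e (\<theta> * of_rat (- x)))"
        unfolding a_def
        by (simp only: symbol_scale symbol_single if_True refl of_rat_0 mult_zero_right e_0 mult_1_right
            symbol_add homogeneousD(1)[OF homogeneous_scale[OF s(1)]]
            homogeneousD(1)[OF homogeneous_scale[OF s(2)]] homogeneousD(1)[OF homogeneous_scale[OF s(3)]]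
            homogeneousD(1)[OF homogeneous_add[OF homogeneous_scale[OF s(2)] homogeneous_scale[OF s(3)]]])
      also have "\<dots> = 1 / 2 + (e ((\<theta> - \<theta>1) * ?y) + e (- ((\<theta> - \<theta>1) * ?y))) / 4"
        by (simp add: of_rat_minus algebra_simps add_divide_distrib flip: e_add)
      also have "e ((\<theta> - \<theta>1) * ?y) + e (- ((\<theta> - \<theta>1) * ?y)) = of_real (2 * Re (e ((\<theta> - \<theta>1) * ?y)))"
        by (simp only: e_minus complex_add_cnj)
      also have "1 / 2 + complex_of_real (2 * Re (e ((\<theta> - \<theta>1) * ?y))) / 4 =
          of_real (1 / 2 + 2 * Re (e ((\<theta> - \<theta>1) * ?y)) / 4)"
        by simp
      also have "1 / 2 + 2 * Re (e ((\<theta> - \<theta>1) * ?y)) / 4 = c ?y \<theta>"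
        by (simp add: Re_e c_def diff_divide_distrib)
      finally show ?thesis .
    qed
    ultimately show ?thesis unfolding Q_def by blast
  qed
  have Q_\<beta>: "\<beta> \<in> Q"
  proof -
    have "(\<lambda>\<theta>. \<Prod>x\<in>Y. c (of_rat x) \<theta>) \<in> Q" if "finite Y" "Y \<subseteq> \<Gamma>" for Y
      using that by (induction Y rule: finite_induct) (auto intro!: Q_1 Q_mult Q_c)
    then show ?thesis unfolding \<beta>_def using finX X\<Gamma> by blast
  qed
  have Q_power: "(\<lambda>\<theta>. \<beta> \<theta> ^ k) \<in> Q" for k
    by (induction k) (auto intro!: Q_1 Q_mult Q_\<beta>)
  \<comment> \<open>By the product-to-sum formula, two cosines with constant phase difference have a
    product bounded in modulus by the base of this square, uniformly in \<open>\<theta>\<close>;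
    genericity of \<open>\<theta>1\<close> makes it less than 1.\<close>
  define \<kappa> where "\<kappa> = (\<lambda>t. ((\<bar>cos (pi * ((\<rho> t - 1) * \<theta>1))\<bar> + 1) / 2)\<^sup>2)"
  have \<kappa>: "0 \<le> \<kappa> t" "\<kappa> t < 1" if t: "t \<in> T" for t
  proof -
    have "\<bar>cos (pi * ((\<rho> t - 1) * \<theta>1))\<bar> \<noteq> 1"
    proof
      assume "\<bar>cos (pi * ((\<rho> t - 1) * \<theta>1))\<bar> = 1"
      then have "(cos (pi * ((\<rho> t - 1) * \<theta>1)))\<^sup>2 = 1" by (metis power2_abs power_one)
      then have "sin (pi * ((\<rho> t - 1) * \<theta>1)) = 0" using sin_cos_squared_add[of "pi * ((\<rho> t - 1) * \<theta>1)"] by simp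
      then have "(\<rho> t - 1) * \<theta>1 \<in> \<int>" by (simp add: mult.commute[of pi] sin_times_pi_eq_0)
      then show False using generic[OF t] by simp
    qed
    then have "\<bar>cos (pi * ((\<rho> t - 1) * \<theta>1))\<bar> < 1" using abs_cos_le_one[of "pi * ((\<rho> t - 1) * \<theta>1)"] by linarith
    then show "\<kappa> t < 1" unfolding \<kappa>_def by (subst abs_square_less_1) simp
  qed (simp add: \<kappa>_def)
  have \<beta>\<beta>: "\<beta> \<theta> * \<beta> (\<theta> * \<rho> t) \<le> \<kappa> t" if t: "t \<in> T" for t \<theta>
  proof -
    define \<alpha> where "\<alpha> = pi * ((\<theta> - \<theta>1) * \<rho> t)"
    define \<psi> where "\<psi> = pi * ((\<rho> t - 1) * \<theta>1)"
    have "\<beta> \<theta> \<le> (cos \<alpha>)\<^sup>2" using \<beta>c[of "scale t" \<theta>] t by (simp add: X_def of_rat_scale c_def \<alpha>_def)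
    moreover have "\<beta> (\<theta> * \<rho> t) \<le> (cos (\<alpha> + \<psi>))\<^sup>2"
      using \<beta>c[of 1 "\<theta> * \<rho> t"] by (simp add: X_def c_def \<alpha>_def \<psi>_def algebra_simps)
    ultimately have "\<beta> \<theta> * \<beta> (\<theta> * \<rho> t) \<le> (cos \<alpha>)\<^sup>2 * (cos (\<alpha> + \<psi>))\<^sup>2"
      using \<beta>0 by (intro mult_mono) auto
    also have "\<dots> = \<bar>cos \<alpha> * cos (\<alpha> + \<psi>)\<bar>\<^sup>2" by (simp add: power_mult_distrib)
    also have "\<dots> \<le> ((\<bar>cos \<psi>\<bar> + 1) / 2)\<^sup>2"
    proof (rule power_mono)
      have "cos \<alpha> * cos (\<alpha> + \<psi>) = (cos (\<alpha> - (\<alpha> + \<psi>)) + cos (\<alpha> + (\<alpha> + \<psi>))) / 2" by (rule cos_times_cos)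
      also have "\<dots> = (cos \<psi> + cos (2 * \<alpha> + \<psi>)) / 2" by simp
      finally have eq: "cos \<alpha> * cos (\<alpha> + \<psi>) = (cos \<psi> + cos (2 * \<alpha> + \<psi>)) / 2" .
      have "\<bar>cos \<psi> + cos (2 * \<alpha> + \<psi>)\<bar> \<le> \<bar>cos \<psi>\<bar> + 1"
        using abs_cos_le_one[of "2 * \<alpha> + \<psi>"] by linarith
      then show "\<bar>cos \<alpha> * cos (\<alpha> + \<psi>)\<bar> \<le> (\<bar>cos \<psi>\<bar> + 1) / 2" unfolding eq by simp
    qed simp
    finally show ?thesis by (simp add: \<kappa>_def \<psi>_def)
  qed
  define L where "L = (\<Sum>x\<in>supp f. cmod (f x))"
  have L: "0 \<le> L" by (simp add: L_def sum_nonneg)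
  have bound: "cmod (symbol f 0 \<theta>1) \<le> N f + (\<Sum>t\<in>T. L * \<kappa> t ^ k)" for k
  proof -
    obtain a where a: "a \<in> homogeneous 0" "\<And>\<theta>. symbol a 0 \<theta> = of_real (\<beta> \<theta> ^ k)"
      using Q_power[of k] by (auto simp: Q_def)
    note aA = homogeneousD(1)[OF a(1)]
    have "N a \<le> 1"
      using \<beta>0 \<beta>1 by (intro N_homogeneous_0_le a(1)) (simp add: a(2) norm_power power_le_one)
    define g where "g = a \<otimes>\<^bsub>A\<^esub> f \<otimes>\<^bsub>A\<^esub> a"
    have g: "g \<in> carrier A" unfolding g_def using aA f by (intro mult_closed)
    have "N g \<le> N a * N f * N a"
      unfolding g_def using N_mult[OF mult_closed[OF aA f] aA] N_mult[OF aA f] N_nonneg[OF aA]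
      by (meson mult_right_mono order_trans)
    also have "\<dots> \<le> 1 * N f * 1"
      using \<open>N a \<le> 1\<close> N_nonneg[OF aA] N_nonneg[OF f] by (intro mult_mono) auto
    finally have Ng: "N g \<le> N f" by simp
    have sym: "symbol g t \<theta> = of_real (\<beta> \<theta> ^ k) * symbol f t \<theta> * of_real (\<beta> (\<theta> * \<rho> t) ^ k)" for t \<theta>
      using symbol_mult_right[OF mult_closed[OF aA f] a(1), of t \<theta>] symbol_mult_left[OF a(1) f, of t \<theta>]
      by (simp add: g_def a(2))
    have "snd z \<in> insert 0 T" if z: "z \<in> supp g" for z
    proof -
      obtain x s y r where 1: "(x, s) \<in> supp (a \<otimes>\<^bsub>A\<^esub> f)" "(y, r) \<in> supp a" "z = (x + scale s * y, s + r)"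
        using z unfolding g_def by (rule supp_multE)
      obtain x' s' y' r' where 2: "(x', s') \<in> supp a" "(y', r') \<in> supp f" "(x, s) = (x' + scale s' * y', s' + r')"
        using 1(1) by (rule supp_multE)
      have "r = 0" "s' = 0" using homogeneousD(2)[OF a(1)] 1 2 by auto
      then have "snd z \<in> snd ` supp f" using 1 2 by (auto intro: rev_image_eqI)
      then show ?thesis by (auto simp: T)
    qed
    then have supp_g: "snd ` supp g \<subseteq> insert 0 T" by (rule image_subsetI)
    have "0 \<notin> T" by (simp add: T)
    \<comment> \<open>Contractivity of the projection to degree 0 is not yet known for
      \<open>N\<close>, so the other parts are subtracted from \<open>g\<close> instead; their norms
      decay geometrically in \<open>k\<close>.\<close>
    have "part 0 g x = g x + (\<Sum>t\<in>T. (-1) * part t g x)" for x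
      using sum_parts[OF _ supp_g, of x] finT \<open>0 \<notin> T\<close> by (simp add: sum_negf)
    then have "part 0 g = (\<lambda>x. g x + (\<Sum>t\<in>T. (-1) * part t g x))" by blast
    moreover have part_A: "part t g \<in> carrier A" for t using part_homogeneous[OF g] by (rule homogeneousD)
    ultimately have "N (part 0 g) \<le> N g + N (\<lambda>x. \<Sum>t\<in>T. (-1) * part t g x)"
      using g by (simp only:) (intro N_add group_algebra_sum_closed group_algebra_scale_closed)
    also have "N (\<lambda>x. \<Sum>t\<in>T. (-1) * part t g x) \<le> (\<Sum>t\<in>T. N (\<lambda>x. (-1) * part t g x))"
      using finT part_A by (intro N_sum group_algebra_scale_closed)
    also have "(\<Sum>t\<in>T. N (\<lambda>x. (-1) * part t g x)) = (\<Sum>t\<in>T. N (part t g))"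
      by (simp only: N_scale[OF part_A]) simp
    also have "\<dots> \<le> (\<Sum>t\<in>T. L * \<kappa> t ^ k)"
    proof (intro sum_mono N_homogeneous_le[OF part_homogeneous[OF g]])
      fix t \<theta> assume t: "t \<in> T"
      have "cmod (symbol (part t g) t \<theta>) = cmod (symbol f t \<theta>) * (\<beta> \<theta> * \<beta> (\<theta> * \<rho> t)) ^ k"
        using \<beta>0 by (simp add: symbol_part[OF g] sym norm_mult norm_power power_mult_distrib)
      also have "\<dots> \<le> L * \<kappa> t ^ k"
        unfolding L_def using \<beta>0 \<beta>\<beta>[OF t] by (intro mult_mono norm_symbol_le power_mono) (auto intro: sum_nonneg)
      finally show "cmod (symbol (part t g) t \<theta>) \<le> L * \<kappa> t ^ k" .
    qed
    finally have "N (part 0 g) \<le> N f + (\<Sum>t\<in>T. L * \<kappa> t ^ k)" using Ng by linarith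
    moreover have "cmod (symbol f 0 \<theta>1) \<le> N (part 0 g)"
      using norm_symbol_homogeneous_0_le[OF part_homogeneous[OF g], of \<theta>1]
      by (simp add: symbol_part[OF g] sym \<beta>\<theta>1)
    ultimately show ?thesis by linarith
  qed
  have "(\<lambda>k. N f + (\<Sum>t\<in>T. L * \<kappa> t ^ k)) \<longlonglongrightarrow> N f + (\<Sum>t\<in>T. L * 0)"
    using \<kappa> by (intro tendsto_intros LIMSEQ_realpow_zero) auto
  then have "cmod (symbol f 0 \<theta>1) \<le> N f + (\<Sum>t\<in>T. L * 0)"
    using bound by (intro LIMSEQ_le_const) auto
  then show ?thesis by simp
qed

text \<open>Since \<open>\<rho> t\<close> differs from 1, each degree \<open>t\<close> excludes only
  one arithmetic progression of points. The complement of a countable set is dense, and the symbol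
  is continuous.\<close>

lemma norm_symbol_0_le:
  assumes f: "f \<in> carrier A"
  shows "cmod (symbol f 0 \<theta>) \<le> N f"
proof -
  define T where "T = snd ` supp f - {0}"
  have finT: "finite T" using finite_supp[OF f] by (simp add: T_def)
  define bad where "bad = (\<Union>t\<in>T. \<Union>n::int. {of_int n / (\<rho> t - 1)})"
  have "countable bad" unfolding bad_def by (auto intro!: countable_UN countable_finite[OF finT])
  let ?S = "{\<theta>. cmod (symbol f 0 \<theta>) \<le> N f}"
  have sub: "- bad \<subseteq> ?S"
  proof
    fix \<theta> assume \<theta>: "\<theta> \<in> - bad"
    have "(\<rho> t - 1) * \<theta> \<notin> \<int>" if t: "t \<in> T" for t
    proof
      assume "(\<rho> t - 1) * \<theta> \<in> \<int>"
      then obtain n where "(\<rho> t - 1) * \<theta> = of_int n" by (elim Ints_cases)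
      moreover have "\<rho> t - 1 \<noteq> 0" using t \<rho>_eq_1_iff[of t] by (simp add: T_def)
      ultimately have "\<theta> = of_int n / (\<rho> t - 1)" by (simp add: field_simps)
      then show False using \<theta> t by (auto simp: bad_def)
    qed
    then show "\<theta> \<in> ?S" using norm_symbol_0_le_generic[OF f T_def] by simp
  qed
  have "\<theta> \<in> closure ?S"
    unfolding closure_approachable
  proof (intro allI impI)
    fix \<epsilon> :: real assume "\<epsilon> > 0"
    then have "uncountable ({\<theta><..<\<theta> + \<epsilon>} - bad)"
      using \<open>countable bad\<close> by (intro uncountable_minus_countable uncountable_open_interval[THEN iffD2]) auto
    then have "{\<theta><..<\<theta> + \<epsilon>} - bad \<noteq> {}" by (metis countable_empty)
    then obtain y where "y \<in> {\<theta><..<\<theta> + \<epsilon>}" "y \<notin> bad" by blast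
    then show "\<exists>y\<in>?S. dist y \<theta> < \<epsilon>" using sub by (intro bexI[of _ y]) (auto simp: dist_real_def)
  qed
  moreover have "closed ?S"
    by (intro closed_Collect_le continuous_intros continuous_on_symbol)
  ultimately show ?thesis by simp
qed

lemma norm_symbol_le_N:
  assumes f: "f \<in> carrier A"
  shows "cmod (symbol f t \<theta>) \<le> N f"
proof -
  have "f \<otimes>\<^bsub>A\<^esub> single (0, - t) \<in> carrier A"
    by (intro mult_closed f homogeneousD(1)[OF single_homogeneous[OF \<Gamma>_0]])
  then show ?thesis
    using norm_symbol_0_le[of "f \<otimes>\<^bsub>A\<^esub> single (0, - t)" \<theta>] by (simp add: shift_homogeneous(1)[OF f] N_shift[OF f])
qed

text \<open>The symbols mediate between the norms: \<open>N'\<close> bounds every symbol, and the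
  symbol of a homogeneous part bounds its \<open>N\<close>. The two norms play interchangeable
  roles, so a second application with them exchanged gives equality.\<close>

lemma N_le_Cstar_norm:
  assumes N': "is_Cstar_norm G N'" and f: "f \<in> carrier A"
  shows "N f \<le> N' f"
proof -
  interpret N': pq_Cstar p q N' by unfold_locales (rule N')
  define h where "h = st f \<otimes>\<^bsub>A\<^esub> f"
  have hA: "h \<in> carrier A" unfolding h_def using f by (intro mult_closed star_closed)
  have sa: "st h = h" using f star_closed[OF f] by (simp add: h_def star_mult star_star)
  \<comment> \<open>Only the Z^2 coordinate is confined: the number of degrees grows quadratically,
    whereas the supports in \<open>\<Gamma>\<close> may grow exponentially under the
    dilations.\<close>
  define S where "S = (\<lambda>R. UNIV \<times> ({- int R..int R} \<times> {- int R..int R}) :: (rat \<times> int \<times> int) set)"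
  have S_mult: "x \<otimes>\<^bsub>G\<^esub> y \<in> S (2 * a)" if "x \<in> S a" "y \<in> S a" for x y a
    using that by (cases x; cases y) (auto simp: S_def mult_G)
  obtain R where R: "supp h \<subseteq> S R"
  proof -
    define R where "R = (\<Sum>z\<in>supp h. nat \<bar>fst (snd z)\<bar> + nat \<bar>snd (snd z)\<bar>)"
    have "z \<in> S R" if z: "z \<in> supp h" for z
    proof -
      have "nat \<bar>fst (snd z)\<bar> + nat \<bar>snd (snd z)\<bar> \<le> R"
        unfolding R_def using finite_supp[OF hA] z by (intro member_le_sum) auto
      then show ?thesis by (cases z) (auto simp: S_def)
    qed
    then show ?thesis using that by blast
  qed
  have "N h \<le> N' h"
  proof (rule N_le_of_growth[OF hA sa N'.N_nonneg])
    fix n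
    let ?g = "iter_square n h" and ?R = "2 ^ n * R"
    have g: "?g \<in> carrier A" by (rule iter_square_selfadjoint[OF hA sa])
    show "N' (iter_square (Suc n) h) \<le> (N' ?g)\<^sup>2"
      using N'.N_mult[OF g g] by (simp add: power2_eq_square)
    have supp: "supp ?g \<subseteq> S ?R" by (rule supp_iter_square[OF R S_mult])
    let ?T = "snd ` supp ?g"
    have finT: "finite ?T" using finite_supp[OF g] by simp
    have part_A: "part t ?g \<in> carrier A" for t using part_homogeneous[OF g] by (rule homogeneousD)
    have "?g = (\<lambda>x. \<Sum>t\<in>?T. part t ?g x)" using sum_parts[OF finT subset_refl] by blast
    then have "N ?g = N (\<lambda>x. \<Sum>t\<in>?T. part t ?g x)" by simp
    also have "\<dots> \<le> (\<Sum>t\<in>?T. N (part t ?g))" using finT part_A by (intro N_sum)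
    also have "\<dots> \<le> (\<Sum>t\<in>?T. N' ?g)"
      by (intro sum_mono N_homogeneous_le[OF part_homogeneous[OF g]])
        (simp add: symbol_part[OF g] N'.norm_symbol_le_N[OF g])
    also have "\<dots> = real (card ?T) * N' ?g" by simp
    also have "\<dots> \<le> (real (2 * R + 1) * 2 ^ n)\<^sup>2 * N' ?g"
    proof (rule mult_right_mono[OF _ N'.N_nonneg[OF g]])
      have card: "card {- int r..int r} = 2 * r + 1" for r unfolding card_atLeastAtMost_int by linarith
      have "?T \<subseteq> {- int ?R..int ?R} \<times> {- int ?R..int ?R}" using supp by (auto simp: S_def)
      then have "card ?T \<le> card ({- int ?R..int ?R} \<times> {- int ?R..int ?R})" by (intro card_mono) auto
      also have "card ({- int ?R..int ?R} \<times> {- int ?R..int ?R}) = (2 * ?R + 1)\<^sup>2"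
        by (simp only: card card_cartesian_product power2_eq_square)
      also have "\<dots> \<le> ((2 * R + 1) * 2 ^ n)\<^sup>2" by (intro power_mono) (auto simp: algebra_simps)
      finally have "real (card ?T) \<le> real (((2 * R + 1) * 2 ^ n)\<^sup>2)" by (rule of_nat_mono)
      then show "real (card ?T) \<le> (real (2 * R + 1) * 2 ^ n)\<^sup>2"
        by (simp only: of_nat_power of_nat_mult[of _ "2 ^ n"] of_nat_numeral)
    qed
    finally show "N ?g \<le> (real (2 * R + 1) * 2 ^ n)\<^sup>2 * N' ?g" .
  qed
  then have "(N f)\<^sup>2 \<le> (N' f)\<^sup>2" using f by (simp add: h_def N_star_mult N'.N_star_mult)
  then show ?thesis using N'.N_nonneg[OF f] by (rule power2_le_imp_le)
qed

end

lemma is_Cstar_norm_restrict: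
  assumes "group G" "is_Cstar_norm G N"
  shows "is_Cstar_norm G (restrict N (carrier (group_algebra G)))"
proof -
  interpret group G by fact
  interpret A: ring A by (rule ring_group_algebra)
  show ?thesis
    using assms(2)
    by (simp add: is_Cstar_norm_def Let_def star_closed group_algebra_scale_closed)
qed

theorem theorem2p5:
  fixes p q :: int
  assumes "p \<ge> 2" and "q \<ge> 2"
    and "\<not> (\<exists>r s :: nat. r > 0 \<and> s > 0 \<and> p ^ r = q ^ s)"
  shows "algebraically_Cstar_unique
           (semidirect_product (Z_inverting (p * q)) (integer_group \<times>\<times> integer_group)
              (pq_action p q))"
proof -
  interpret pq_setting p q by unfold_locales (use assms in auto)
  have "\<exists>!N. N \<in> extensional (carrier A) \<and> is_Cstar_norm G N"
  proof (rule ex1I)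
    show "restrict reduced_norm (carrier A) \<in> extensional (carrier A) \<and>
        is_Cstar_norm G (restrict reduced_norm (carrier A))"
      using is_Cstar_norm_restrict[OF is_group is_Cstar_norm_reduced_norm] by simp
    then have N0: "is_Cstar_norm G (restrict reduced_norm (carrier A))" by blast
    fix N assume N: "N \<in> extensional (carrier A) \<and> is_Cstar_norm G N"
    interpret N: pq_Cstar p q N by unfold_locales (use N in blast)
    interpret N0: pq_Cstar p q "restrict reduced_norm (carrier A)" by unfold_locales (rule N0)
    show "N = restrict reduced_norm (carrier A)"
    proof (rule extensionalityI)
      fix f assume f: "f \<in> carrier A"
      show "N f = restrict reduced_norm (carrier A) f"
        using N.N_le_Cstar_norm[OF N0 f] N0.N_le_Cstar_norm[OF _ f] N by (intro antisym) auto
    qed (use N in auto)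
  qed
  then show ?thesis by (simp add: algebraically_Cstar_unique_def G_def)
qed

end
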